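(* Let $N\ge2$ and let $X$ be the Walsh spider with $N$ legs. Then for every $f\in\operatorname{Dom}\mathcal E$, $$\sqrt{\Gamma(e^{t\Delta}f)}\le(N-1)\,e^{t\Delta}\sqrt{\Gamma(f)}\quad\mu\text{-a.e.},\qquad t\ge0,$$ and the constant $N-1$ is optimal: if $C$ is a constant such that $\sqrt{\Gamma(e^{t\Delta}f)}\le C\,e^{t\Delta}\sqrt{\Gamma(f)}$ for all $f\in\operatorname{Dom}\mathcal E$ and all $t\ge0$, then $C\ge N-1$.
   Context: The Walsh spider with $N$ legs is the metric graph consisting of $N$ copies $I_1,\dots,I_N$ of $[0,+\infty)$ identified at their respective points $0$; $\mu$ is Lebesgue measure on each leg, and functions are written $f=(f_1,\dots,f_N)$. $\operatorname{Dom}\mathcal E$ is the set of $f\in L^2(X,\mu)$ with $f_j\in H^1([0,\infty))$ for all $j$ and $f_1(0)=\dots=f_N(0)$; $\mathcal E(f,g)=\sum_j\int_0^\infty f_j'g_j'\,dx$; $\Gamma(f)=(f')^2$ on each leg. $\Delta$ is the nonpositive self-adjoint generator of $\mathcal E$ ($\mathcal E(u,v)=-\int v\Delta u\,d\mu$), i.e. $\Delta f=f''$ with the Kirchhoff condition $\sum_jf_j'(0)=0$. *)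

theory Defs
  imports "HOL-Analysis.Analysis"
begin

(* A function on the spider with N legs is the tuple of its restrictions f j to the legs j < N,
   each a function on {0..}; values for j \<ge> N or x < 0 are irrelevant.  The common vertex is a null
   set, so the gluing only enters through the vertex condition in Dom_E.  Elements of L2 are
   represented by functions, and every notion below is invariant under a.e. equality. *)

type_synonym spider_fun = "nat \<Rightarrow> real \<Rightarrow> real"

abbreviation leg :: "real measure" where
  "leg \<equiv> lebesgue_on {0..}"

definition L2_leg :: "(real \<Rightarrow> real) set" where
  "L2_leg = {g. g \<in> borel_measurable leg \<and> integrable leg (\<lambda>x. (g x)\<^sup>2)}"

definition L2 :: "nat \<Rightarrow> spider_fun set" where
  "L2 N = {f. \<forall>j<N. f j \<in> L2_leg}"

definition L2_inner :: "nat \<Rightarrow> spider_fun \<Rightarrow> spider_fun \<Rightarrow> real" where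
  "L2_inner N f g = (\<Sum>j<N. \<integral>x. f j x * g j x \<partial>leg)"

definition L2_norm :: "nat \<Rightarrow> spider_fun \<Rightarrow> real" where
  "L2_norm N f = sqrt (L2_inner N f f)"

definition AE_eq :: "nat \<Rightarrow> spider_fun \<Rightarrow> spider_fun \<Rightarrow> bool" where
  "AE_eq N f g \<longleftrightarrow> (\<forall>j<N. AE x in leg. f j x = g j x)"


subsection \<open>The Sobolev space of the half-line\<close>

text \<open>Weak derivatives are tested against $C^1_c((0,\infty))$.\<close>

definition test_fun :: "(real \<Rightarrow> real) \<Rightarrow> bool" where
  "test_fun \<phi> \<longleftrightarrow> \<phi> C1_differentiable_on UNIV \<and>
     compact (closure {x. \<phi> x \<noteq> 0}) \<and> closure {x. \<phi> x \<noteq> 0} \<subseteq> {0<..}"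

definition has_weak_deriv :: "(real \<Rightarrow> real) \<Rightarrow> (real \<Rightarrow> real) \<Rightarrow> bool" where
  "has_weak_deriv f g \<longleftrightarrow>
     (\<forall>\<phi>. test_fun \<phi> \<longrightarrow> (\<integral>x. f x * deriv \<phi> x \<partial>leg) = - (\<integral>x. g x * \<phi> x \<partial>leg))"

definition H1_leg :: "(real \<Rightarrow> real) set" where
  "H1_leg = {f \<in> L2_leg. \<exists>g\<in>L2_leg. has_weak_deriv f g}"

definition weak_deriv :: "(real \<Rightarrow> real) \<Rightarrow> real \<Rightarrow> real" where
  "weak_deriv f = (SOME g. g \<in> L2_leg \<and> has_weak_deriv f g)"

text \<open>The value at 0 of the continuous representative.\<close>

definition value_at_0 :: "(real \<Rightarrow> real) \<Rightarrow> real" where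
  "value_at_0 f =
     (THE c. \<exists>h. continuous_on {0..} h \<and> (AE x in leg. h x = f x) \<and> h 0 = c)"


subsection \<open>Dirichlet form, energy density and Laplacian\<close>

definition Dom_E :: "nat \<Rightarrow> spider_fun set" where
  "Dom_E N = {f \<in> L2 N. (\<forall>j<N. f j \<in> H1_leg) \<and>
     (\<forall>i<N. \<forall>j<N. value_at_0 (f i) = value_at_0 (f j))}"

definition E_form :: "nat \<Rightarrow> spider_fun \<Rightarrow> spider_fun \<Rightarrow> real" where
  "E_form N f g = (\<Sum>j<N. \<integral>x. weak_deriv (f j) x * weak_deriv (g j) x \<partial>leg)"

definition Gam :: "spider_fun \<Rightarrow> spider_fun" where
  "Gam f = (\<lambda>j x. (weak_deriv (f j) x)\<^sup>2)"

text \<open>The graph of the generator of the form: \<open>u\<close> is in the domain and its image is \<open>w\<close>.\<close>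

definition is_Laplacian :: "nat \<Rightarrow> spider_fun \<Rightarrow> spider_fun \<Rightarrow> bool" where
  "is_Laplacian N u w \<longleftrightarrow> u \<in> Dom_E N \<and> w \<in> L2 N \<and>
     (\<forall>v\<in>Dom_E N. E_form N u v = - L2_inner N v w)"


subsection \<open>The heat semigroup\<close>

definition C0_semigroup :: "nat \<Rightarrow> (real \<Rightarrow> spider_fun \<Rightarrow> spider_fun) \<Rightarrow> bool" where
  "C0_semigroup N P \<longleftrightarrow>
     (\<forall>t\<ge>0. \<forall>f\<in>L2 N. P t f \<in> L2 N) \<and>
     (\<forall>t\<ge>0. \<forall>f\<in>L2 N. \<forall>g\<in>L2 N. \<forall>a b. AE_eq N (P t (\<lambda>j x. a * f j x + b * g j x))
                                              (\<lambda>j x. a * P t f j x + b * P t g j x)) \<and>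
     (\<forall>t\<ge>0. \<exists>M. \<forall>f\<in>L2 N. L2_norm N (P t f) \<le> M * L2_norm N f) \<and>
     (\<forall>f\<in>L2 N. AE_eq N (P 0 f) f) \<and>
     (\<forall>s\<ge>0. \<forall>t\<ge>0. \<forall>f\<in>L2 N. AE_eq N (P (s + t) f) (P s (P t f))) \<and>
     (\<forall>f\<in>L2 N. ((\<lambda>t. L2_norm N (\<lambda>j x. P t f j x - f j x)) \<longlongrightarrow> 0) (at_right 0))"

definition infinitesimal_generator ::
    "nat \<Rightarrow> (real \<Rightarrow> spider_fun \<Rightarrow> spider_fun) \<Rightarrow> spider_fun \<Rightarrow> spider_fun \<Rightarrow> bool" where
  "infinitesimal_generator N P u w \<longleftrightarrow> u \<in> L2 N \<and> w \<in> L2 N \<and>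
     ((\<lambda>t. L2_norm N (\<lambda>j x. (P t u j x - u j x) / t - w j x)) \<longlongrightarrow> 0) (at_right 0)"

text \<open>The semigroup $e^{t\Delta}$ is the strongly continuous semigroup on $L^2$ whose generator is
  $\Delta$; it is determined up to a.e. equality of its values.\<close>

definition heat :: "nat \<Rightarrow> real \<Rightarrow> spider_fun \<Rightarrow> spider_fun" where
  "heat N = (SOME P. C0_semigroup N P \<and>
     (\<forall>u w. infinitesimal_generator N P u w \<longleftrightarrow> is_Laplacian N u w))"

end

theory Submission
  imports Defs "HOL-Probability.Probability" "HOL-Real_Asymp.Real_Asymp"
begin

text \<open>
  Reflect at the vertex.  With $\bar f = \frac1N \sum_i f_i$, extend $f_j$ to the line by
  $2 \bar f - f_j$ evaluated at $-y$ for $y < 0$ (\<open>unfold\<close>).  Convolution with an even kernel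
  preserves this symmetry, and the unfolding is $\sqrt 2$ times an isometry into $N$ copies of
  $L^2(\mathbb R)$; so the heat flow on leg $j$ is the Gaussian convolution
  $P_t f = p_t * e_j$, with $e_j$ the extension of $f_j$.

  For $f$ in the form domain the extension is continuous at the vertex, so $(P_t f)_j' =
  p_t * e_j'$ (\<open>spread_H1\<close>), where $e_j'$ is $f_j'$ for $y > 0$ and $f_j' - 2 \bar f'$ at $-y$
  for $y < 0$.  Write $p = p_t(x - y)$, $q = p_t(x + y) \le p$ and $a_i = |f_i'(y)|$, where
  $x, y > 0$.  The weights of the $a_i$ in the bound for $|(P_t f)_j'|(x)$ are
  $p + (1 - 2/N) q$ for $i = j$ and $2q/N$ otherwise; in $P_t |f'|$ they are
  $p - (1 - 2/N) q$ and $2q/N$.  Since $q \le p$, the former are at most $N - 1$ times the latter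
  (\<open>conv_unfold_deriv_le\<close>).  At $x = 0$, where $p = q$, the weights of $a_j$ are
  $2 - 2/N$ and $2/N$, with ratio exactly $N - 1$.  Functions supported on a single leg whose
  derivative is essentially positive make the bound sharp there (\<open>gradient_bound_optimal\<close>);
  the estimate reaches the vertex by continuity.

  It remains to identify \<open>heat\<close>, the strongly continuous semigroup generated by $\Delta$, with
  this explicit semigroup.  Let $R f = r * e_j$ with $r(x) = \frac12 e^{-|x|}$.  One checks that
  $\Delta R f = R f - f$ in the form sense (\<open>resolvent_Laplacian\<close>: Kirchhoff holds because $r'$
  is odd and $\sum_j e_j$ is even), and that $R f$ is in the domain of the generator $G$ of $P_t$
  with $G R f = R f - f$ (\<open>resolvent_generator\<close>: the kernel $(e^t r - p_t * r)/t$ is an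
  approximate identity).  Both operators are dissipative, so $1 - \Delta$ and $1 - G$ are injective
  and $\Delta = G$ (\<open>heat_sg_generator\<close>).  Conversely, if two strongly continuous semigroups have
  generator $\Delta$, then the norm of the difference of two orbits starting at the same point of
  the domain has nonpositive right derivative.  Orbits are continuous from the left by a Baire
  argument (\<open>C0_left_continuous\<close>), so the difference vanishes (\<open>heat_eq\<close>).

  Weak derivatives enter through the lemma of du Bois-Reymond (\<open>weak_deriv_imp_prim\<close>): $H^1$
  functions on the half-line are primitives of square-integrable functions.
\<close>

section \<open>Square-integrable functions\<close>

text \<open>The square-integrable functions of a measure, as functions rather than classes.\<close>

definition sqi :: "'a measure \<Rightarrow> ('a \<Rightarrow> real) set" where
  "sqi M = {g \<in> borel_measurable M. integrable M (\<lambda>x. (g x)\<^sup>2)}"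

lemma L2_leg_sqi: "L2_leg = sqi leg"
  by (auto simp: L2_leg_def sqi_def)

lemma sqiI: "g \<in> borel_measurable M \<Longrightarrow> integrable M (\<lambda>x. (g x)\<^sup>2) \<Longrightarrow> g \<in> sqi M"
  by (simp add: sqi_def)

lemma sqi_measurable[measurable_dest]: "g \<in> sqi M \<Longrightarrow> g \<in> borel_measurable M"
  by (simp add: sqi_def)

lemma sqi_integrable_square: "g \<in> sqi M \<Longrightarrow> integrable M (\<lambda>x. (g x)\<^sup>2)"
  by (simp add: sqi_def)

lemma sqi_integrable_mult:
  assumes "f \<in> sqi M" "g \<in> sqi M"
  shows "integrable M (\<lambda>x. f x * g x)"
proof (rule Bochner_Integration.integrable_bound)
  show "integrable M (\<lambda>x. (f x)\<^sup>2 + (g x)\<^sup>2)"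
    using assms by (intro Bochner_Integration.integrable_add sqi_integrable_square)
  show "(\<lambda>x. f x * g x) \<in> borel_measurable M"
    using assms[THEN sqi_measurable] by measurable
  have "\<bar>a * b\<bar> \<le> \<bar>a\<^sup>2 + b\<^sup>2\<bar>" for a b :: real
  proof -
    have "2 * \<bar>a * b\<bar> \<le> a\<^sup>2 + b\<^sup>2"
      using sum_squares_bound[of "\<bar>a\<bar>" "\<bar>b\<bar>"] by (simp add: abs_mult)
    then show ?thesis
      by linarith
  qed
  then show "AE x in M. norm (f x * g x) \<le> norm ((f x)\<^sup>2 + (g x)\<^sup>2)"
    by simp
qed

lemma sqi_add:
  assumes "f \<in> sqi M" "g \<in> sqi M"
  shows "(\<lambda>x. f x + g x) \<in> sqi M"
proof (rule sqiI)
  show "(\<lambda>x. f x + g x) \<in> borel_measurable M"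
    using assms[THEN sqi_measurable] by measurable
  have "integrable M (\<lambda>x. (f x)\<^sup>2 + (g x)\<^sup>2 + 2 * (f x * g x))"
    using assms by (intro Bochner_Integration.integrable_add sqi_integrable_square
        Bochner_Integration.integrable_mult_right sqi_integrable_mult)
  then show "integrable M (\<lambda>x. (f x + g x)\<^sup>2)"
    by (simp add: power2_sum mult.assoc)
qed

lemma sqi_cmult: "f \<in> sqi M \<Longrightarrow> (\<lambda>x. c * f x) \<in> sqi M"
  by (auto simp: sqi_def power_mult_distrib)

lemma sqi_uminus: "f \<in> sqi M \<Longrightarrow> (\<lambda>x. - f x) \<in> sqi M"
  using sqi_cmult[of f M "-1"] by simp

lemma sqi_diff: "f \<in> sqi M \<Longrightarrow> g \<in> sqi M \<Longrightarrow> (\<lambda>x. f x - g x) \<in> sqi M"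
  using sqi_add[of f M "\<lambda>x. - g x"] sqi_uminus[of g M] by simp

lemma sqi_zero: "(\<lambda>x. 0) \<in> sqi M"
  by (simp add: sqi_def)

lemma sqi_sum: "(\<And>i. i \<in> I \<Longrightarrow> f i \<in> sqi M) \<Longrightarrow> (\<lambda>x. \<Sum>i\<in>I. f i x) \<in> sqi M"
  by (induction I rule: infinite_finite_induct) (auto intro: sqi_zero sqi_add)

lemma sqi_abs: "f \<in> sqi M \<Longrightarrow> (\<lambda>x. \<bar>f x\<bar>) \<in> sqi M"
  by (auto simp: sqi_def)

lemma sqi_cong_AE:
  assumes "f \<in> sqi M" "g \<in> borel_measurable M" "AE x in M. f x = g x"
  shows "g \<in> sqi M"
proof (rule sqiI[OF assms(2)])
  show "integrable M (\<lambda>x. (g x)\<^sup>2)"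
    by (rule Bochner_Integration.integrable_cong_AE_imp[OF sqi_integrable_square[OF assms(1)]])
      (use assms in \<open>auto\<close>)
qed

lemma sqi_bound:
  assumes "f \<in> sqi M" "g \<in> borel_measurable M" "AE x in M. \<bar>g x\<bar> \<le> \<bar>f x\<bar>"
  shows "g \<in> sqi M"
proof (rule sqiI[OF assms(2)])
  show "integrable M (\<lambda>x. (g x)\<^sup>2)"
    by (rule Bochner_Integration.integrable_bound[OF sqi_integrable_square[OF assms(1)]])
      (use assms in \<open>auto simp: abs_le_square_iff\<close>)
qed

lemma quadratic_discriminant_bound:
  fixes A B C :: real
  assumes *: "\<And>s t. 0 \<le> A * s\<^sup>2 - 2 * B * s * t + C * t\<^sup>2"
  shows "B\<^sup>2 \<le> A * C"
proof (cases "A = 0")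
  case True
  have "B = 0"
  proof (rule ccontr)
    assume "B \<noteq> 0"
    then show False
      using *[of "(C + 1) / (2 * B)" 1] True by (simp add: field_simps)
  qed
  then show ?thesis
    using True by simp
next
  case False
  then have "A > 0"
    using *[of 1 0] by simp
  have "0 \<le> A * B\<^sup>2 - 2 * B * B * A + C * A\<^sup>2"
    using *[of B A] .
  also have "\<dots> = A * (A * C - B\<^sup>2)"
    by (simp add: power2_eq_square algebra_simps)
  finally show ?thesis
    using \<open>A > 0\<close> by (simp add: zero_le_mult_iff)
qed

lemma Cauchy_Schwarz_integral:
  assumes "f \<in> sqi M" "g \<in> sqi M"
  shows "(\<integral>x. f x * g x \<partial>M)\<^sup>2 \<le> (\<integral>x. (f x)\<^sup>2 \<partial>M) * (\<integral>x. (g x)\<^sup>2 \<partial>M)"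
proof -
  define A B C where "A = (\<integral>x. (f x)\<^sup>2 \<partial>M)" and "B = (\<integral>x. f x * g x \<partial>M)"
    and "C = (\<integral>x. (g x)\<^sup>2 \<partial>M)"
  have *: "0 \<le> A * s\<^sup>2 - 2 * B * s * t + C * t\<^sup>2" for s t
  proof -
    have "0 \<le> (\<integral>x. (s * f x - t * g x)\<^sup>2 \<partial>M)"
      by simp
    also have "\<dots> = (\<integral>x. s\<^sup>2 * (f x)\<^sup>2 - (2 * s * t) * (f x * g x) + t\<^sup>2 * (g x)\<^sup>2 \<partial>M)"
      by (rule Bochner_Integration.integral_cong) (auto simp: power2_eq_square algebra_simps)
    also have "\<dots> = s\<^sup>2 * A - (2 * s * t) * B + t\<^sup>2 * C"
      unfolding A_def B_def C_def using assms
      by (subst Bochner_Integration.integral_add Bochner_Integration.integral_diff;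
          (intro Bochner_Integration.integrable_diff Bochner_Integration.integrable_mult_right
             sqi_integrable_square sqi_integrable_mult)?; simp)+
    finally show ?thesis
      by (simp add: algebra_simps)
  qed
  from quadratic_discriminant_bound[OF this] show ?thesis
    by (simp add: A_def B_def C_def)
qed

lemma integral_square_add_le:
  assumes "f \<in> sqi M" "g \<in> sqi M"
  shows "(\<integral>x. (f x + g x)\<^sup>2 \<partial>M) \<le> 2 * (\<integral>x. (f x)\<^sup>2 \<partial>M) + 2 * (\<integral>x. (g x)\<^sup>2 \<partial>M)"
proof -
  have "(\<integral>x. (f x + g x)\<^sup>2 \<partial>M) \<le> (\<integral>x. 2 * (f x)\<^sup>2 + 2 * (g x)\<^sup>2 \<partial>M)"
    using assms
  proof (intro integral_mono sqi_integrable_square Bochner_Integration.integrable_add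
      Bochner_Integration.integrable_mult_right sqi_add)
    show "(f x + g x)\<^sup>2 \<le> 2 * (f x)\<^sup>2 + 2 * (g x)\<^sup>2" for x
      using sum_squares_bound[of "f x" "g x"] by (simp add: power2_sum)
  qed auto
  also have "\<dots> = 2 * (\<integral>x. (f x)\<^sup>2 \<partial>M) + 2 * (\<integral>x. (g x)\<^sup>2 \<partial>M)"
    using assms by (subst Bochner_Integration.integral_add) (auto intro: sqi_integrable_square)
  finally show ?thesis .
qed

section \<open>Convolution on the line\<close>

lemma lborel_integral_reflect_shift:
  "(\<integral>y. f (x - y) \<partial>lborel) = (\<integral>y. f y \<partial>lborel)" for f :: "real \<Rightarrow> real"
  using lborel_integral_real_affine[of "-1" f x] by simp

lemma lborel_integrable_reflect_shift:
  "integrable lborel (\<lambda>y. f (x - y)) \<longleftrightarrow> integrable lborel f" for f :: "real \<Rightarrow> real"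
  using lborel_integrable_real_affine_iff[of "-1" f x] by simp

lemma lborel_integral_shift:
  "(\<integral>y. f (y + x) \<partial>lborel) = (\<integral>y. f y \<partial>lborel)" for f :: "real \<Rightarrow> real"
  using lborel_integral_real_affine[of 1 f x] by (simp add: add.commute)

lemma lborel_integral_shift_minus:
  "(\<integral>y. f (y - x) \<partial>lborel) = (\<integral>y. f y \<partial>lborel)" for f :: "real \<Rightarrow> real"
  using lborel_integral_shift[of f "-x"] by simp

lemma lborel_integrable_shift:
  "integrable lborel (\<lambda>y. f (y + x)) \<longleftrightarrow> integrable lborel f" for f :: "real \<Rightarrow> real"
  using lborel_integrable_real_affine_iff[of 1 f x] by (simp add: add.commute)

lemma lborel_integrable_shift_minus:
  "integrable lborel (\<lambda>y. f (y - x)) \<longleftrightarrow> integrable lborel f" for f :: "real \<Rightarrow> real"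
  using lborel_integrable_shift[of f "-x"] by simp

lemma lborel_integral_reflect:
  "(\<integral>y. f (- y) \<partial>lborel) = (\<integral>y. f y \<partial>lborel)" for f :: "real \<Rightarrow> real"
  using lborel_integral_reflect_shift[of f 0] by simp

lemma lborel_integrable_reflect:
  "integrable lborel (\<lambda>y. f (- y)) \<longleftrightarrow> integrable lborel f" for f :: "real \<Rightarrow> real"
  using lborel_integrable_reflect_shift[of f 0] by simp

lemma sqi_reflect_shift: "f \<in> sqi lborel \<Longrightarrow> (\<lambda>y. f (x - y)) \<in> sqi lborel" for f :: "real \<Rightarrow> real"
  using lborel_integrable_reflect_shift[of "\<lambda>y. (f y)\<^sup>2" x] by (auto simp: sqi_def)

lemma sqi_reflect: "f \<in> sqi lborel \<Longrightarrow> (\<lambda>y. f (- y)) \<in> sqi lborel" for f :: "real \<Rightarrow> real"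
  using sqi_reflect_shift[of f 0] by simp

lemma sqi_shift: "f \<in> sqi lborel \<Longrightarrow> (\<lambda>y. f (y + x)) \<in> sqi lborel" for f :: "real \<Rightarrow> real"
  using lborel_integrable_shift[of "\<lambda>y. (f y)\<^sup>2" x] by (auto simp: sqi_def)

text \<open>Convolution on the line.  Where the integral diverges the value is 0.\<close>

definition conv :: "(real \<Rightarrow> real) \<Rightarrow> (real \<Rightarrow> real) \<Rightarrow> real \<Rightarrow> real" where
  "conv k g x = (\<integral>y. k (x - y) * g y \<partial>lborel)"

text \<open>Bounded integrable functions are closed under convolution, and they lie in $L^2$,
  so that their convolution with a square-integrable function converges at every point.\<close>

definition bdd_L1 :: "(real \<Rightarrow> real) \<Rightarrow> bool" where
  "bdd_L1 k \<longleftrightarrow> integrable lborel k \<and> (\<exists>B. \<forall>x. \<bar>k x\<bar> \<le> B)"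

lemma bdd_L1_integrable: "bdd_L1 k \<Longrightarrow> integrable lborel k"
  by (simp add: bdd_L1_def)

lemma bdd_L1_measurable[measurable_dest]: "bdd_L1 k \<Longrightarrow> k \<in> borel_measurable borel"
  by (auto simp: bdd_L1_def)

lemma bdd_L1_sqi: assumes "bdd_L1 k" shows "k \<in> sqi lborel"
proof -
  obtain B where B: "\<bar>k x\<bar> \<le> B" for x
    using assms by (auto simp: bdd_L1_def)
  have [measurable]: "k \<in> borel_measurable borel"
    using assms by measurable
  have "integrable lborel (\<lambda>x. (k x)\<^sup>2)"
  proof (rule Bochner_Integration.integrable_bound)
    show "integrable lborel (\<lambda>x. B * k x)"
      using assms by (simp add: bdd_L1_integrable)
    have "\<bar>k x * k x\<bar> \<le> \<bar>B * k x\<bar>" for x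
      unfolding abs_mult using B[of x] by (intro mult_right_mono) auto
    then show "AE x in lborel. norm ((k x)\<^sup>2) \<le> norm (B * k x)"
      by (simp add: power2_eq_square)
  qed simp
  then show ?thesis
    by (simp add: sqi_def)
qed

lemma conv_commute: "conv k g x = conv g k x"
  unfolding conv_def using lborel_integral_reflect_shift[of "\<lambda>y. k (x - y) * g y" x]
  by (simp add: mult.commute)

lemma conv_even:
  assumes "\<And>u. k (- u) = k u" "\<And>u. l (- u) = l u"
  shows "conv k l (- x) = conv k l x"
proof -
  have "conv k l (- x) = (\<integral>y. k (- x - - y) * l (- y) \<partial>lborel)"
    unfolding conv_def by (rule lborel_integral_reflect[symmetric])
  also have "\<dots> = conv k l x"
    using assms(1)[of "x - _"] by (simp add: conv_def assms(2))
  finally show ?thesis .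
qed

lemma conv_measurable[measurable]:
  assumes [measurable]: "k \<in> borel_measurable borel" "g \<in> borel_measurable borel"
  shows "conv k g \<in> borel_measurable borel"
  unfolding conv_def[abs_def] by measurable

lemma conv_integrable:
  fixes k g :: "real \<Rightarrow> real"
  assumes "k \<in> sqi lborel" "g \<in> sqi lborel"
  shows "integrable lborel (\<lambda>y. k (x - y) * g y)"
  by (intro sqi_integrable_mult sqi_reflect_shift assms)

lemma conv_add_right:
  assumes "k \<in> sqi lborel" "g \<in> sqi lborel" "h \<in> sqi lborel"
  shows "conv k (\<lambda>y. a * g y + b * h y) x = a * conv k g x + b * conv k h x"
proof -
  have "conv k (\<lambda>y. a * g y + b * h y) x
      = (\<integral>y. a * (k (x - y) * g y) + b * (k (x - y) * h y) \<partial>lborel)"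
    unfolding conv_def by (rule Bochner_Integration.integral_cong) (auto simp: algebra_simps)
  also have "\<dots> = a * conv k g x + b * conv k h x"
    unfolding conv_def using assms
    by (subst Bochner_Integration.integral_add) (auto intro!: conv_integrable)
  finally show ?thesis .
qed

lemma conv_add_left:
  assumes "k \<in> sqi lborel" "l \<in> sqi lborel" "g \<in> sqi lborel"
  shows "conv (\<lambda>y. a * k y + b * l y) g x = a * conv k g x + b * conv l g x"
  using conv_add_right[OF assms(3,1,2), of a b x] by (simp add: conv_commute[of _ g])

lemma conv_bound:
  assumes "k \<in> sqi lborel" "g \<in> sqi lborel"
  shows "(conv k g x)\<^sup>2 \<le> (\<integral>y. (k y)\<^sup>2 \<partial>lborel) * (\<integral>y. (g y)\<^sup>2 \<partial>lborel)"
  using Cauchy_Schwarz_integral[OF sqi_reflect_shift[OF assms(1), of x] assms(2)]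
  by (simp add: conv_def lborel_integral_reflect_shift[of "\<lambda>y. (k y)\<^sup>2" x])

lemma conv_cong_AE:
  assumes "AE y in lborel. g y = h y" "k \<in> borel_measurable borel"
    "g \<in> borel_measurable borel" "h \<in> borel_measurable borel"
  shows "conv k g x = conv k h x"
  unfolding conv_def using assms by (intro integral_cong_AE) auto

lemma conv_integrable_pair:
  fixes k g :: "real \<Rightarrow> real"
  assumes "integrable lborel k" "integrable lborel g"
  shows "integrable (lborel \<Otimes>\<^sub>M lborel) (\<lambda>(x, y). k (x - y) * g y)"
proof -
  have [measurable]: "k \<in> borel_measurable borel" "g \<in> borel_measurable borel"
    using assms by auto
  have "integrable (lborel \<Otimes>\<^sub>M lborel) (\<lambda>(y, x). k (x - y) * g y)"
  proof (rule lborel_pair.Fubini_integrable)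
    show "(\<lambda>(y, x). k (x - y) * g y) \<in> borel_measurable (lborel \<Otimes>\<^sub>M lborel)"
      by measurable
    have "(\<integral>x. norm (k (x - y) * g y) \<partial>lborel) = (\<integral>x. \<bar>k x\<bar> \<partial>lborel) * \<bar>g y\<bar>" for y
      using lborel_integral_shift_minus[of "\<lambda>x. \<bar>k x\<bar>" y] by (simp add: abs_mult)
    then show "integrable lborel (\<lambda>y. \<integral>x. norm (case (y, x) of (y, x) \<Rightarrow> k (x - y) * g y) \<partial>lborel)"
      using assms by simp
    show "AE y in lborel. integrable lborel (\<lambda>x. case (y, x) of (y, x) \<Rightarrow> k (x - y) * g y)"
      using assms by (simp add: lborel_integrable_shift_minus)
  qed
  then show ?thesis
    by (subst (asm) lborel_pair.integrable_product_swap_iff[symmetric]) (simp add: case_prod_unfold)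
qed

lemma conv_L1:
  assumes "integrable lborel k" "integrable lborel g"
  shows "integrable lborel (conv k g)"
    and "(\<integral>x. conv k g x \<partial>lborel) = (\<integral>x. k x \<partial>lborel) * (\<integral>x. g x \<partial>lborel)"
proof -
  note int = conv_integrable_pair[OF assms]
  show "integrable lborel (conv k g)"
    using lborel_pair.integrable_fst'[OF int] by (simp add: conv_def[abs_def])
  have "(\<integral>x. conv k g x \<partial>lborel) = (\<integral>y. (\<integral>x. k (x - y) * g y \<partial>lborel) \<partial>lborel)"
    unfolding conv_def using lborel_pair.Fubini_integral[of "\<lambda>x y. k (x - y) * g y"] int
    by simp
  also have "\<dots> = (\<integral>x. k x \<partial>lborel) * (\<integral>x. g x \<partial>lborel)"
    by (simp add: lborel_integral_shift_minus)
  finally show "(\<integral>x. conv k g x \<partial>lborel) = (\<integral>x. k x \<partial>lborel) * (\<integral>x. g x \<partial>lborel)" .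
qed

text \<open>Cauchy-Schwarz with respect to the measure with density \<open>\<bar>k\<bar>\<close>: the pointwise
  bound behind Young's inequality.\<close>

lemma weighted_Cauchy_Schwarz:
  fixes k :: "'a \<Rightarrow> real"
  assumes k: "integrable M k" and f[measurable]: "f \<in> borel_measurable M"
    and kf: "integrable M (\<lambda>x. \<bar>k x\<bar> * (f x)\<^sup>2)"
  shows "(\<integral>x. k x * f x \<partial>M)\<^sup>2 \<le> (\<integral>x. \<bar>k x\<bar> \<partial>M) * (\<integral>x. \<bar>k x\<bar> * (f x)\<^sup>2 \<partial>M)"
proof -
  have [measurable]: "k \<in> borel_measurable M"
    using k by auto
  define u where "u = (\<lambda>x. sgn (k x) * sqrt \<bar>k x\<bar>)"
  define v where "v = (\<lambda>x. sqrt \<bar>k x\<bar> * f x)"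
  have u: "(u x)\<^sup>2 = \<bar>k x\<bar>" for x
    by (auto simp: u_def power_mult_distrib sgn_if)
  have v: "(v x)\<^sup>2 = \<bar>k x\<bar> * (f x)\<^sup>2" for x
    by (auto simp: v_def power_mult_distrib)
  have uv: "u x * v x = k x * f x" for x
  proof -
    have "u x * v x = sgn (k x) * (sqrt \<bar>k x\<bar>)\<^sup>2 * f x"
      unfolding u_def v_def power2_eq_square by (simp only: ac_simps)
    then show ?thesis
      by (simp add: sgn_mult_abs)
  qed
  have "u \<in> sqi M" "v \<in> sqi M"
    using k kf by (auto intro!: sqiI simp: u v) (auto simp: u_def v_def)
  from Cauchy_Schwarz_integral[OF this] show ?thesis
    by (simp add: u v uv)
qed

lemma conv_L2:
  assumes k: "bdd_L1 k" and g: "g \<in> sqi lborel"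
  shows "conv k g \<in> sqi lborel"
    and "(\<integral>x. (conv k g x)\<^sup>2 \<partial>lborel) \<le> (\<integral>x. \<bar>k x\<bar> \<partial>lborel)\<^sup>2 * (\<integral>x. (g x)\<^sup>2 \<partial>lborel)"
proof -
  have [measurable]: "k \<in> borel_measurable borel" "g \<in> borel_measurable borel"
    using k sqi_measurable[OF g] by measurable
  obtain B where B: "\<bar>k x\<bar> \<le> B" for x
    using k by (auto simp: bdd_L1_def)
  let ?h = "conv (\<lambda>x. \<bar>k x\<bar>) (\<lambda>y. (g y)\<^sup>2)"
  have abs_k: "integrable lborel (\<lambda>x. \<bar>k x\<bar>)" and g2: "integrable lborel (\<lambda>y. (g y)\<^sup>2)"
    using bdd_L1_integrable[OF k] g by (auto simp: sqi_def)
  note h = conv_L1[OF abs_k g2]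
  have le: "(conv k g x)\<^sup>2 \<le> (\<integral>x. \<bar>k x\<bar> \<partial>lborel) * ?h x" for x
  proof -
    have "integrable lborel (\<lambda>y. \<bar>k (x - y)\<bar> * (g y)\<^sup>2)"
    proof (rule Bochner_Integration.integrable_bound)
      show "integrable lborel (\<lambda>y. B * (g y)\<^sup>2)"
        using g2 by simp
      show "AE y in lborel. norm (\<bar>k (x - y)\<bar> * (g y)\<^sup>2) \<le> norm (B * (g y)\<^sup>2)"
        using B by (intro AE_I2) (auto simp: abs_mult intro!: mult_right_mono order.trans[OF B abs_ge_self])
    qed measurable
    from weighted_Cauchy_Schwarz[OF _ _ this] bdd_L1_integrable[OF k]
    show ?thesis
      by (simp add: conv_def lborel_integrable_reflect_shift lborel_integral_reflect_shift[of "\<lambda>x. \<bar>k x\<bar>"])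
  qed
  have int: "integrable lborel (\<lambda>x. (\<integral>x. \<bar>k x\<bar> \<partial>lborel) * ?h x)"
    using h(1) by simp
  have int2: "integrable lborel (\<lambda>x. (conv k g x)\<^sup>2)"
    by (rule Bochner_Integration.integrable_bound[OF int])
      (use le in \<open>auto intro!: order.trans[OF le abs_ge_self]\<close>)
  then show "conv k g \<in> sqi lborel"
    by (simp add: sqi_def)
  have "(\<integral>x. (conv k g x)\<^sup>2 \<partial>lborel) \<le> (\<integral>x. (\<integral>x. \<bar>k x\<bar> \<partial>lborel) * ?h x \<partial>lborel)"
    by (intro integral_mono int int2 le)
  also have "\<dots> = (\<integral>x. \<bar>k x\<bar> \<partial>lborel)\<^sup>2 * (\<integral>x. (g x)\<^sup>2 \<partial>lborel)"
    by (simp add: h(2) power2_eq_square[of "\<integral>x. \<bar>k x\<bar> \<partial>lborel"])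
  finally show "(\<integral>x. (conv k g x)\<^sup>2 \<partial>lborel) \<le> (\<integral>x. \<bar>k x\<bar> \<partial>lborel)\<^sup>2 * (\<integral>x. (g x)\<^sup>2 \<partial>lborel)" .
qed

lemma bdd_L1_conv:
  assumes "bdd_L1 k" "bdd_L1 l"
  shows "bdd_L1 (conv k l)"
proof -
  have "\<bar>conv k l x\<bar> \<le> sqrt ((\<integral>y. (k y)\<^sup>2 \<partial>lborel) * (\<integral>y. (l y)\<^sup>2 \<partial>lborel))" for x
    using real_sqrt_le_mono[OF conv_bound[OF assms[THEN bdd_L1_sqi], of x]] by simp
  then show ?thesis
    using conv_L1(1)[OF assms[THEN bdd_L1_integrable]] by (auto simp: bdd_L1_def)
qed

lemma bdd_L1_add: "bdd_L1 k \<Longrightarrow> bdd_L1 l \<Longrightarrow> bdd_L1 (\<lambda>x. a * k x + b * l x)"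
proof -
  assume *: "bdd_L1 k" "bdd_L1 l"
  then obtain B C where B: "\<bar>k x\<bar> \<le> B" and C: "\<bar>l x\<bar> \<le> C" for x
    by (auto simp: bdd_L1_def)
  have "\<bar>a * k x + b * l x\<bar> \<le> \<bar>a\<bar> * B + \<bar>b\<bar> * C" for x
    using mult_left_mono[OF B, of "\<bar>a\<bar>" x] mult_left_mono[OF C, of "\<bar>b\<bar>" x]
      abs_triangle_ineq[of "a * k x" "b * l x"] by (simp add: abs_mult)
  then show ?thesis
    using * by (auto simp: bdd_L1_def)
qed

lemma conv_assoc:
  assumes k: "bdd_L1 k" and l: "bdd_L1 l" and g: "g \<in> sqi lborel"
  shows "conv k (conv l g) x = conv (conv k l) g x"
proof -
  have [measurable]: "k \<in> borel_measurable borel" "l \<in> borel_measurable borel" "g \<in> borel_measurable borel"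
    using k l sqi_measurable[OF g] by measurable
  have abs_l: "bdd_L1 (\<lambda>x. \<bar>l x\<bar>)"
    using l by (auto simp: bdd_L1_def)
  have int: "integrable (lborel \<Otimes>\<^sub>M lborel) (\<lambda>(y, z). k (x - y) * (l (y - z) * g z))"
  proof (rule lborel_pair.Fubini_integrable)
    show "(\<lambda>(y, z). k (x - y) * (l (y - z) * g z)) \<in> borel_measurable (lborel \<Otimes>\<^sub>M lborel)"
      by measurable
    have "(\<integral>z. norm (k (x - y) * (l (y - z) * g z)) \<partial>lborel)
        = \<bar>k (x - y)\<bar> * conv (\<lambda>x. \<bar>l x\<bar>) (\<lambda>z. \<bar>g z\<bar>) y" for y
      by (simp add: conv_def abs_mult)
    moreover have "integrable lborel (\<lambda>y. \<bar>k (x - y)\<bar> * conv (\<lambda>x. \<bar>l x\<bar>) (\<lambda>z. \<bar>g z\<bar>) y)"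
      by (intro sqi_integrable_mult sqi_abs sqi_reflect_shift bdd_L1_sqi k conv_L2 abs_l g)
    ultimately show "integrable lborel
        (\<lambda>y. \<integral>z. norm (case (y, z) of (y, z) \<Rightarrow> k (x - y) * (l (y - z) * g z)) \<partial>lborel)"
      by simp
    show "AE y in lborel. integrable lborel (\<lambda>z. case (y, z) of (y, z) \<Rightarrow> k (x - y) * (l (y - z) * g z))"
      using conv_integrable[OF bdd_L1_sqi[OF l] g] by simp
  qed
  have "conv k (conv l g) x = (\<integral>y. (\<integral>z. k (x - y) * (l (y - z) * g z) \<partial>lborel) \<partial>lborel)"
    by (simp add: conv_def)
  also have "\<dots> = (\<integral>z. (\<integral>y. k (x - y) * (l (y - z) * g z) \<partial>lborel) \<partial>lborel)"
    using lborel_pair.Fubini_integral[OF int] by simp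
  also have "\<dots> = (\<integral>z. conv k l (x - z) * g z \<partial>lborel)"
  proof (rule Bochner_Integration.integral_cong[OF refl])
    fix z
    have "(\<integral>y. k (x - y) * (l (y - z) * g z) \<partial>lborel) = (\<integral>y. k (x - y) * l (y - z) \<partial>lborel) * g z"
      by (simp flip: mult.assoc)
    also have "(\<integral>y. k (x - y) * l (y - z) \<partial>lborel) = conv k l (x - z)"
      using lborel_integral_shift[of "\<lambda>y. k (x - y) * l (y - z)" z]
      by (simp add: conv_def diff_diff_eq add.commute)
    finally show "(\<integral>y. k (x - y) * (l (y - z) * g z) \<partial>lborel) = conv k l (x - z) * g z" .
  qed
  finally show ?thesis
    by (simp add: conv_def)
qed

section \<open>Translations and approximate identities\<close>

text \<open>Translation is continuous in $L^1$: it suffices to treat indicators of sets of finite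
  measure, and by outer regularity of open sets, for which dominated convergence applies.\<close>

lemma L1_translation_indicator_open:
  fixes U :: "real set"
  assumes U: "open U" "emeasure lborel U < \<infinity>" and h: "h \<longlonglongrightarrow> 0"
  shows "(\<lambda>n. \<integral>x. \<bar>indicator U (x + h n) - indicator U x :: real\<bar> \<partial>lborel) \<longlonglongrightarrow> 0"
proof -
  have [measurable]: "U \<in> sets borel"
    using U(1) by simp
  have int: "integrable lborel (indicator U :: real \<Rightarrow> real)"
    using U(2) by simp
  define s where "s = (\<lambda>n x. indicator U (x + h n) * indicator U x :: real)"
  have "(\<lambda>n. \<integral>x. s n x \<partial>lborel) \<longlonglongrightarrow> (\<integral>x. indicator U x \<partial>lborel)"
  proof (rule integral_dominated_convergence[where w = "indicator U"])
    show "AE x in lborel. (\<lambda>n. s n x) \<longlonglongrightarrow> indicator U x"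
    proof (rule AE_I2)
      fix x :: real
      show "(\<lambda>n. s n x) \<longlonglongrightarrow> indicator U x"
      proof (cases "x \<in> U")
        case True
        have "(\<lambda>n. x + h n) \<longlonglongrightarrow> x + 0"
          by (intro tendsto_intros h)
        then have "\<forall>\<^sub>F n in sequentially. x + h n \<in> U"
          using topological_tendstoD[of "\<lambda>n. x + h n" x sequentially U] U True by simp
        then have "\<forall>\<^sub>F n in sequentially. s n x = indicator U x"
          by eventually_elim (simp add: s_def True)
        then show ?thesis
          by (rule tendsto_eventually)
      qed (simp add: s_def)
    qed
    show "AE x in lborel. norm (s n x) \<le> indicator U x" for n
      by (simp add: s_def split: split_indicator)
  qed (simp_all add: int s_def)
  then have "(\<lambda>n. 2 * (\<integral>x. indicator U x \<partial>lborel) - 2 * (\<integral>x. s n x \<partial>lborel))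
      \<longlonglongrightarrow> 2 * (\<integral>x. indicator U x \<partial>lborel) - 2 * (\<integral>x. indicator U x \<partial>lborel)"
    by (intro tendsto_intros)
  also have "(\<lambda>n. 2 * (\<integral>x. indicator U x \<partial>lborel) - 2 * (\<integral>x. s n x \<partial>lborel))
     = (\<lambda>n. \<integral>x. \<bar>indicator U (x + h n) - indicator U x :: real\<bar> \<partial>lborel)"
  proof
    fix n
    have int': "integrable lborel (\<lambda>x. indicator U (x + h n) :: real)"
      using lborel_integrable_shift[of "indicator U" "h n"] int by simp
    have ints: "integrable lborel (s n)"
      by (rule Bochner_Integration.integrable_bound[OF int]) (auto simp: s_def split: split_indicator)
    have "(\<integral>x. \<bar>indicator U (x + h n) - indicator U x :: real\<bar> \<partial>lborel)
        = (\<integral>x. indicator U (x + h n) + indicator U x - 2 * s n x \<partial>lborel)"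
      by (intro Bochner_Integration.integral_cong) (auto simp: s_def split: split_indicator)
    also have "\<dots> = 2 * (\<integral>x. indicator U x \<partial>lborel) - 2 * (\<integral>x. s n x \<partial>lborel)"
      using int int' ints lborel_integral_shift[of "indicator U :: real \<Rightarrow> real" "h n"] by simp
    finally show "2 * (\<integral>x. indicator U x \<partial>lborel) - 2 * (\<integral>x. s n x \<partial>lborel)
      = (\<integral>x. \<bar>indicator U (x + h n) - indicator U x :: real\<bar> \<partial>lborel)" ..
  qed
  finally show ?thesis
    by simp
qed

lemma L1_translation_approx:
  fixes f :: "real \<Rightarrow> real"
  assumes f: "integrable lborel f"
    and g: "\<And>e. e > 0 \<Longrightarrow> \<exists>g. integrable lborel g \<and> (\<integral>x. \<bar>f x - g x\<bar> \<partial>lborel) \<le> e \<and>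
        (\<lambda>n. \<integral>x. \<bar>g (x + h n) - g x\<bar> \<partial>lborel) \<longlonglongrightarrow> 0"
  shows "(\<lambda>n. \<integral>x. \<bar>f (x + h n) - f x\<bar> \<partial>lborel) \<longlonglongrightarrow> 0"
proof (rule tendstoI)
  fix e :: real assume "e > 0"
  then obtain g where g: "integrable lborel g" "(\<integral>x. \<bar>f x - g x\<bar> \<partial>lborel) \<le> e / 3"
      "(\<lambda>n. \<integral>x. \<bar>g (x + h n) - g x\<bar> \<partial>lborel) \<longlonglongrightarrow> 0"
    using g[of "e / 3"] by auto
  have "\<forall>\<^sub>F n in sequentially. dist (\<integral>x. \<bar>g (x + h n) - g x\<bar> \<partial>lborel) 0 < e / 3"
    using \<open>e > 0\<close> by (intro tendstoD[OF g(3)]) auto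
  then show "\<forall>\<^sub>F n in sequentially. dist (\<integral>x. \<bar>f (x + h n) - f x\<bar> \<partial>lborel) 0 < e"
  proof eventually_elim
    case (elim n)
    have int: "integrable lborel (\<lambda>x. f (x + h n))" "integrable lborel (\<lambda>x. g (x + h n))"
      using f g by (auto simp: lborel_integrable_shift)
    have "(\<integral>x. \<bar>f (x + h n) - f x\<bar> \<partial>lborel)
        \<le> (\<integral>x. \<bar>f (x + h n) - g (x + h n)\<bar> + \<bar>g (x + h n) - g x\<bar> + \<bar>f x - g x\<bar> \<partial>lborel)"
      using f g int by (intro integral_mono) auto
    also have "\<dots> = (\<integral>x. \<bar>f (x + h n) - g (x + h n)\<bar> \<partial>lborel)
        + (\<integral>x. \<bar>g (x + h n) - g x\<bar> \<partial>lborel) + (\<integral>x. \<bar>f x - g x\<bar> \<partial>lborel)"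
      using f g int by simp
    also have "(\<integral>x. \<bar>f (x + h n) - g (x + h n)\<bar> \<partial>lborel) = (\<integral>x. \<bar>f x - g x\<bar> \<partial>lborel)"
      by (rule lborel_integral_shift)
    also have "(\<integral>x. \<bar>f x - g x\<bar> \<partial>lborel) + (\<integral>x. \<bar>g (x + h n) - g x\<bar> \<partial>lborel)
        + (\<integral>x. \<bar>f x - g x\<bar> \<partial>lborel) < e / 3 + e / 3 + e / 3"
      using elim g(2) by simp
    finally show ?case
      by simp
  qed
qed

lemma L1_translation:
  fixes f :: "real \<Rightarrow> real"
  assumes "integrable lborel f" and h: "h \<longlonglongrightarrow> 0"
  shows "(\<lambda>n. \<integral>x. \<bar>f (x + h n) - f x\<bar> \<partial>lborel) \<longlonglongrightarrow> 0"
  using assms(1)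
proof (induction rule: integrable_induct)
  case (base A c)
  then have [measurable]: "A \<in> sets borel"
    by simp
  have "(\<lambda>n. \<integral>x. \<bar>indicator A (x + h n) - indicator A x :: real\<bar> \<partial>lborel) \<longlonglongrightarrow> 0"
  proof (rule L1_translation_approx)
    show "integrable lborel (indicator A :: real \<Rightarrow> real)"
      using base by simp
    fix e :: real assume "e > 0"
    then obtain U where U: "open U" "A \<subseteq> U" "emeasure lborel (U - A) < e"
      using outer_regular_lborel[of A e] by auto
    have [measurable]: "U \<in> sets borel"
      using U by auto
    have fin: "emeasure lborel U < \<infinity>"
    proof -
      have "emeasure lborel U = emeasure lborel A + emeasure lborel (U - A)"
        using U by (subst plus_emeasure) (auto simp: Un_absorb1)
      also have "\<dots> < \<infinity>"
        using base U(3) by (auto simp: ennreal_add_less_top intro: less_le_trans)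
      finally show ?thesis .
    qed
    have "(\<integral>x. \<bar>indicator A x - indicator U x :: real\<bar> \<partial>lborel) = (\<integral>x. indicator (U - A) x \<partial>lborel)"
      using U(2) by (intro Bochner_Integration.integral_cong) (auto split: split_indicator)
    also have "\<dots> \<le> e"
      using U(3) \<open>e > 0\<close> by (simp add: measure_def enn2real_leI)
    finally show "\<exists>g. integrable lborel g \<and> (\<integral>x. \<bar>indicator A x - g x\<bar> \<partial>lborel) \<le> e \<and>
        (\<lambda>n. \<integral>x. \<bar>g (x + h n) - g x\<bar> \<partial>lborel) \<longlonglongrightarrow> 0"
      using L1_translation_indicator_open[OF U(1) fin h] fin
      by (intro exI[of _ "indicator U"]) auto
  qed
  then have "(\<lambda>n. \<bar>c\<bar> * (\<integral>x. \<bar>indicator A (x + h n) - indicator A x :: real\<bar> \<partial>lborel)) \<longlonglongrightarrow> 0"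
    by (rule tendsto_mult_right_zero)
  moreover have "\<bar>indicator A u *\<^sub>R c - indicator A v *\<^sub>R c\<bar> = \<bar>c\<bar> * \<bar>indicator A u - indicator A v :: real\<bar>" for u v
    unfolding abs_mult[symmetric] by (simp add: algebra_simps)
  ultimately show ?case
    by simp
next
  case (add f g)
  have "(\<lambda>n. (\<integral>x. \<bar>f (x + h n) - f x\<bar> \<partial>lborel) + (\<integral>x. \<bar>g (x + h n) - g x\<bar> \<partial>lborel)) \<longlonglongrightarrow> 0 + 0"
    by (intro tendsto_add add)
  then have lim: "(\<lambda>n. (\<integral>x. \<bar>f (x + h n) - f x\<bar> \<partial>lborel) + (\<integral>x. \<bar>g (x + h n) - g x\<bar> \<partial>lborel)) \<longlonglongrightarrow> 0"
    by simp
  show ?case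
  proof (rule Lim_null_comparison[OF _ lim])
    show "\<forall>\<^sub>F n in sequentially. norm (\<integral>x. \<bar>f (x + h n) + g (x + h n) - (f x + g x)\<bar> \<partial>lborel)
      \<le> (\<integral>x. \<bar>f (x + h n) - f x\<bar> \<partial>lborel) + (\<integral>x. \<bar>g (x + h n) - g x\<bar> \<partial>lborel)"
    proof (rule always_eventually, rule allI)
      fix n
      have int: "integrable lborel (\<lambda>x. f (x + h n))" "integrable lborel (\<lambda>x. g (x + h n))"
        using add by (auto simp: lborel_integrable_shift)
      have "(\<integral>x. \<bar>f (x + h n) + g (x + h n) - (f x + g x)\<bar> \<partial>lborel)
        \<le> (\<integral>x. \<bar>f (x + h n) - f x\<bar> + \<bar>g (x + h n) - g x\<bar> \<partial>lborel)"
        using add int by (intro integral_mono) auto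
      then show "norm (\<integral>x. \<bar>f (x + h n) + g (x + h n) - (f x + g x)\<bar> \<partial>lborel)
      \<le> (\<integral>x. \<bar>f (x + h n) - f x\<bar> \<partial>lborel) + (\<integral>x. \<bar>g (x + h n) - g x\<bar> \<partial>lborel)"
        using add int by simp
    qed
  qed
next
  case (lim f s)
  have "(\<lambda>i. \<integral>x. \<bar>f x - s i x\<bar> \<partial>lborel) \<longlonglongrightarrow> (\<integral>x. 0 \<partial>(lborel :: real measure))"
  proof (rule integral_dominated_convergence[where w = "\<lambda>x. 3 * \<bar>f x\<bar>"])
    show "AE x in lborel. (\<lambda>i. \<bar>f x - s i x\<bar>) \<longlonglongrightarrow> 0"
    proof (rule AE_I2)
      fix x
      have "(\<lambda>i. \<bar>f x - s i x\<bar>) \<longlonglongrightarrow> \<bar>f x - f x\<bar>"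
        by (intro tendsto_intros lim.hyps(2)) simp
      then show "(\<lambda>i. \<bar>f x - s i x\<bar>) \<longlonglongrightarrow> 0"
        by simp
    qed
    show "AE x in lborel. norm \<bar>f x - s i x\<bar> \<le> 3 * \<bar>f x\<bar>" for i
    proof (rule AE_I2)
      fix x
      have "\<bar>s i x\<bar> \<le> 2 * \<bar>f x\<bar>"
        using lim.hyps(3)[of x i] by simp
      then show "norm \<bar>f x - s i x\<bar> \<le> 3 * \<bar>f x\<bar>"
        by simp
    qed
    have [measurable]: "f \<in> borel_measurable borel" "s i \<in> borel_measurable borel" for i
      using borel_measurable_integrable[OF lim.hyps(4)] borel_measurable_integrable[OF lim.hyps(1)] by auto
    show "(\<lambda>x. \<bar>f x - s i x\<bar>) \<in> borel_measurable lborel" for i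
      by measurable
    show "integrable lborel (\<lambda>x. 3 * \<bar>f x\<bar>)"
      using lim.hyps(4) by simp
  qed simp
  then have *: "(\<lambda>i. \<integral>x. \<bar>f x - s i x\<bar> \<partial>lborel) \<longlonglongrightarrow> 0"
    by simp
  show ?case
  proof (rule L1_translation_approx)
    fix e :: real assume "e > 0"
    then have "\<forall>\<^sub>F i in sequentially. dist (\<integral>x. \<bar>f x - s i x\<bar> \<partial>lborel) 0 < e"
      by (rule tendstoD[OF *])
    then obtain i where "dist (\<integral>x. \<bar>f x - s i x\<bar> \<partial>lborel) 0 < e"
      by (auto simp: eventually_sequentially)
    then show "\<exists>g. integrable lborel g \<and> (\<integral>x. \<bar>f x - g x\<bar> \<partial>lborel) \<le> e \<and>
        (\<lambda>n. \<integral>x. \<bar>g (x + h n) - g x\<bar> \<partial>lborel) \<longlonglongrightarrow> 0"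
      using lim.hyps(1) lim.IH by (intro exI[of _ "s i"] conjI) (auto simp: less_imp_le)
  qed (rule lim.hyps)
qed

text \<open>The passage from $L^1$ to $L^2$ is by truncation.\<close>

lemma L2_translation_seq:
  fixes g :: "real \<Rightarrow> real"
  assumes g: "g \<in> sqi lborel" and h: "h \<longlonglongrightarrow> 0"
  shows "(\<lambda>n. \<integral>x. (g (x + h n) - g x)\<^sup>2 \<partial>lborel) \<longlonglongrightarrow> 0"
proof (rule tendstoI)
  fix e :: real assume "e > 0"
  have [measurable]: "g \<in> borel_measurable borel"
    using sqi_measurable[OF g] by simp
  define s where "s = (\<lambda>(i::nat) x. if \<bar>x\<bar> \<le> real i \<and> \<bar>g x\<bar> \<le> real i then g x else 0)"
  have [measurable]: "s i \<in> borel_measurable borel" for i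
    unfolding s_def by measurable
  have s_le: "\<bar>s i x\<bar> \<le> \<bar>g x\<bar>" for i x
    by (auto simp: s_def)
  have s_sqi: "s i \<in> sqi lborel" for i
    by (rule sqi_bound[OF g]) (use s_le in auto)
  have "(\<lambda>i. \<integral>x. (g x - s i x)\<^sup>2 \<partial>lborel) \<longlonglongrightarrow> (\<integral>x. 0 \<partial>(lborel :: real measure))"
  proof (rule integral_dominated_convergence[where w = "\<lambda>x. (g x)\<^sup>2"])
    show "AE x in lborel. (\<lambda>i. (g x - s i x)\<^sup>2) \<longlonglongrightarrow> 0"
    proof (intro AE_I2 tendsto_eventually)
      fix x
      obtain m :: nat where "max \<bar>x\<bar> \<bar>g x\<bar> \<le> real m"
        using real_arch_simple by blast
      then show "\<forall>\<^sub>F i in sequentially. (g x - s i x)\<^sup>2 = 0"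
        by (intro eventually_sequentiallyI[of m]) (auto simp: s_def)
    qed
    show "AE x in lborel. norm ((g x - s i x)\<^sup>2) \<le> (g x)\<^sup>2" for i
      by (auto simp: s_def)
  qed (use g in \<open>auto simp: sqi_def\<close>)
  then have "\<forall>\<^sub>F i in sequentially. dist (\<integral>x. (g x - s i x)\<^sup>2 \<partial>lborel) 0 < e / 16"
    using \<open>e > 0\<close> by (intro tendstoD) auto
  then obtain i where i: "(\<integral>x. (g x - s i x)\<^sup>2 \<partial>lborel) < e / 16"
    by (auto simp: eventually_sequentially)
  have s_int: "integrable lborel (s i)"
  proof (rule Bochner_Integration.integrable_bound)
    show "integrable lborel (\<lambda>x. real i * indicator {- real i..real i} x)"
      by simp
    show "AE x in lborel. norm (s i x) \<le> norm (real i * indicator {- real i..real i} x)"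
      by (auto simp: s_def split: split_indicator)
  qed simp
  have "\<forall>\<^sub>F n in sequentially. dist (\<integral>x. \<bar>s i (x + h n) - s i x\<bar> \<partial>lborel) 0 < e / (16 * (real i + 1))"
    using \<open>e > 0\<close> by (intro tendstoD[OF L1_translation[OF s_int h]]) auto
  then show "\<forall>\<^sub>F n in sequentially. dist (\<integral>x. (g (x + h n) - g x)\<^sup>2 \<partial>lborel) 0 < e"
  proof eventually_elim
    case (elim n)
    let ?a = "\<lambda>x. g (x + h n) - s i (x + h n)" and ?b = "\<lambda>x. s i (x + h n) - s i x"
      and ?c = "\<lambda>x. s i x - g x"
    have abc: "?a \<in> sqi lborel" "?b \<in> sqi lborel" "?c \<in> sqi lborel"
      by (intro sqi_diff sqi_shift g s_sqi)+
    have "(\<integral>x. (g (x + h n) - g x)\<^sup>2 \<partial>lborel) = (\<integral>x. ((?a x + ?b x) + ?c x)\<^sup>2 \<partial>lborel)"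
      by simp
    also have "\<dots> \<le> 2 * (\<integral>x. (?a x + ?b x)\<^sup>2 \<partial>lborel) + 2 * (\<integral>x. (?c x)\<^sup>2 \<partial>lborel)"
      by (intro integral_square_add_le sqi_add abc)
    also have "(\<integral>x. (?a x + ?b x)\<^sup>2 \<partial>lborel) \<le> 2 * (\<integral>x. (?a x)\<^sup>2 \<partial>lborel) + 2 * (\<integral>x. (?b x)\<^sup>2 \<partial>lborel)"
      by (intro integral_square_add_le sqi_add abc)
    also have "(\<integral>x. (?a x)\<^sup>2 \<partial>lborel) = (\<integral>x. (g x - s i x)\<^sup>2 \<partial>lborel)"
      by (rule lborel_integral_shift)
    also have "(\<integral>x. (?c x)\<^sup>2 \<partial>lborel) = (\<integral>x. (g x - s i x)\<^sup>2 \<partial>lborel)"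
      by (simp add: power2_commute)
    also have "(\<integral>x. (?b x)\<^sup>2 \<partial>lborel) \<le> (\<integral>x. (2 * (real i + 1)) * \<bar>?b x\<bar> \<partial>lborel)"
    proof (rule integral_mono)
      show "integrable lborel (\<lambda>x. (?b x)\<^sup>2)"
        by (intro sqi_integrable_square abc)
      show "integrable lborel (\<lambda>x. (2 * (real i + 1)) * \<bar>?b x\<bar>)"
        using s_int by (simp add: lborel_integrable_shift)
      show "(?b x)\<^sup>2 \<le> (2 * (real i + 1)) * \<bar>?b x\<bar>" for x
      proof -
        have "\<bar>?b x\<bar> \<le> 2 * (real i + 1)"
          by (auto simp: s_def)
        then have "\<bar>?b x\<bar> * \<bar>?b x\<bar> \<le> 2 * (real i + 1) * \<bar>?b x\<bar>"
          by (rule mult_right_mono) simp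
        then show ?thesis
          by (simp add: power2_eq_square)
      qed
    qed
    also have "\<dots> = (2 * (real i + 1)) * (\<integral>x. \<bar>?b x\<bar> \<partial>lborel)"
      by (rule Bochner_Integration.integral_mult_right_zero)
    also have "\<dots> \<le> e / 8"
    proof -
      have "(2 * (real i + 1)) * (\<integral>x. \<bar>?b x\<bar> \<partial>lborel) \<le> (2 * (real i + 1)) * (e / (16 * (real i + 1)))"
        using elim by (intro mult_left_mono) auto
      also have "\<dots> = e / 8"
        by (simp add: field_simps)
      finally show ?thesis .
    qed
    finally show ?case
      using i \<open>e > 0\<close> by (simp add: dist_real_def)
  qed
qed

lemma L2_translation:
  fixes g :: "real \<Rightarrow> real"
  assumes g: "g \<in> sqi lborel" and "e > 0"
  shows "\<exists>d>0. \<forall>h. \<bar>h\<bar> < d \<longrightarrow> (\<integral>x. (g (x + h) - g x)\<^sup>2 \<partial>lborel) < e"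
proof -
  have "((\<lambda>h. \<integral>x. (g (x + h) - g x)\<^sup>2 \<partial>lborel) \<longlongrightarrow> 0) (at 0)"
    unfolding tendsto_at_iff_sequentially o_def
    using L2_translation_seq[OF g] by blast
  from tendstoD[OF this \<open>e > 0\<close>] obtain d where "d > 0"
    and d: "\<And>h. h \<noteq> 0 \<Longrightarrow> \<bar>h\<bar> < d \<Longrightarrow> (\<integral>x. (g (x + h) - g x)\<^sup>2 \<partial>lborel) < e"
    by (auto simp: eventually_at dist_real_def)
  then show ?thesis
    using \<open>e > 0\<close> by (intro exI[of _ d] conjI allI impI, simp, case_tac "h = 0") auto
qed

lemma translation_quadratic_bound:
  fixes g :: "real \<Rightarrow> real"
  assumes g: "g \<in> sqi lborel" and "e > 0"
  shows "\<exists>C\<ge>0. \<forall>h. (\<integral>x. (g (x + h) - g x)\<^sup>2 \<partial>lborel) \<le> e + C * h\<^sup>2"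
proof -
  obtain d where "d > 0" and d: "\<And>h. \<bar>h\<bar> < d \<Longrightarrow> (\<integral>x. (g (x + h) - g x)\<^sup>2 \<partial>lborel) < e"
    using L2_translation[OF assms] by auto
  define C where "C = 4 * (\<integral>x. (g x)\<^sup>2 \<partial>lborel) / d\<^sup>2"
  have "C \<ge> 0"
    by (auto simp: C_def intro!: divide_nonneg_nonneg)
  moreover have "(\<integral>x. (g (x + h) - g x)\<^sup>2 \<partial>lborel) \<le> e + C * h\<^sup>2" for h
  proof (cases "\<bar>h\<bar> < d")
    case True
    then show ?thesis
      using d[OF True] \<open>C \<ge> 0\<close> by (simp add: add_increasing2 less_imp_le)
  next
    case False
    have "(\<integral>x. (g (x + h) + (- g x))\<^sup>2 \<partial>lborel)
        \<le> 2 * (\<integral>x. (g (x + h))\<^sup>2 \<partial>lborel) + 2 * (\<integral>x. (- g x)\<^sup>2 \<partial>lborel)"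
      by (intro integral_square_add_le sqi_shift sqi_uminus g)
    also have "\<dots> = 4 * (\<integral>x. (g x)\<^sup>2 \<partial>lborel) * 1"
      using lborel_integral_shift[of "\<lambda>x. (g x)\<^sup>2" h] by simp
    also have "\<dots> \<le> 4 * (\<integral>x. (g x)\<^sup>2 \<partial>lborel) * (h\<^sup>2 / d\<^sup>2)"
      using False \<open>d > 0\<close> by (intro mult_left_mono) (auto simp: abs_le_square_iff[symmetric])
    also have "\<dots> = C * h\<^sup>2"
      by (simp add: C_def)
    finally show ?thesis
      using \<open>e > 0\<close> by simp
  qed
  ultimately show ?thesis
    by blast
qed

lemma conv_continuous_0:
  assumes k: "k \<in> sqi lborel" and g: "g \<in> sqi lborel" and h: "h \<longlonglongrightarrow> 0"
  shows "(\<lambda>n. conv k g (h n)) \<longlonglongrightarrow> conv k g 0"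
proof -
  have le: "(conv k g (h n) - conv k g 0)\<^sup>2
      \<le> (\<integral>x. (k (x + h n) - k x)\<^sup>2 \<partial>lborel) * (\<integral>x. (g x)\<^sup>2 \<partial>lborel)" for n
  proof -
    have "conv k g (h n) - conv k g 0 = (\<integral>y. (k (h n - y) - k (0 - y)) * g y \<partial>lborel)"
      unfolding conv_def left_diff_distrib
      by (intro Bochner_Integration.integral_diff[symmetric] conv_integrable k g)
    also have "\<dots>\<^sup>2 \<le> (\<integral>y. (k (h n - y) - k (0 - y))\<^sup>2 \<partial>lborel) * (\<integral>y. (g y)\<^sup>2 \<partial>lborel)"
      by (intro Cauchy_Schwarz_integral sqi_diff sqi_reflect_shift k g)
    also have "(\<integral>y. (k (h n - y) - k (0 - y))\<^sup>2 \<partial>lborel) = (\<integral>x. (k (x + h n) - k x)\<^sup>2 \<partial>lborel)"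
      using lborel_integral_reflect[of "\<lambda>x. (k (x + h n) - k x)\<^sup>2"] by simp
    finally show ?thesis .
  qed
  have "(\<lambda>n. (\<integral>x. (k (x + h n) - k x)\<^sup>2 \<partial>lborel) * (\<integral>x. (g x)\<^sup>2 \<partial>lborel)) \<longlonglongrightarrow> 0"
    using tendsto_mult_left_zero[OF L2_translation_seq[OF k h]] .
  then have "(\<lambda>n. (conv k g (h n) - conv k g 0)\<^sup>2) \<longlonglongrightarrow> 0"
    by (rule Lim_null_comparison[rotated]) (use le in auto)
  then have "(\<lambda>n. conv k g (h n) - conv k g 0) \<longlonglongrightarrow> 0"
    by simp
  then show ?thesis
    by (simp add: LIM_zero_iff)
qed

lemma integrable_moment2:
  assumes "bdd_L1 k" "integrable lborel (\<lambda>y. y\<^sup>2 * k y)"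
  shows "integrable lborel (\<lambda>y. k y * (e + C * y\<^sup>2))"
proof -
  have "integrable lborel (\<lambda>y. e * k y + C * (y\<^sup>2 * k y))"
    using assms bdd_L1_integrable[OF assms(1)] by simp
  then show ?thesis
    by (simp add: algebra_simps)
qed

lemma approx_identity_bound:
  assumes k: "bdd_L1 k" "\<And>x. k x \<ge> 0" "integrable lborel (\<lambda>y. y\<^sup>2 * k y)"
    and g: "g \<in> sqi lborel"
    and C: "C \<ge> 0" "\<And>h. (\<integral>x. (g (x + h) - g x)\<^sup>2 \<partial>lborel) \<le> e + C * h\<^sup>2"
  defines "m \<equiv> \<integral>x. k x \<partial>lborel"
  shows "(\<integral>x. (conv k g x - m * g x)\<^sup>2 \<partial>lborel) \<le> m * (e * m + C * (\<integral>y. y\<^sup>2 * k y \<partial>lborel))"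
proof -
  have [measurable]: "k \<in> borel_measurable borel" "g \<in> borel_measurable borel"
    using k(1) sqi_measurable[OF g] by measurable
  obtain B where B: "\<bar>k x\<bar> \<le> B" for x
    using k by (auto simp: bdd_L1_def)
  have k_int: "integrable lborel k"
    by (rule bdd_L1_integrable[OF k(1)])
  have m: "m \<ge> 0"
    unfolding m_def using k by simp
  define F where "F = (\<lambda>y x. k y * (g (x - y) - g x)\<^sup>2)"
  have F_meas[measurable]: "(\<lambda>(y, x). F y x) \<in> borel_measurable (borel \<Otimes>\<^sub>M borel)"
    unfolding F_def by measurable
  have F_nonneg: "F y x \<ge> 0" for y x
    using k by (simp add: F_def)
  have F_int_x: "integrable lborel (F y)" for y
    unfolding F_def using sqi_shift[OF g, of "-y"] g
    by (intro Bochner_Integration.integrable_mult_right sqi_integrable_square sqi_diff) auto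
  have F_le: "(\<integral>x. F y x \<partial>lborel) \<le> k y * (e + C * y\<^sup>2)" for y
    unfolding F_def using C(2)[of "-y"] k(2)[of y] by (simp add: mult_left_mono)
  have F_ge: "(\<integral>x. F y x \<partial>lborel) \<ge> 0" for y
    using F_nonneg by simp
  have "integrable lborel (\<lambda>y. \<integral>x. F y x \<partial>lborel)"
  proof (rule Bochner_Integration.integrable_bound)
    show "integrable lborel (\<lambda>y. k y * (e + C * y\<^sup>2))"
      by (rule integrable_moment2[OF k(1,3)])
    show "AE y in lborel. norm (\<integral>x. F y x \<partial>lborel) \<le> norm (k y * (e + C * y\<^sup>2))"
      using F_le F_ge by (intro AE_I2) (simp, metis abs_of_nonneg order.trans)
  qed simp
  then have F_int: "integrable (lborel \<Otimes>\<^sub>M lborel) (\<lambda>(y, x). F y x)"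
    using F_nonneg F_int_x by (intro lborel_pair.Fubini_integrable) auto
  have pointwise: "(conv k g x - m * g x)\<^sup>2 \<le> m * (\<integral>y. F y x \<partial>lborel)" for x
  proof -
    have "integrable lborel (\<lambda>y. k y * g (x - y))"
      by (intro sqi_integrable_mult bdd_L1_sqi[OF k(1)] sqi_reflect_shift g)
    then have "conv k g x - m * g x = (\<integral>y. k y * (g (x - y) - g x) \<partial>lborel)"
      unfolding conv_commute[of k] unfolding conv_def m_def using k_int
      by (simp add: algebra_simps)
    also have "\<dots>\<^sup>2 \<le> (\<integral>y. \<bar>k y\<bar> \<partial>lborel) * (\<integral>y. \<bar>k y\<bar> * (g (x - y) - g x)\<^sup>2 \<partial>lborel)"
    proof (rule weighted_Cauchy_Schwarz[OF k_int])
      show "integrable lborel (\<lambda>y. \<bar>k y\<bar> * (g (x - y) - g x)\<^sup>2)"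
      proof (rule Bochner_Integration.integrable_bound)
        show "integrable lborel (\<lambda>y. 2 * B * (g (x - y))\<^sup>2 + 2 * (g x)\<^sup>2 * k y)"
          using k_int sqi_integrable_square[OF sqi_reflect_shift[OF g, of x]] by simp
        show "AE y in lborel. norm (\<bar>k y\<bar> * (g (x - y) - g x)\<^sup>2)
            \<le> norm (2 * B * (g (x - y))\<^sup>2 + 2 * (g x)\<^sup>2 * k y)"
        proof (rule AE_I2)
          fix y
          have "(g (x - y) - g x)\<^sup>2 \<le> 2 * (g (x - y))\<^sup>2 + 2 * (g x)\<^sup>2"
            using sum_squares_bound[of "g (x - y)" "- g x"] by (simp add: power2_diff)
          then have "k y * (g (x - y) - g x)\<^sup>2 \<le> k y * (2 * (g (x - y))\<^sup>2 + 2 * (g x)\<^sup>2)"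
            using k(2) by (rule mult_left_mono)
          also have "\<dots> \<le> 2 * B * (g (x - y))\<^sup>2 + 2 * (g x)\<^sup>2 * k y"
            using mult_right_mono[of "k y" B "2 * (g (x - y))\<^sup>2"] B[of y] by (simp add: algebra_simps)
          finally show "norm (\<bar>k y\<bar> * (g (x - y) - g x)\<^sup>2)
            \<le> norm (2 * B * (g (x - y))\<^sup>2 + 2 * (g x)\<^sup>2 * k y)"
            using k(2)[of y] by simp
        qed
      qed measurable
    qed measurable
    finally show ?thesis
      using k(2) by (simp add: m_def F_def)
  qed
  have int: "integrable lborel (\<lambda>x. m * (\<integral>y. F y x \<partial>lborel))"
    using lborel_pair.integrable_snd[OF F_int] by simp
  have "(\<integral>x. (conv k g x - m * g x)\<^sup>2 \<partial>lborel) \<le> (\<integral>x. m * (\<integral>y. F y x \<partial>lborel) \<partial>lborel)"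
    using pointwise
    by (intro integral_mono int sqi_integrable_square sqi_diff conv_L2 k(1) g sqi_cmult)
  also have "\<dots> = m * (\<integral>y. (\<integral>x. F y x \<partial>lborel) \<partial>lborel)"
    using lborel_pair.Fubini_integral[OF F_int] by simp
  also have "\<dots> \<le> m * (\<integral>y. k y * (e + C * y\<^sup>2) \<partial>lborel)"
    using m F_le lborel_pair.integrable_fst[OF F_int]
    by (intro mult_left_mono integral_mono integrable_moment2[OF k(1,3)]) auto
  also have "(\<integral>y. k y * (e + C * y\<^sup>2) \<partial>lborel) = e * m + C * (\<integral>y. y\<^sup>2 * k y \<partial>lborel)"
    unfolding m_def using k_int k(3) by (simp add: distrib_left mult.commute mult.left_commute)
  finally show ?thesis .
qed

text \<open>An approximate identity is recognised by its mass and its second moment.\<close>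

lemma approx_identity:
  assumes k: "\<And>t. t > 0 \<Longrightarrow> bdd_L1 (k t)" "\<And>t x. t > 0 \<Longrightarrow> k t x \<ge> 0"
      "\<And>t. t > 0 \<Longrightarrow> integrable lborel (\<lambda>y. y\<^sup>2 * k t y)"
    and mass: "((\<lambda>t. \<integral>x. k t x \<partial>lborel) \<longlongrightarrow> 1) (at_right (0::real))"
    and moment: "((\<lambda>t. \<integral>y. y\<^sup>2 * k t y \<partial>lborel) \<longlongrightarrow> 0) (at_right 0)"
    and g: "g \<in> sqi lborel"
  shows "((\<lambda>t. \<integral>x. (conv (k t) g x - g x)\<^sup>2 \<partial>lborel) \<longlongrightarrow> 0) (at_right 0)"
proof (rule tendstoI)
  fix e :: real assume "e > 0"
  obtain C where C: "C \<ge> 0" "\<And>h. (\<integral>x. (g (x + h) - g x)\<^sup>2 \<partial>lborel) \<le> e / 4 + C * h\<^sup>2"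
    using translation_quadratic_bound[OF g, of "e / 4"] \<open>e > 0\<close> by auto
  let ?m = "\<lambda>t. \<integral>x. k t x \<partial>lborel" and ?M = "\<lambda>t. \<integral>y. y\<^sup>2 * k t y \<partial>lborel"
  let ?G = "\<integral>x. (g x)\<^sup>2 \<partial>lborel"
  let ?b = "\<lambda>t. 2 * (?m t * (e / 4 * ?m t + C * ?M t)) + 2 * ((?m t - 1)\<^sup>2 * ?G)"
  have "(?b \<longlongrightarrow> 2 * (1 * (e / 4 * 1 + C * 0)) + 2 * ((1 - 1)\<^sup>2 * ?G)) (at_right 0)"
    by (intro tendsto_intros mass moment)
  then have "\<forall>\<^sub>F t in at_right 0. ?b t < e"
    by (rule order_tendstoD) (use \<open>e > 0\<close> in simp)
  moreover have "\<forall>\<^sub>F t in at_right 0. (t::real) > 0"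
    by (simp add: eventually_at_right_less)
  ultimately show "\<forall>\<^sub>F t in at_right 0. dist (\<integral>x. (conv (k t) g x - g x)\<^sup>2 \<partial>lborel) 0 < e"
  proof eventually_elim
    case (elim t)
    have "(\<integral>x. (conv (k t) g x - g x)\<^sup>2 \<partial>lborel)
        = (\<integral>x. ((conv (k t) g x - ?m t * g x) + (?m t - 1) * g x)\<^sup>2 \<partial>lborel)"
      by (simp add: algebra_simps)
    also have "\<dots> \<le> 2 * (\<integral>x. (conv (k t) g x - ?m t * g x)\<^sup>2 \<partial>lborel)
        + 2 * (\<integral>x. ((?m t - 1) * g x)\<^sup>2 \<partial>lborel)"
      by (intro integral_square_add_le sqi_diff sqi_cmult g conv_L2 k elim)
    also have "\<dots> \<le> ?b t"
      using approx_identity_bound[OF k(1)[OF elim(2)] k(2)[OF elim(2)] k(3)[OF elim(2)] g C]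
      by (simp add: power_mult_distrib)
    also have "\<dots> < e"
      by (rule elim)
    finally show ?case
      by simp
  qed
qed

section \<open>The heat kernel and the resolvent kernel\<close>

text \<open>The kernel of $e^{t\Delta}$ on the line: the Gaussian of variance $2t$, because the
  generator is $\Delta$ and not $\Delta/2$.\<close>

definition heat_kernel :: "real \<Rightarrow> real \<Rightarrow> real" where
  "heat_kernel t = normal_density 0 (sqrt (2 * t))"

lemma heat_kernel_eq:
  assumes "t > 0"
  shows "heat_kernel t x = exp (- x\<^sup>2 / (4 * t)) / sqrt (4 * pi * t)"
  using assms by (simp add: heat_kernel_def normal_density_def mult.assoc)

lemma heat_kernel_nonneg: "heat_kernel t x \<ge> 0"
  by (simp add: heat_kernel_def)

lemma heat_kernel_pos: "t > 0 \<Longrightarrow> heat_kernel t x > 0"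
  by (simp add: heat_kernel_def normal_density_pos)

lemma heat_kernel_even: "heat_kernel t (- x) = heat_kernel t x"
  by (simp add: heat_kernel_def normal_density_def)

lemma heat_kernel_mono:
  assumes "t > 0" "\<bar>x\<bar> \<le> \<bar>y\<bar>"
  shows "heat_kernel t y \<le> heat_kernel t x"
proof -
  have "x\<^sup>2 \<le> y\<^sup>2"
    using assms(2) by (simp add: abs_le_square_iff)
  then show ?thesis
    using assms(1) by (auto simp: heat_kernel_eq divide_right_mono)
qed

lemma heat_kernel_integral: "t > 0 \<Longrightarrow> (\<integral>x. heat_kernel t x \<partial>lborel) = 1"
  by (simp add: heat_kernel_def)

lemma bdd_L1_heat_kernel:
  assumes "t > 0"
  shows "bdd_L1 (heat_kernel t)"
  unfolding bdd_L1_def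
proof (intro conjI exI allI)
  show "integrable lborel (heat_kernel t)"
    using assms by (simp add: heat_kernel_def)
  show "\<bar>heat_kernel t x\<bar> \<le> heat_kernel t 0" for x
    using heat_kernel_mono[OF assms, of 0 x] heat_kernel_nonneg[of t x] by simp
qed

lemma heat_kernel_moment1:
  assumes "t > 0"
  shows "has_bochner_integral lborel (\<lambda>y. y * heat_kernel t y) 0"
  using normal_moment_nz_1[of "sqrt (2 * t)" 0] assms by (simp add: heat_kernel_def mult.commute)

lemma heat_kernel_moment2:
  assumes "t > 0"
  shows "has_bochner_integral lborel (\<lambda>y. y\<^sup>2 * heat_kernel t y) (2 * t)"
  using normal_moment_even[of "sqrt (2 * t)" 0 1] assms by (simp add: heat_kernel_def mult.commute)

lemma heat_kernel_exp_moment: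
  assumes "t > 0"
  shows "has_bochner_integral lborel (\<lambda>y. exp y * heat_kernel t y) (exp t)"
proof -
  have eq: "exp y * heat_kernel t y = exp t * normal_density (2 * t) (sqrt (2 * t)) y" for y
  proof -
    have "y + - y\<^sup>2 / (4 * t) = t + - (y - 2 * t)\<^sup>2 / (4 * t)"
      using assms by (simp add: field_simps power2_eq_square)
    then have "exp y * exp (- y\<^sup>2 / (4 * t)) = exp t * exp (- (y - 2 * t)\<^sup>2 / (4 * t))"
      by (simp flip: exp_add)
    then show ?thesis
      using assms by (simp add: heat_kernel_def normal_density_def)
  qed
  have "has_bochner_integral lborel (normal_density (2 * t) (sqrt (2 * t))) 1"
    using assms by (simp add: has_bochner_integral_iff)
  from has_bochner_integral_mult_right[OF this, of "exp t"] show ?thesis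
    by (simp add: eq)
qed

lemma heat_kernel_semigroup:
  assumes "s > 0" "t > 0"
  shows "conv (heat_kernel s) (heat_kernel t) = heat_kernel (s + t)"
proof
  fix x
  have "integrable lborel (\<lambda>y. heat_kernel s (x - y) * heat_kernel t y)"
    using assms by (intro conv_integrable bdd_L1_sqi bdd_L1_heat_kernel)
  then have "ennreal (conv (heat_kernel s) (heat_kernel t) x)
      = (\<integral>\<^sup>+y. ennreal (heat_kernel s (x - y) * heat_kernel t y) \<partial>lborel)"
    unfolding conv_def by (intro nn_integral_eq_integral[symmetric]) (auto simp: heat_kernel_nonneg)
  also have "\<dots> = ennreal (heat_kernel (s + t) x)"
    using fun_cong[OF conv_normal_density_zero_mean[of "sqrt (2 * s)" "sqrt (2 * t)"], of x] assms
    by (simp add: heat_kernel_def distrib_left)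
  finally show "conv (heat_kernel s) (heat_kernel t) x = heat_kernel (s + t) x"
    by (subst (asm) ennreal_inj) (auto simp: heat_kernel_nonneg conv_def)
qed

text \<open>The kernel of $(1-\Delta)^{-1}$ on the line.\<close>

definition res_kernel :: "real \<Rightarrow> real" where
  "res_kernel x = exp (- \<bar>x\<bar>) / 2"

lemma res_kernel_nonneg: "res_kernel x \<ge> 0"
  by (simp add: res_kernel_def)

lemma res_kernel_even: "res_kernel (- x) = res_kernel x"
  by (simp add: res_kernel_def)

lemma res_kernel_measurable[measurable]: "res_kernel \<in> borel_measurable borel"
  unfolding res_kernel_def[abs_def] by measurable

lemma power_exp_half_line:
  "has_bochner_integral lborel (\<lambda>x::real. indicator {0..} x * (x ^ k * exp (- x))) (fact k)"
proof (rule has_bochner_integral_nn_integral)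
  have "(\<integral>\<^sup>+x. ennreal (indicator {0..} x * (x ^ k * exp (- x))) \<partial>lborel)
      = (\<integral>\<^sup>+x. ennreal (x ^ k * exp (- x)) * indicator {0 ..} x \<partial>lborel)"
    by (intro nn_integral_cong) (auto split: split_indicator)
  then show "(\<integral>\<^sup>+x. ennreal (indicator {0..} x * (x ^ k * exp (- x))) \<partial>lborel) = ennreal (fact k)"
    by (simp add: nn_intergal_power_times_exp_Ici)
qed (auto split: split_indicator)

lemma res_kernel_moment:
  "has_bochner_integral lborel (\<lambda>x. x ^ k * res_kernel x) ((1 + (-1) ^ k) / 2 * fact k)"
proof -
  let ?f = "\<lambda>x::real. indicator {0..} x * (x ^ k * exp (- x))"
  have f: "has_bochner_integral lborel ?f (fact k)"
    by (rule power_exp_half_line)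
  then have f': "has_bochner_integral lborel (\<lambda>x. ?f (- x)) (fact k)"
    using lborel_integrable_reflect[of ?f] lborel_integral_reflect[of ?f]
    by (simp add: has_bochner_integral_iff)
  have "has_bochner_integral lborel (\<lambda>x. 1 / 2 * ?f x + ((-1) ^ k / 2) * ?f (- x))
      (1 / 2 * fact k + ((-1) ^ k / 2) * fact k)"
    by (intro has_bochner_integral_add has_bochner_integral_mult_right f f')
  then have "has_bochner_integral lborel (\<lambda>x. x ^ k * res_kernel x)
      (1 / 2 * fact k + ((-1) ^ k / 2) * fact k)"
  proof (rule has_bochner_integralI_AE)
    have "AE x in lborel. (x::real) \<noteq> 0"
      by (rule AE_lborel_singleton)
    then show "AE x in lborel. 1 / 2 * ?f x + ((-1) ^ k / 2) * ?f (- x) = x ^ k * res_kernel x"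
    proof eventually_elim
      case (elim x)
      have "(-1) ^ k * (- x) ^ k = x ^ k"
        by (simp flip: power_mult_distrib)
      then show ?case
        using elim by (cases "x > 0") (auto simp: res_kernel_def mult.assoc[symmetric])
    qed
  qed simp
  then show ?thesis
    by (simp add: algebra_simps add_divide_distrib)
qed

lemma res_kernel_has_integral: "has_bochner_integral lborel res_kernel 1"
  using res_kernel_moment[of 0] by simp

lemma bdd_L1_res_kernel: "bdd_L1 res_kernel"
  using res_kernel_has_integral
  by (auto simp: bdd_L1_def has_bochner_integral_iff res_kernel_def intro!: exI[of _ "1 / 2"])

lemma conv_moment2:
  assumes k: "integrable lborel k" "integrable lborel (\<lambda>x. x * k x)" "integrable lborel (\<lambda>x. x\<^sup>2 * k x)"
    and l: "integrable lborel l" "integrable lborel (\<lambda>x. x * l x)" "integrable lborel (\<lambda>x. x\<^sup>2 * l x)"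
    and pos: "\<And>x. k x \<ge> 0" "\<And>x. l x \<ge> 0"
  shows "has_bochner_integral lborel (\<lambda>x. x\<^sup>2 * conv k l x)
     ((\<integral>x. x\<^sup>2 * k x \<partial>lborel) * (\<integral>x. l x \<partial>lborel)
       + 2 * (\<integral>x. x * k x \<partial>lborel) * (\<integral>x. x * l x \<partial>lborel)
       + (\<integral>x. k x \<partial>lborel) * (\<integral>x. x\<^sup>2 * l x \<partial>lborel))"
proof -
  have [measurable]: "k \<in> borel_measurable borel" "l \<in> borel_measurable borel"
    using k l by auto
  define F where "F = (\<lambda>y x. x\<^sup>2 * (k (x - y) * l y))"
  have [measurable]: "(\<lambda>(y, x). F y x) \<in> borel_measurable (borel \<Otimes>\<^sub>M borel)"
    unfolding F_def by measurable
  have F_shift: "F y (x + y) = l y * (x\<^sup>2 * k x) + (2 * (y * l y)) * (x * k x) + (y\<^sup>2 * l y) * k x" for x y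
    by (simp add: F_def power2_sum algebra_simps)
  have F_int_x: "integrable lborel (F y)" for y
  proof -
    have "integrable lborel (\<lambda>x. F y (x + y))"
      unfolding F_shift using k by simp
    then show ?thesis
      by (simp add: lborel_integrable_shift)
  qed
  have F_val: "(\<integral>x. F y x \<partial>lborel) = l y * (\<integral>x. x\<^sup>2 * k x \<partial>lborel)
      + (2 * (y * l y)) * (\<integral>x. x * k x \<partial>lborel) + (y\<^sup>2 * l y) * (\<integral>x. k x \<partial>lborel)" for y
  proof -
    have "(\<integral>x. F y x \<partial>lborel) = (\<integral>x. F y (x + y) \<partial>lborel)"
      by (rule lborel_integral_shift[symmetric])
    also have "\<dots> = l y * (\<integral>x. x\<^sup>2 * k x \<partial>lborel)
      + (2 * (y * l y)) * (\<integral>x. x * k x \<partial>lborel) + (y\<^sup>2 * l y) * (\<integral>x. k x \<partial>lborel)"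
      unfolding F_shift using k by simp
    finally show ?thesis .
  qed
  have F_nonneg: "F y x \<ge> 0" for y x
    by (simp add: F_def pos)
  have F_int: "integrable (lborel \<Otimes>\<^sub>M lborel) (\<lambda>(y, x). F y x)"
  proof (rule lborel_pair.Fubini_integrable)
    show "integrable lborel (\<lambda>y. \<integral>x. norm (case (y, x) of (y, x) \<Rightarrow> F y x) \<partial>lborel)"
      using l F_nonneg by (simp add: F_val)
  qed (use F_int_x in auto)
  have eq: "(\<integral>y. F y x \<partial>lborel) = x\<^sup>2 * conv k l x" for x
    unfolding F_def conv_def by simp
  have "integrable lborel (\<lambda>x. x\<^sup>2 * conv k l x)"
    using lborel_pair.integrable_snd[OF F_int] by (simp add: eq)
  moreover have "(\<integral>x. x\<^sup>2 * conv k l x \<partial>lborel) = (\<integral>y. (\<integral>x. F y x \<partial>lborel) \<partial>lborel)"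
    using lborel_pair.Fubini_integral[OF F_int] by (simp add: eq)
  moreover have "(\<integral>y. (\<integral>x. F y x \<partial>lborel) \<partial>lborel)
     = (\<integral>x. x\<^sup>2 * k x \<partial>lborel) * (\<integral>x. l x \<partial>lborel)
       + 2 * (\<integral>x. x * k x \<partial>lborel) * (\<integral>x. x * l x \<partial>lborel)
       + (\<integral>x. k x \<partial>lborel) * (\<integral>x. x\<^sup>2 * l x \<partial>lborel)"
    unfolding F_val using l by simp
  ultimately show ?thesis
    by (simp add: has_bochner_integral_iff)
qed

text \<open>The resolvent kernel is 1-excessive for the heat semigroup.  No heat equation is needed:
  $r(x - y) \le e^{-x} e^y / 2$, and the exponential moment of the Gaussian is $e^t$.\<close>

lemma res_kernel_excessive:
  assumes "t > 0"
  shows "conv (heat_kernel t) res_kernel x \<le> exp t * res_kernel x"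
proof -
  have le: "conv (heat_kernel t) res_kernel x \<le> exp t * (exp (- x) / 2)" for x
  proof -
    have hb: "has_bochner_integral lborel (\<lambda>y. exp (- x) / 2 * (exp y * heat_kernel t y)) (exp (- x) / 2 * exp t)"
      by (rule has_bochner_integral_mult_right[OF heat_kernel_exp_moment[OF assms]])
    have "conv res_kernel (heat_kernel t) x \<le> (\<integral>y. exp (- x) / 2 * (exp y * heat_kernel t y) \<partial>lborel)"
      unfolding conv_def
    proof (rule integral_mono)
      show "integrable lborel (\<lambda>y. res_kernel (x - y) * heat_kernel t y)"
        using assms by (intro conv_integrable bdd_L1_sqi bdd_L1_heat_kernel bdd_L1_res_kernel)
      show "integrable lborel (\<lambda>y. exp (- x) / 2 * (exp y * heat_kernel t y))"
        using hb by (simp add: has_bochner_integral_iff)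
      fix y
      have "res_kernel (x - y) \<le> exp (- x) / 2 * exp y"
        by (simp add: res_kernel_def flip: exp_add)
      then show "res_kernel (x - y) * heat_kernel t y \<le> exp (- x) / 2 * (exp y * heat_kernel t y)"
        using mult_right_mono[OF _ heat_kernel_nonneg[of t y]] by (simp only: mult.assoc[symmetric])
    qed
    then show ?thesis
      using hb by (simp add: has_bochner_integral_iff conv_commute[of res_kernel] mult.commute)
  qed
  have even: "conv (heat_kernel t) res_kernel (- x) = conv (heat_kernel t) res_kernel x"
    by (intro conv_even heat_kernel_even res_kernel_even)
  show ?thesis
    using le[of x] le[of "- x"] even by (cases "x \<ge> 0") (auto simp: res_kernel_def)
qed

text \<open>The kernel $(e^t r - p_t * r) / t$, which equals $\frac1t \int_0^t e^{t-s} p_s \, ds$.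
  All that is used of it is its sign, its mass and its second moment: they make it an approximate
  identity, and this is the statement that $(P_t R f - R f) / t$ tends to $R f - f$.\<close>

definition diff_kernel :: "real \<Rightarrow> real \<Rightarrow> real" where
  "diff_kernel t x = exp t / t * res_kernel x + (- 1 / t) * conv (heat_kernel t) res_kernel x"

lemma diff_kernel_even: "diff_kernel t (- u) = diff_kernel t u"
  by (simp add: diff_kernel_def res_kernel_even conv_even heat_kernel_even)

lemma diff_kernel_nonneg: "t > 0 \<Longrightarrow> diff_kernel t x \<ge> 0"
  using res_kernel_excessive[of t x] by (simp add: diff_kernel_def field_simps)

lemma bdd_L1_diff_kernel: "t > 0 \<Longrightarrow> bdd_L1 (diff_kernel t)"
  unfolding diff_kernel_def[abs_def]
  by (intro bdd_L1_add bdd_L1_conv bdd_L1_heat_kernel bdd_L1_res_kernel)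

lemma diff_kernel_mass:
  assumes "t > 0"
  shows "(\<integral>x. diff_kernel t x \<partial>lborel) = (exp t - 1) / t"
proof -
  note int = bdd_L1_integrable[OF bdd_L1_heat_kernel[OF assms]] bdd_L1_integrable[OF bdd_L1_res_kernel]
  show ?thesis
    unfolding diff_kernel_def[abs_def] using conv_L1[OF int] int res_kernel_has_integral assms
    by (simp add: has_bochner_integral_iff heat_kernel_integral diff_divide_distrib)
qed

lemma diff_kernel_moment2:
  assumes "t > 0"
  shows "has_bochner_integral lborel (\<lambda>y. y\<^sup>2 * diff_kernel t y) ((2 * exp t - 2 - 2 * t) / t)"
proof -
  note h = heat_kernel_moment1[OF assms] heat_kernel_moment2[OF assms]
  have r1: "has_bochner_integral lborel (\<lambda>y. y * res_kernel y) 0"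
    using res_kernel_moment[of 1] by simp
  have r2: "has_bochner_integral lborel (\<lambda>y. y\<^sup>2 * res_kernel y) 2"
    using res_kernel_moment[of 2] by (simp add: fact_2)
  have c: "has_bochner_integral lborel (\<lambda>y. y\<^sup>2 * conv (heat_kernel t) res_kernel y) (2 * t + 2)"
    using conv_moment2[of "heat_kernel t" res_kernel] h r1 r2 res_kernel_has_integral
      bdd_L1_integrable[OF bdd_L1_heat_kernel[OF assms]] heat_kernel_nonneg[of t] res_kernel_nonneg
      heat_kernel_integral[OF assms]
    by (simp add: has_bochner_integral_iff)
  have "has_bochner_integral lborel
     (\<lambda>y. exp t / t * (y\<^sup>2 * res_kernel y) + (- 1 / t) * (y\<^sup>2 * conv (heat_kernel t) res_kernel y))
     (exp t / t * 2 + (- 1 / t) * (2 * t + 2))"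
    by (intro has_bochner_integral_add has_bochner_integral_mult_right r2 c)
  also have "exp t / t * 2 + (- 1 / t) * (2 * t + 2) = (2 * exp t - 2 - 2 * t) / t"
    using assms by (simp add: field_simps)
  finally show ?thesis
    by (simp add: diff_kernel_def[abs_def] algebra_simps)
qed

lemma heat_kernel_approx_identity:
  assumes "g \<in> sqi lborel"
  shows "((\<lambda>t. \<integral>x. (conv (heat_kernel t) g x - g x)\<^sup>2 \<partial>lborel) \<longlongrightarrow> 0) (at_right 0)"
proof (rule approx_identity)
  show "((\<lambda>t. \<integral>x. heat_kernel t x \<partial>lborel) \<longlongrightarrow> 1) (at_right 0)"
    by (rule tendsto_eventually, rule eventually_mono[OF eventually_at_right_less[of "0::real"]])
      (simp add: heat_kernel_integral)
  have "((\<lambda>t::real. 2 * t) \<longlongrightarrow> 0) (at_right 0)"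
    by real_asymp
  then show "((\<lambda>t. \<integral>y. y\<^sup>2 * heat_kernel t y \<partial>lborel) \<longlongrightarrow> 0) (at_right 0)"
    by (rule Lim_transform_eventually)
      (rule eventually_mono[OF eventually_at_right_less[of "0::real"]],
        use heat_kernel_moment2 in \<open>auto simp: has_bochner_integral_iff\<close>)
qed (use heat_kernel_moment2 assms in
    \<open>auto simp: bdd_L1_heat_kernel heat_kernel_nonneg has_bochner_integral_iff\<close>)

lemma diff_kernel_approx_identity:
  assumes "g \<in> sqi lborel"
  shows "((\<lambda>t. \<integral>x. (conv (diff_kernel t) g x - g x)\<^sup>2 \<partial>lborel) \<longlongrightarrow> 0) (at_right 0)"
proof (rule approx_identity)
  have "((\<lambda>t::real. (exp t - 1) / t) \<longlongrightarrow> 1) (at_right 0)"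
    by real_asymp
  then show "((\<lambda>t. \<integral>x. diff_kernel t x \<partial>lborel) \<longlongrightarrow> 1) (at_right 0)"
    by (rule Lim_transform_eventually)
      (rule eventually_mono[OF eventually_at_right_less[of "0::real"]], simp add: diff_kernel_mass)
  have "((\<lambda>t::real. (2 * exp t - 2 - 2 * t) / t) \<longlongrightarrow> 0) (at_right 0)"
    by real_asymp
  then show "((\<lambda>t. \<integral>y. y\<^sup>2 * diff_kernel t y \<partial>lborel) \<longlongrightarrow> 0) (at_right 0)"
    by (rule Lim_transform_eventually)
      (rule eventually_mono[OF eventually_at_right_less[of "0::real"]],
        use diff_kernel_moment2 in \<open>auto simp: has_bochner_integral_iff\<close>)
qed (use diff_kernel_moment2 assms in
    \<open>auto simp: bdd_L1_diff_kernel diff_kernel_nonneg has_bochner_integral_iff\<close>)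

section \<open>Primitives of square-integrable functions\<close>

text \<open>The primitive vanishing at 0.  The oriented integral makes it meaningful on both sides of 0.\<close>

definition prim :: "(real \<Rightarrow> real) \<Rightarrow> real \<Rightarrow> real" where
  "prim g x = (LBINT y=ereal 0..ereal x. g y)"

lemma indicator_Icc_sqi: "(indicator {a..b} :: real \<Rightarrow> real) \<in> sqi lborel"
proof (rule sqiI)
  have "(\<lambda>x. (indicator {a..b} x :: real)\<^sup>2) = indicator {a..b}"
    by (auto split: split_indicator)
  moreover have "integrable lborel (indicator {a..b} :: real \<Rightarrow> real)"
    by (rule integrable_real_indicator) (auto simp: emeasure_lborel_Icc_eq)
  ultimately show "integrable lborel (\<lambda>x. (indicator {a..b} x :: real)\<^sup>2)"
    by simp
qed simp

lemma indicator_Icc_mult_integrable: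
  "g \<in> sqi lborel \<Longrightarrow> integrable lborel (\<lambda>x::real. indicator {a..b} x * g x :: real)"
  by (rule sqi_integrable_mult[OF indicator_Icc_sqi])

lemma sqi_interval_integrable:
  fixes a b :: real
  assumes "g \<in> sqi lborel"
  shows "interval_lebesgue_integrable lborel (ereal a) (ereal b) g"
proof -
  have "set_integrable lborel {a..b} g" for a b
    using indicator_Icc_mult_integrable[OF assms] by (simp add: set_integrable_def)
  then have "set_integrable lborel {a<..<b} g" for a b
    by (rule set_integrable_subset[of _ "{a..b}"]) auto
  then show ?thesis
    by (simp add: interval_lebesgue_integrable_def)
qed

lemma prim_diff:
  assumes "g \<in> sqi lborel"
  shows "prim g b - prim g a = (LBINT y=ereal a..ereal b. g y)"
proof -
  have "prim g a + (LBINT y=ereal a..ereal b. g y) = prim g b"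
    unfolding prim_def by (rule interval_integral_sum)
      (simp add: sqi_interval_integrable[OF assms] flip: ereal_min ereal_max)
  then show ?thesis
    by simp
qed

lemma prim_diff_le:
  assumes "g \<in> sqi lborel" "a \<le> b"
  shows "prim g b - prim g a = (\<integral>y. indicator {a..b} y * g y \<partial>lborel)"
  using assms by (simp add: prim_diff interval_integral_Icc set_lebesgue_integral_def)

lemma prim_nonneg_eq:
  assumes "x \<ge> 0"
  shows "prim g x = (\<integral>y. indicator {0..x} y * g y \<partial>lborel)"
  using assms by (simp add: prim_def interval_integral_Icc set_lebesgue_integral_def)

lemma prim_0 [simp]: "prim g 0 = 0"
  by (simp add: prim_def)

lemma prim_Hoelder:
  assumes g: "g \<in> sqi lborel"
  shows "(prim g b - prim g a)\<^sup>2 \<le> \<bar>b - a\<bar> * (\<integral>y. (g y)\<^sup>2 \<partial>lborel)"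
proof -
  have *: "(prim g b - prim g a)\<^sup>2 \<le> \<bar>b - a\<bar> * (\<integral>y. (g y)\<^sup>2 \<partial>lborel)" if "a \<le> b" for a b
  proof -
    have "(\<lambda>x. (indicator {a..b} x :: real)\<^sup>2) = indicator {a..b}"
      by (auto split: split_indicator)
    then show ?thesis
      using Cauchy_Schwarz_integral[OF indicator_Icc_sqi g, of a b] that
      by (simp add: prim_diff_le[OF g that])
  qed
  show ?thesis
    using *[of a b] *[of b a] by (cases "a \<le> b") (auto simp: power2_commute abs_minus_commute)
qed

lemma continuous_on_prim:
  assumes g: "g \<in> sqi lborel"
  shows "continuous_on S (prim g)"
proof (rule continuous_at_imp_continuous_on, rule ballI)
  fix a
  let ?G = "\<integral>y. (g y)\<^sup>2 \<partial>lborel"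
  have "((\<lambda>b. \<bar>b - a\<bar> * ?G) \<longlongrightarrow> \<bar>a - a\<bar> * ?G) (at a)"
    by (intro tendsto_intros)
  then have "((\<lambda>b. \<bar>b - a\<bar> * ?G) \<longlongrightarrow> 0) (at a)"
    by simp
  then have "((\<lambda>b. (prim g b - prim g a)\<^sup>2) \<longlongrightarrow> 0) (at a)"
    by (rule Lim_null_comparison[rotated]) (use prim_Hoelder[OF g] in auto)
  then have "((\<lambda>b. prim g b - prim g a) \<longlongrightarrow> 0) (at a)"
    by simp
  then show "isCont (prim g) a"
    by (simp add: isCont_def LIM_zero_iff)
qed

lemma prim_measurable[measurable]: "g \<in> sqi lborel \<Longrightarrow> prim g \<in> borel_measurable borel"
  by (intro borel_measurable_continuous_onI continuous_on_prim)

lemma prim_add: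
  assumes "f \<in> sqi lborel" "g \<in> sqi lborel"
  shows "prim (\<lambda>y. a * f y + b * g y) x = a * prim f x + b * prim g x"
  unfolding prim_def using sqi_interval_integrable[OF assms(1), of 0 x]
    sqi_interval_integrable[OF assms(2), of 0 x]
  by (subst interval_lebesgue_integral_add) auto

lemma prim_C1:
  assumes "continuous_on UNIV g"
    and "\<And>x. (F has_real_derivative g x) (at x)"
  shows "prim g x = F x - F 0"
  unfolding prim_def
proof (rule interval_integral_FTC_finite)
  show "continuous_on {min 0 x..max 0 x} g"
    by (rule continuous_on_subset[OF assms(1)]) simp
  show "(F has_vector_derivative g y) (at y within {min 0 x..max 0 x})" for y
    using assms(2)[of y] has_real_derivative_iff_has_vector_derivative
      has_vector_derivative_at_within by blast
qed

lemma prim_C1_derivative: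
  assumes "continuous_on UNIV g"
  shows "(prim g has_real_derivative g x) (at x)"
proof -
  let ?a = "min 0 x - 1" and ?b = "max 0 x + 1"
  have "((\<lambda>u. LBINT y=ereal 0..ereal u. g y) has_vector_derivative g x) (at x within {?a..?b})"
    by (rule interval_integral_FTC2) (auto intro: continuous_on_subset[OF assms])
  moreover have "at x within {?a..?b} = at x"
    by (rule at_within_Icc_at) auto
  ultimately show ?thesis
    by (simp add: prim_def[abs_def] has_real_derivative_iff_has_vector_derivative)
qed

text \<open>Integration by parts for primitives is Fubini's theorem on a triangle.\<close>

lemma triangle_Fubini:
  fixes u v :: "real \<Rightarrow> real"
  assumes u: "integrable lborel u" and v: "integrable lborel v"
  shows "(\<integral>s. u s * (\<integral>y. indicator {..s} y * v y \<partial>lborel) \<partial>lborel)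
       + (\<integral>y. v y * (\<integral>s. indicator {..y} s * u s \<partial>lborel) \<partial>lborel)
     = (\<integral>s. u s \<partial>lborel) * (\<integral>y. v y \<partial>lborel)"
    and "integrable lborel (\<lambda>s. u s * (\<integral>y. indicator {..s} y * v y \<partial>lborel))"
proof -
  have [measurable]: "u \<in> borel_measurable borel" "v \<in> borel_measurable borel"
    using u v by auto
  have uv: "integrable (lborel \<Otimes>\<^sub>M lborel) (\<lambda>(s, y). u s * v y)"
    using u v by (intro lborel_pair.Fubini_integrable) (auto simp: abs_mult)
  define A where "A = (\<lambda>(s::real, y::real). indicator {..s} y * (u s * v y))"
  define B where "B = (\<lambda>(s::real, y::real). indicator {..y} s * (u s * v y))"
  have AB_meas[measurable]: "A \<in> borel_measurable (lborel \<Otimes>\<^sub>M lborel)" "B \<in> borel_measurable (lborel \<Otimes>\<^sub>M lborel)"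
    unfolding A_def B_def by (auto simp: indicator_def)
  have A: "integrable (lborel \<Otimes>\<^sub>M lborel) A" and B: "integrable (lborel \<Otimes>\<^sub>M lborel) B"
    by (rule Bochner_Integration.integrable_bound[OF uv AB_meas(1)],
        auto simp: A_def split: split_indicator)
       (rule Bochner_Integration.integrable_bound[OF uv AB_meas(2)],
        auto simp: B_def split: split_indicator)
  have A1: "(\<integral>y. A (s, y) \<partial>lborel) = u s * (\<integral>y. indicator {..s} y * v y \<partial>lborel)" for s
    by (simp add: A_def mult.left_commute[of _ "u s"])
  have B1: "(\<integral>s. B (s, y) \<partial>lborel) = v y * (\<integral>s. indicator {..y} s * u s \<partial>lborel)" for y
    by (simp add: B_def mult.left_commute[of _ "v y"] mult.commute[of _ "v y"])
  show "integrable lborel (\<lambda>s. u s * (\<integral>y. indicator {..s} y * v y \<partial>lborel))"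
    using lborel_pair.integrable_fst'[OF A] by (simp add: A1)
  have "AE p in lborel \<Otimes>\<^sub>M lborel. fst p \<noteq> (snd p :: real)"
  proof (rule lborel_pair.AE_pair_measure)
    show "{x \<in> space (lborel \<Otimes>\<^sub>M lborel). fst x \<noteq> (snd x :: real)} \<in> sets (lborel \<Otimes>\<^sub>M lborel)"
      by measurable
    show "AE x in lborel. AE y in lborel. fst (x, y) \<noteq> (snd (x, y) :: real)"
      by (rule AE_I2, simp, rule AE_mp[OF AE_lborel_singleton], auto)
  qed
  then have "AE p in lborel \<Otimes>\<^sub>M lborel. A p + B p = (\<lambda>(s, y). u s * v y) p"
    by eventually_elim (auto simp: A_def B_def split: split_indicator)
  then have "(\<integral>p. A p + B p \<partial>(lborel \<Otimes>\<^sub>M lborel)) = (\<integral>p. (\<lambda>(s, y). u s * v y) p \<partial>(lborel \<Otimes>\<^sub>M lborel))"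
    using A B uv by (intro integral_cong_AE) auto
  also have "\<dots> = (\<integral>s. u s \<partial>lborel) * (\<integral>y. v y \<partial>lborel)"
    using lborel_pair.integral_fst'[OF uv] by simp
  also have "(\<integral>p. A p + B p \<partial>(lborel \<Otimes>\<^sub>M lborel))
      = (\<integral>p. A p \<partial>(lborel \<Otimes>\<^sub>M lborel)) + (\<integral>p. B p \<partial>(lborel \<Otimes>\<^sub>M lborel))"
    by (intro Bochner_Integration.integral_add A B)
  also have "(\<integral>p. A p \<partial>(lborel \<Otimes>\<^sub>M lborel)) = (\<integral>s. u s * (\<integral>y. indicator {..s} y * v y \<partial>lborel) \<partial>lborel)"
    using lborel_pair.integral_fst'[OF A] by (simp add: A1)
  also have "(\<integral>p. B p \<partial>(lborel \<Otimes>\<^sub>M lborel)) = (\<integral>y. v y * (\<integral>s. indicator {..y} s * u s \<partial>lborel) \<partial>lborel)"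
    using lborel_pair.integral_snd[of "\<lambda>s y. B (s, y)"] B by (simp add: B1)
  finally show "(\<integral>s. u s * (\<integral>y. indicator {..s} y * v y \<partial>lborel) \<partial>lborel)
       + (\<integral>y. v y * (\<integral>s. indicator {..y} s * u s \<partial>lborel) \<partial>lborel)
     = (\<integral>s. u s \<partial>lborel) * (\<integral>y. v y \<partial>lborel)" .
qed

lemma prim_by_parts:
  assumes f: "f \<in> sqi lborel" and g: "g \<in> sqi lborel" and x: "x \<ge> 0"
  shows "(\<integral>y. indicator {0..x} y * (f y * (b + prim g y) + (a + prim f y) * g y) \<partial>lborel)
     = (a + prim f x) * (b + prim g x) - a * b"
    and "integrable lborel (\<lambda>y. indicator {0..x} y * (f y * (b + prim g y) + (a + prim f y) * g y))"
proof -
  let ?u = "\<lambda>y. indicator {0..x} y * f y" and ?v = "\<lambda>y. indicator {0..x} y * g y"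
  have u: "integrable lborel ?u" and v: "integrable lborel ?v"
    using f g by (auto intro: indicator_Icc_mult_integrable)
  have cut: "indicator {0..x} s * k s * (\<integral>y. indicator {..s} y * (indicator {0..x} y * h y) \<partial>lborel)
      = indicator {0..x} s * k s * prim h s" for s :: real and h k :: "real \<Rightarrow> real"
  proof (cases "s \<in> {0..x}")
    case True
    then have "(\<integral>y. indicator {..s} y * (indicator {0..x} y * h y) \<partial>lborel) = prim h s"
      by (subst prim_nonneg_eq) (auto intro!: Bochner_Integration.integral_cong split: split_indicator)
    then show ?thesis
      by simp
  qed simp
  note tri = triangle_Fubini[OF u v] triangle_Fubini[OF v u]
  have eq: "indicator {0..x} y * (f y * (b + prim g y) + (a + prim f y) * g y)
      = b * ?u y + a * ?v y + (?u y * prim g y + ?v y * prim f y)" for y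
    by (simp add: algebra_simps)
  have i1: "integrable lborel (\<lambda>y. ?u y * prim g y)" and i2: "integrable lborel (\<lambda>y. ?v y * prim f y)"
    using tri(2,4) by (simp_all only: cut)
  show "integrable lborel (\<lambda>y. indicator {0..x} y * (f y * (b + prim g y) + (a + prim f y) * g y))"
    unfolding eq using u v i1 i2 by (intro Bochner_Integration.integrable_add Bochner_Integration.integrable_mult_right)
  have "(\<integral>y. b * ?u y + a * ?v y + (?u y * prim g y + ?v y * prim f y) \<partial>lborel)
      = b * (\<integral>y. ?u y \<partial>lborel) + a * (\<integral>y. ?v y \<partial>lborel)
        + ((\<integral>y. ?u y * prim g y \<partial>lborel) + (\<integral>y. ?v y * prim f y \<partial>lborel))"
    using u v i1 i2 by (simp only: Bochner_Integration.integral_add Bochner_Integration.integrable_add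
        Bochner_Integration.integrable_mult_right Bochner_Integration.integral_mult_right_zero)
  also have "(\<integral>y. ?u y * prim g y \<partial>lborel) + (\<integral>y. ?v y * prim f y \<partial>lborel)
      = (\<integral>y. ?u y \<partial>lborel) * (\<integral>y. ?v y \<partial>lborel)"
    using tri(1) by (simp only: cut)
  finally show "(\<integral>y. indicator {0..x} y * (f y * (b + prim g y) + (a + prim f y) * g y) \<partial>lborel)
     = (a + prim f x) * (b + prim g x) - a * b"
    unfolding eq prim_nonneg_eq[OF x] by (simp add: algebra_simps)
qed

text \<open>A function that is integrable on the half-line and has a limit at infinity has limit 0;
  this removes the boundary term at infinity in the integration by parts.\<close>

lemma limit_of_integrable:
  fixes H :: "real \<Rightarrow> real"
  assumes int: "integrable lborel (\<lambda>x. indicator {0..} x * H x)" and lim: "(H \<longlongrightarrow> L) at_top"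
  shows "L = 0"
proof (rule ccontr)
  assume "L \<noteq> 0"
  have "\<forall>\<^sub>F x in at_top. dist (H x) L < \<bar>L\<bar> / 2"
    using \<open>L \<noteq> 0\<close> by (intro tendstoD[OF lim]) simp
  then obtain M0 where "\<And>x. x \<ge> M0 \<Longrightarrow> dist (H x) L < \<bar>L\<bar> / 2"
    by (auto simp: eventually_at_top_linorder)
  moreover define M where "M = max M0 0"
  ultimately have M: "M \<ge> 0" "\<And>x. x \<ge> M \<Longrightarrow> \<bar>L\<bar> / 2 \<le> \<bar>H x\<bar>"
    by (auto simp: dist_real_def) (smt (verit))
  let ?I = "\<integral>x. \<bar>indicator {0..} x * H x\<bar> \<partial>lborel"
  have le: "real n * (\<bar>L\<bar> / 2) \<le> ?I" for n
  proof -
    have "real n * (\<bar>L\<bar> / 2) = (\<integral>x. \<bar>L\<bar> / 2 * indicator {M..M + real n} x \<partial>lborel)"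
      by simp
    also have "\<dots> \<le> ?I"
      using int M by (intro integral_mono) (auto split: split_indicator)
    finally show ?thesis .
  qed
  obtain n where "?I / (\<bar>L\<bar> / 2) < real n"
    using reals_Archimedean2 by blast
  then show False
    using le[of n] \<open>L \<noteq> 0\<close> by (simp add: field_simps)
qed

lemma half_line_by_parts:
  assumes f: "f \<in> sqi lborel" and g: "g \<in> sqi lborel"
    and F: "(\<lambda>x. indicator {0..} x * (a + prim f x)) \<in> sqi lborel"
    and G: "(\<lambda>x. indicator {0..} x * (b + prim g x)) \<in> sqi lborel"
  shows "(\<integral>y. indicator {0..} y * (f y * (b + prim g y)) \<partial>lborel)
     + (\<integral>y. indicator {0..} y * ((a + prim f y) * g y) \<partial>lborel) = - (a * b)"
proof -
  have [measurable]: "f \<in> borel_measurable borel" "g \<in> borel_measurable borel"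
    "prim f \<in> borel_measurable borel" "prim g \<in> borel_measurable borel"
    using sqi_measurable[OF f] sqi_measurable[OF g] f g by auto
  let ?h = "\<lambda>y. f y * (b + prim g y) + (a + prim f y) * g y"
  have i1: "integrable lborel (\<lambda>y. indicator {0..} y * (f y * (b + prim g y)))"
    using sqi_integrable_mult[OF f G] by (simp add: mult.left_commute)
  have i2: "integrable lborel (\<lambda>y. indicator {0..} y * ((a + prim f y) * g y))"
    using sqi_integrable_mult[OF F g] by (simp add: mult.assoc)
  have int: "integrable lborel (\<lambda>y. indicator {0..} y * ?h y)"
    using Bochner_Integration.integrable_add[OF i1 i2] by (simp add: distrib_left)
  let ?H = "\<lambda>x. (a + prim f x) * (b + prim g x)"
  have "((\<lambda>x. \<integral>y. indicator {0..x} y * ?h y \<partial>lborel) \<longlongrightarrow> (\<integral>y. indicator {0..} y * ?h y \<partial>lborel)) at_top"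
  proof (rule integral_dominated_convergence_at_top[where w = "\<lambda>y. \<bar>indicator {0..} y * ?h y\<bar>"])
    show "AE y in lborel. ((\<lambda>x. indicator {0..x} y * ?h y) \<longlongrightarrow> indicator {0..} y * ?h y) at_top"
      by (intro AE_I2 tendsto_eventually eventually_mono[OF eventually_ge_at_top])
        (auto split: split_indicator)
    show "\<forall>\<^sub>F x in at_top. AE y in lborel. norm (indicator {0..x} y * ?h y) \<le> \<bar>indicator {0..} y * ?h y\<bar>"
      by (intro always_eventually allI AE_I2) (auto split: split_indicator)
  qed (use int in simp_all)
  then have "((\<lambda>x. (\<integral>y. indicator {0..x} y * ?h y \<partial>lborel) + a * b)
      \<longlongrightarrow> (\<integral>y. indicator {0..} y * ?h y \<partial>lborel) + a * b) at_top"
    by (intro tendsto_intros)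
  then have lim: "(?H \<longlongrightarrow> (\<integral>y. indicator {0..} y * ?h y \<partial>lborel) + a * b) at_top"
    by (rule Lim_transform_eventually)
      (use eventually_ge_at_top[of 0] in eventually_elim, use prim_by_parts(1)[OF f g] in simp)
  have "integrable lborel (\<lambda>x. indicator {0..} x * ?H x)"
    by (rule Bochner_Integration.integrable_cong[THEN iffD1, OF refl _ sqi_integrable_mult[OF F G]])
      (auto split: split_indicator)
  from limit_of_integrable[OF this lim] show ?thesis
    using Bochner_Integration.integral_add[OF i1 i2] by (simp add: distrib_left)
qed

section \<open>The Sobolev space of the half-line\<close>

lemma AE_leg: "(AE x in leg. P x) \<longleftrightarrow> (AE x in lborel. x \<ge> 0 \<longrightarrow> P x)"
  by (subst AE_restrict_space_iff) (auto simp: AE_completion_iff)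

lemma measurable_leg: "h \<in> borel_measurable borel \<Longrightarrow> h \<in> borel_measurable leg"
  by (intro measurable_restrict_space1 measurable_completion) simp

lemma integral_leg:
  fixes h :: "real \<Rightarrow> real"
  assumes [measurable]: "h \<in> borel_measurable borel"
  shows "(\<integral>x. h x \<partial>leg) = (\<integral>x. indicator {0..} x * h x \<partial>lborel)"
  by (subst integral_restrict_space) (simp_all add: integral_completion)

lemma integrable_leg:
  fixes h :: "real \<Rightarrow> real"
  assumes [measurable]: "h \<in> borel_measurable borel"
  shows "integrable leg h \<longleftrightarrow> integrable lborel (\<lambda>x. indicator {0..} x * h x)"
  by (subst integrable_restrict_space) (simp_all add: integrable_completion)

lemma indicator_half_line_square: "(indicator {0..} x * (h::real))\<^sup>2 = indicator {0..} x * h\<^sup>2"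
  by (auto split: split_indicator)

lemma sqi_leg_iff:
  assumes "h \<in> borel_measurable borel"
  shows "h \<in> sqi leg \<longleftrightarrow> (\<lambda>x. indicator {0..} x * h x) \<in> sqi lborel"
proof -
  have "(\<lambda>x. indicator {0..} x * h x) \<in> borel_measurable borel"
    using assms by measurable
  then show ?thesis
    using assms measurable_leg[OF assms]
    by (simp add: sqi_def integrable_leg indicator_half_line_square)
qed

lemma sqi_lborel_leg: "h \<in> sqi lborel \<Longrightarrow> h \<in> sqi leg"
  by (subst sqi_leg_iff) (auto dest: sqi_measurable intro!: sqi_bound[of h] split: split_indicator)

lemma sqi_leg_borel_rep:
  assumes f: "f \<in> sqi leg"
  shows "\<exists>g\<in>sqi lborel. AE x in leg. f x = g x"
proof -
  have "(\<lambda>x. indicator {0..} x *\<^sub>R f x) \<in> borel_measurable lebesgue"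
    using sqi_measurable[OF f] by (subst (asm) borel_measurable_restrict_space_iff) auto
  from completion_ex_borel_measurable_real[OF this]
  obtain g0 where [measurable]: "g0 \<in> borel_measurable borel"
    and g0: "AE x in lborel. indicator {0..} x *\<^sub>R f x = g0 x"
    by auto
  define g where "g = (\<lambda>x. indicator {0..} x * g0 x)"
  have [measurable]: "g \<in> borel_measurable borel"
    unfolding g_def by measurable
  have eq: "AE x in leg. f x = g x"
    unfolding AE_leg using g0 by eventually_elim (auto simp: g_def)
  have "g \<in> sqi leg"
    by (rule sqi_cong_AE[OF f]) (auto intro: measurable_leg eq)
  then have "(\<lambda>x. indicator {0..} x * g x) \<in> sqi lborel"
    by (simp add: sqi_leg_iff)
  also have "(\<lambda>x. indicator {0..} x * g x) = g"
    by (auto simp: g_def split: split_indicator)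
  finally show ?thesis
    using eq by auto
qed

lemma sqi_continuous_Icc:
  fixes f :: "real \<Rightarrow> real"
  assumes "continuous_on {a..b} f"
  shows "(\<lambda>x. indicator {a..b} x * f x) \<in> sqi lborel"
proof (rule sqiI)
  show "(\<lambda>x. indicator {a..b} x * f x) \<in> borel_measurable lborel"
    using borel_measurable_continuous_on_indicator[OF _ assms] by simp
  have "set_integrable lborel {a..b} (\<lambda>x. (f x)\<^sup>2)"
    by (intro borel_integrable_atLeastAtMost' continuous_intros assms)
  moreover have "(indicator {a..b} x * f x)\<^sup>2 = indicator {a..b} x * (f x)\<^sup>2" for x
    by (auto split: split_indicator)
  ultimately show "integrable lborel (\<lambda>x. (indicator {a..b} x * f x)\<^sup>2)"
    by (simp add: set_integrable_def)
qed

lemma test_fun_facts: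
  assumes "test_fun \<phi>"
  obtains c d where "0 < c" "c < d" "\<And>x. x \<notin> {c..d} \<Longrightarrow> \<phi> x = 0" "\<And>x. x \<notin> {c..d} \<Longrightarrow> deriv \<phi> x = 0"
    "\<And>x. (\<phi> has_real_derivative deriv \<phi> x) (at x)" "continuous_on UNIV (deriv \<phi>)"
proof -
  let ?K = "closure {x. \<phi> x \<noteq> 0}"
  obtain D where D: "\<And>x. (\<phi> has_vector_derivative D x) (at x)" "continuous_on UNIV D"
    using assms by (auto simp: test_fun_def C1_differentiable_on_def)
  then have D': "(\<phi> has_real_derivative D x) (at x)" for x
    by (simp add: has_real_derivative_iff_has_vector_derivative)
  then have [simp]: "deriv \<phi> = D"
    by (auto intro: DERIV_imp_deriv)
  have K: "compact ?K" "?K \<subseteq> {0<..}"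
    using assms by (auto simp: test_fun_def)
  obtain c d where cd: "0 < c" "c < d" "?K \<subseteq> {c..d}"
  proof (cases "?K = {}")
    case True
    then show ?thesis
      using that[of 1 2] by auto
  next
    case False
    obtain c where c: "c \<in> ?K" "\<And>x. x \<in> ?K \<Longrightarrow> c \<le> x"
      using compact_attains_inf[OF K(1) False] by blast
    obtain d where d: "d \<in> ?K" "\<And>x. x \<in> ?K \<Longrightarrow> x \<le> d"
      using compact_attains_sup[OF K(1) False] by blast
    have "0 < c"
      using c(1) K(2) by auto
    moreover have "c < d + 1"
      using c(2)[OF d(1)] by simp
    moreover have "?K \<subseteq> {c..d + 1}"
      using c(2) d(2) by (force intro: order.trans)
    ultimately show ?thesis
      using that[of c "d + 1"] by blast
  qed
  have zero: "\<phi> x = 0" if "x \<notin> {c..d}" for x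
    using cd(3) that closure_subset[of "{x. \<phi> x \<noteq> 0}"] by blast
  moreover have "D x = 0" if "x \<notin> {c..d}" for x
  proof -
    have "open (- {c..d})"
      by auto
    then have "(\<phi> has_real_derivative 0) (at x)"
      using that zero
      by (intro has_field_derivative_transform_within_open[of "\<lambda>_. 0" 0 x "- {c..d}" \<phi>]) auto
    then show ?thesis
      using D'[of x] DERIV_unique by blast
  qed
  ultimately show ?thesis
    using that[OF cd(1,2)] D' D(2) by simp
qed

lemma weak_by_parts:
  assumes g: "g \<in> sqi lborel" and \<phi>: "test_fun \<phi>"
  shows "(\<integral>x. (c + prim g x) * deriv \<phi> x \<partial>leg) = - (\<integral>x. g x * \<phi> x \<partial>leg)"
proof -
  obtain a d where ad: "0 < a" "a < d" "\<And>x. x \<notin> {a..d} \<Longrightarrow> \<phi> x = 0"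
    "\<And>x. x \<notin> {a..d} \<Longrightarrow> deriv \<phi> x = 0"
    "\<And>x. (\<phi> has_real_derivative deriv \<phi> x) (at x)" "continuous_on UNIV (deriv \<phi>)"
    using test_fun_facts[OF \<phi>] by metis
  have cont: "continuous_on UNIV \<phi>"
    using ad(5) by (auto intro!: continuous_at_imp_continuous_on DERIV_isCont)
  have [measurable]: "g \<in> borel_measurable borel" "prim g \<in> borel_measurable borel"
    "\<phi> \<in> borel_measurable borel" "deriv \<phi> \<in> borel_measurable borel"
    using sqi_measurable[OF g] g ad(6) cont by (auto intro: borel_measurable_continuous_onI)
  have \<phi>_eq: "\<phi> = (\<lambda>x. indicator {a..d} x * \<phi> x)" and d\<phi>_eq: "deriv \<phi> = (\<lambda>x. indicator {a..d} x * deriv \<phi> x)"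
    using ad(3,4) by (fastforce split: split_indicator)+
  have \<phi>_sqi: "\<phi> \<in> sqi lborel" and d\<phi>_sqi: "deriv \<phi> \<in> sqi lborel"
    by (subst \<phi>_eq, rule sqi_continuous_Icc[OF continuous_on_subset[OF cont]], simp)
      (subst d\<phi>_eq, rule sqi_continuous_Icc[OF continuous_on_subset[OF ad(6)]], simp)
  have "\<phi> 0 = 0" "\<phi> (d + 1) = 0"
    using ad(1,2) by (auto intro!: ad(3))
  then have prim: "prim (deriv \<phi>) x = \<phi> x" for x
    using prim_C1[OF ad(6,5), of x] by simp
  let ?A = "\<lambda>y. indicator {0..} y * (g y * \<phi> y)" and ?B = "\<lambda>y. indicator {0..} y * ((c + prim g y) * deriv \<phi> y)"
  have A: "integrable lborel ?A"
    by (rule Bochner_Integration.integrable_bound[OF sqi_integrable_mult[OF g \<phi>_sqi]])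
      (auto split: split_indicator)
  have B: "integrable lborel ?B"
  proof -
    have "(\<lambda>x. indicator {a..d} x * (c + prim g x)) \<in> sqi lborel"
      by (intro sqi_continuous_Icc continuous_intros continuous_on_prim g)
    from sqi_integrable_mult[OF this d\<phi>_sqi] show ?thesis
      by (rule Bochner_Integration.integrable_cong[THEN iffD1, OF refl, rotated])
        (use ad in \<open>auto split: split_indicator\<close>)
  qed
  have "(\<integral>y. ?A y \<partial>lborel) + (\<integral>y. ?B y \<partial>lborel) = (\<integral>y. ?A y + ?B y \<partial>lborel)"
    by (rule Bochner_Integration.integral_add[OF A B, symmetric])
  also have "\<dots> = (\<integral>y. indicator {0..d + 1} y * (g y * (0 + prim (deriv \<phi>) y) + (c + prim g y) * deriv \<phi> y) \<partial>lborel)"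
    by (rule Bochner_Integration.integral_cong) (use ad(3,4) in \<open>auto simp: prim split: split_indicator\<close>)
  also have "\<dots> = 0"
    using prim_by_parts(1)[OF g d\<phi>_sqi, of "d + 1" 0 c] ad(1,2) \<open>\<phi> (d + 1) = 0\<close> by (simp add: prim)
  finally show ?thesis
    by (simp add: integral_leg)
qed

text \<open>A continuous cut-off: as \<open>n\<close> grows, \<open>plateau n a b\<close> tends to the indicator of the
  open interval.\<close>

definition plateau :: "nat \<Rightarrow> real \<Rightarrow> real \<Rightarrow> real \<Rightarrow> real" where
  "plateau n a b x = max 0 (min 1 (real n * min (x - a) (b - x)))"

lemma plateau_continuous: "continuous_on S (plateau n a b)"
  unfolding plateau_def[abs_def] by (intro continuous_intros)

lemma plateau_measurable[measurable]: "plateau n a b \<in> borel_measurable borel"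
  by (intro borel_measurable_continuous_onI plateau_continuous)

lemma plateau_outside:
  assumes "x \<notin> {a<..<b}"
  shows "plateau n a b x = 0"
proof -
  have "real n * min (x - a) (b - x) \<le> 0"
    using assms by (intro mult_nonneg_nonpos) auto
  then show ?thesis
    by (simp add: plateau_def)
qed

lemma plateau_bounds: "0 \<le> plateau n a b x" "plateau n a b x \<le> 1"
  by (auto simp: plateau_def)

lemma plateau_lim: "(\<lambda>n. plateau n a b x) \<longlonglongrightarrow> indicator {a<..<b} x"
proof (cases "x \<in> {a<..<b}")
  case True
  define m where "m = min (x - a) (b - x)"
  have "m > 0"
    using True by (auto simp: m_def)
  obtain n0 where n0: "1 / m < real n0"
    using reals_Archimedean2 by blast
  have "plateau n a b x = 1" if "n \<ge> n0" for n
  proof -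
    have "1 < real n0 * m"
      using n0 \<open>m > 0\<close> by (simp add: field_simps)
    also have "\<dots> \<le> real n * m"
      using that \<open>m > 0\<close> by (intro mult_right_mono) auto
    finally show ?thesis
      by (simp add: plateau_def m_def)
  qed
  then have "\<forall>\<^sub>F n in sequentially. plateau n a b x = indicator {a<..<b} x"
    using True by (intro eventually_sequentiallyI[of n0]) simp
  then show ?thesis
    by (rule tendsto_eventually)
next
  case False
  then have "plateau n a b x = 0" for n
    by (rule plateau_outside)
  then show ?thesis
    using False by simp
qed

lemma plateau_integral_lim:
  fixes u :: "real \<Rightarrow> real"
  assumes [measurable]: "u \<in> borel_measurable borel" and u: "integrable lborel (\<lambda>x. indicator {a..b} x * u x)"
  shows "(\<lambda>n. \<integral>x. u x * plateau n a b x \<partial>lborel) \<longlonglongrightarrow> (\<integral>x. indicator {a..b} x * u x \<partial>lborel)"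
    and "integrable lborel (\<lambda>x. u x * plateau n a b x)"
proof -
  have AE: "AE x in lborel. x \<noteq> a \<and> x \<noteq> b"
    by (intro AE_conjI AE_lborel_singleton)
  have bound: "\<bar>u x * plateau n a b x\<bar> \<le> \<bar>indicator {a..b} x * u x\<bar>" for n x
    using plateau_bounds[of n a b x] plateau_outside[of x a b n]
    by (auto simp: abs_mult mult_left_le split: split_indicator)
  show "(\<lambda>n. \<integral>x. u x * plateau n a b x \<partial>lborel) \<longlonglongrightarrow> (\<integral>x. indicator {a..b} x * u x \<partial>lborel)"
  proof (rule integral_dominated_convergence[where w = "\<lambda>x. \<bar>indicator {a..b} x * u x\<bar>"])
    show "AE x in lborel. (\<lambda>n. u x * plateau n a b x) \<longlonglongrightarrow> indicator {a..b} x * u x"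
      using AE
    proof eventually_elim
      case (elim x)
      have "(\<lambda>n. u x * plateau n a b x) \<longlonglongrightarrow> u x * indicator {a<..<b} x"
        by (intro tendsto_intros plateau_lim)
      also have "u x * indicator {a<..<b} x = indicator {a..b} x * u x"
        using elim by (auto split: split_indicator)
      finally show ?case .
    qed
  qed (use u bound in auto)
  show "integrable lborel (\<lambda>x. u x * plateau n a b x)"
    by (rule Bochner_Integration.integrable_bound[OF u]) (use bound in auto)
qed

lemma AE_zero_if_interval_integrals_zero:
  fixes w :: "real \<Rightarrow> real"
  assumes w: "integrable lborel w" and zero: "\<And>x. x \<notin> {c..d} \<Longrightarrow> w x = 0"
    and int: "\<And>a b. a \<le> b \<Longrightarrow> (\<integral>x. indicator {a..b} x * w x \<partial>lborel) = 0"
  shows "AE x in lborel. w x = 0"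
proof (rule density_unique_real[OF w, of "\<lambda>_. 0"])
  have w_eq: "indicator {min c d..max c d} x * w x = w x" for x
    using zero[of x] by (cases "x \<in> {c..d}") (auto simp: min_le_iff_disj le_max_iff_disj)
  then have all: "(\<integral>x. w x \<partial>lborel) = 0"
    using int[of "min c d" "max c d"] by (simp add: w_eq)
  have ind: "integrable lborel (\<lambda>x. indicator A x * w x)" if "A \<in> sets borel" for A
    using integrable_mult_indicator[OF _ w, of A] that by simp
  fix A :: "real set" assume "A \<in> sets lborel"
  then have "A \<in> sets borel"
    by simp
  then have "(\<integral>x. indicator A x * w x \<partial>lborel) = 0"
  proof (induction rule: borel_set_induct)
    case (interval a b)
    then show ?case
      using int by simp
  next
    case (compl A)
    have "(\<integral>x. indicator (- A) x * w x \<partial>lborel) = (\<integral>x. w x - indicator A x * w x \<partial>lborel)"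
      by (intro Bochner_Integration.integral_cong) (auto split: split_indicator)
    also have "\<dots> = 0"
      using w ind[OF compl(1)] compl all by simp
    finally show ?case .
  next
    case (union F)
    have [measurable]: "F i \<in> sets borel" for i
      using union by auto
    have "(\<lambda>n. \<integral>x. indicator (\<Union>i<n. F i) x * w x \<partial>lborel) \<longlonglongrightarrow> (\<integral>x. indicator (\<Union>i. F i) x * w x \<partial>lborel)"
    proof (rule integral_dominated_convergence[where w = "\<lambda>x. \<bar>w x\<bar>"])
      show "AE x in lborel. (\<lambda>n. indicator (\<Union>i<n. F i) x * w x) \<longlonglongrightarrow> indicator (\<Union>i. F i) x * w x"
        by (intro AE_I2 tendsto_intros LIMSEQ_indicator_UN)
    qed (use w in \<open>auto split: split_indicator\<close>)
    moreover have "(\<integral>x. indicator (\<Union>i<n. F i) x * w x \<partial>lborel) = 0" for n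
    proof (induction n)
      case (Suc n)
      have "F n \<inter> (\<Union>i<n. F i) = {}"
        using union(1) by (auto simp: disjoint_family_on_def) (metis disjoint_iff less_irrefl)
      then have "indicator (\<Union>i<Suc n. F i) x * w x
          = indicator (F n) x * w x + indicator (\<Union>i<n. F i) x * w x" for x
        by (auto simp: lessThan_Suc split: split_indicator)
      then show ?case
        using ind[of "F n"] ind[of "\<Union>i<n. F i"] Suc union(3)[of n] by simp
    qed simp
    ultimately show ?case
      by (simp add: LIMSEQ_const_iff)
  qed simp
  then show "(LINT x:A|lborel. w x) = (LINT x:A|lborel. 0)"
    by (simp add: set_lebesgue_integral_def)
qed simp

lemma AE_zero_half_line:
  fixes v :: "real \<Rightarrow> real"
  assumes [measurable]: "v \<in> borel_measurable borel"
    and v: "\<And>a b. 0 < a \<Longrightarrow> a \<le> b \<Longrightarrow> integrable lborel (\<lambda>x. indicator {a..b} x * v x)"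
    and int: "\<And>a b. 0 < a \<Longrightarrow> a < b \<Longrightarrow> (\<integral>x. indicator {a..b} x * v x \<partial>lborel) = 0"
  shows "AE x in lborel. x > 0 \<longrightarrow> v x = 0"
proof -
  have "AE x in lborel. indicator {1 / real (Suc n)..real (Suc n)} x * v x = 0" for n
  proof (rule AE_zero_if_interval_integrals_zero)
    let ?c = "1 / real (Suc n)" and ?d = "real (Suc n)"
    have cd: "0 < ?c" "?c \<le> ?d"
      by (auto simp: field_simps)
    show "integrable lborel (\<lambda>x. indicator {?c..?d} x * v x)"
      by (rule v) (use cd in auto)
    show "indicator {?c..?d} x * v x = 0" if "x \<notin> {?c..?d}" for x
      using that by simp
    fix a b :: real
    have eq: "(\<integral>x. indicator {a..b} x * (indicator {?c..?d} x * v x) \<partial>lborel)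
        = (\<integral>x. indicator {max a ?c..min b ?d} x * v x \<partial>lborel)"
      by (intro Bochner_Integration.integral_cong) (auto split: split_indicator)
    show "(\<integral>x. indicator {a..b} x * (indicator {?c..?d} x * v x) \<partial>lborel) = 0"
    proof (cases "max a ?c < min b ?d")
      case True
      then show ?thesis
        unfolding eq using cd(1) by (intro int less_le_trans[OF cd(1) max.cobounded2])
    next
      case False
      have "AE x in lborel. x \<noteq> max a ?c"
        by (rule AE_lborel_singleton)
      then have "(\<integral>x. indicator {max a ?c..min b ?d} x * v x \<partial>lborel) = (\<integral>x. 0 \<partial>(lborel :: real measure))"
        using False by (intro integral_cong_AE) (auto elim!: eventually_mono split: split_indicator)
      then show ?thesis
        unfolding eq by simp
    qed
  qed
  then have "AE x in lborel. \<forall>n. indicator {1 / real (Suc n)..real (Suc n)} x * v x = 0"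
    unfolding AE_all_countable by blast
  then show ?thesis
  proof eventually_elim
    case (elim x)
    show ?case
    proof
      assume "x > 0"
      obtain n where n: "max x (1 / x) < real n"
        using reals_Archimedean2 by blast
      then have "1 / real (Suc n) \<le> x" "x \<le> real (Suc n)"
        using \<open>x > 0\<close> by (auto simp: field_simps)
      then show "v x = 0"
        using elim[rule_format, of n] by simp
    qed
  qed
qed

lemma test_fun_prim:
  assumes \<psi>: "continuous_on UNIV \<psi>" and supp: "0 < c" "\<And>x. x \<notin> {c..d} \<Longrightarrow> \<psi> x = 0"
    and zero: "(\<integral>x. \<psi> x \<partial>lborel) = 0"
  shows "test_fun (prim \<psi>)" "deriv (prim \<psi>) = \<psi>"
proof -
  have der: "(prim \<psi> has_real_derivative \<psi> x) (at x)" for x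
    by (rule prim_C1_derivative[OF \<psi>])
  then show "deriv (prim \<psi>) = \<psi>"
    by (auto intro: DERIV_imp_deriv)
  have \<psi>_eq: "\<psi> = (\<lambda>x. indicator {c..d} x * \<psi> x)"
    using supp by (fastforce split: split_indicator)
  have sqi: "\<psi> \<in> sqi lborel"
    by (subst \<psi>_eq, rule sqi_continuous_Icc[OF continuous_on_subset[OF \<psi>]]) simp
  have "prim \<psi> x = 0" if "x \<notin> {c..max c d}" for x
  proof (cases "x < c")
    case True
    have "prim \<psi> (max 0 x) - prim \<psi> (min 0 x) = (\<integral>y. indicator {min 0 x..max 0 x} y * \<psi> y \<partial>lborel)"
      by (rule prim_diff_le[OF sqi]) simp
    also have "\<dots> = (\<integral>y. 0 \<partial>(lborel :: real measure))"
      using True \<open>0 < c\<close> by (intro Bochner_Integration.integral_cong) (auto intro!: supp(2) split: split_indicator)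
    finally show ?thesis
      by (cases "x \<ge> 0") auto
  next
    case False
    then have "prim \<psi> x = (\<integral>y. indicator {0..x} y * \<psi> y \<partial>lborel)"
      using \<open>0 < c\<close> by (intro prim_nonneg_eq) simp
    also have "\<dots> = (\<integral>y. \<psi> y \<partial>lborel)"
      using False that \<open>0 < c\<close>
      by (intro Bochner_Integration.integral_cong) (auto intro!: supp(2) split: split_indicator)
    finally show ?thesis
      using zero by simp
  qed
  then have "{x. prim \<psi> x \<noteq> 0} \<subseteq> {c..max c d}"
    by blast
  then have cl: "closure {x. prim \<psi> x \<noteq> 0} \<subseteq> {c..max c d}"
    by (rule closure_minimal) simp
  have "compact (closure {x. prim \<psi> x \<noteq> 0})"
    using bounded_subset[OF bounded_closed_interval cl] by (simp add: compact_eq_bounded_closed)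
  moreover have "prim \<psi> C1_differentiable_on UNIV"
    unfolding C1_differentiable_on_def using der \<psi>
    by (auto simp: has_real_derivative_iff_has_vector_derivative)
  ultimately show "test_fun (prim \<psi>)"
    using cl \<open>0 < c\<close> by (force simp: test_fun_def)
qed

text \<open>The lemma of du Bois-Reymond.  With $u(x) = f(x) - \int_0^x g$, testing against the primitive of a
  combination of two plateaus with total mass zero shows that the mean of $u$ over an interval does
  not depend on the interval.\<close>

lemma weak_deriv_imp_prim:
  assumes f: "f \<in> sqi leg" and g: "g \<in> sqi leg" and weak: "has_weak_deriv f g"
    and g0: "g0 \<in> sqi lborel" and g_eq: "AE x in leg. g x = g0 x"
  shows "\<exists>c. AE x in leg. f x = c + prim g0 x"
proof -
  obtain f0 where f0: "f0 \<in> sqi lborel" and f_eq: "AE x in leg. f x = f0 x"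
    using sqi_leg_borel_rep[OF f] by blast
  define u where "u = (\<lambda>x. f0 x - prim g0 x)"
  have [measurable]: "f0 \<in> borel_measurable borel" "g0 \<in> borel_measurable borel"
    "f \<in> borel_measurable leg" "g \<in> borel_measurable leg" "prim g0 \<in> borel_measurable borel"
    using f0 g0 f g by (auto dest: sqi_measurable)
  have [measurable]: "u \<in> borel_measurable borel"
    unfolding u_def by measurable
  have prim_sqi: "(\<lambda>x. indicator {a..b} x * prim g0 x) \<in> sqi lborel" for a b
    by (intro sqi_continuous_Icc continuous_on_prim g0)
  have f0_sqi: "(\<lambda>x. indicator {a..b} x * f0 x) \<in> sqi lborel" for a b
    by (rule sqi_bound[OF f0]) (auto split: split_indicator)
  have u_int: "integrable lborel (\<lambda>x. indicator {a..b} x * u x)" for a b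
  proof -
    have "integrable lborel (\<lambda>x. indicator {a..b} x * (indicator {a..b} x * f0 x - indicator {a..b} x * prim g0 x))"
      by (intro sqi_integrable_mult indicator_Icc_sqi sqi_diff prim_sqi f0_sqi)
    then show ?thesis
      by (rule Bochner_Integration.integrable_cong[THEN iffD1, OF refl, rotated])
        (auto simp: u_def split: split_indicator)
  qed
  have test: "(\<integral>x. u x * \<psi> x \<partial>lborel) = 0"
    if \<psi>: "continuous_on UNIV \<psi>" "0 < c" "\<And>x. x \<notin> {c..d} \<Longrightarrow> \<psi> x = 0" "(\<integral>x. \<psi> x \<partial>lborel) = 0" for \<psi> c d
  proof -
    have t: "test_fun (prim \<psi>)" "deriv (prim \<psi>) = \<psi>"
      using test_fun_prim[of \<psi> c d] \<psi> by blast+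
    have [measurable]: "\<psi> \<in> borel_measurable borel"
      by (rule borel_measurable_continuous_onI[OF \<psi>(1)])
    have \<psi>_eq: "\<psi> = (\<lambda>x. indicator {c..d} x * \<psi> x)"
      using \<psi>(3) by (fastforce split: split_indicator)
    have \<psi>_sqi: "\<psi> \<in> sqi lborel"
      by (subst \<psi>_eq, rule sqi_continuous_Icc[OF continuous_on_subset[OF \<psi>(1)]]) simp
    have [measurable]: "\<psi> \<in> borel_measurable leg" "prim \<psi> \<in> borel_measurable leg" "f0 \<in> borel_measurable leg"
       "g0 \<in> borel_measurable leg" "prim g0 \<in> borel_measurable leg"
      by (intro measurable_leg; simp add: \<psi>_sqi prim_measurable)+
    have "(\<integral>x. f0 x * \<psi> x \<partial>leg) = (\<integral>x. f x * \<psi> x \<partial>leg)"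
      by (rule integral_cong_AE) (use f_eq in auto)
    also have "\<dots> = - (\<integral>x. g x * prim \<psi> x \<partial>leg)"
      using weak t by (auto simp: has_weak_deriv_def)
    also have "(\<integral>x. g x * prim \<psi> x \<partial>leg) = (\<integral>x. g0 x * prim \<psi> x \<partial>leg)"
      by (rule integral_cong_AE) (use g_eq in auto)
    also have "- (\<integral>x. g0 x * prim \<psi> x \<partial>leg) = (\<integral>x. prim g0 x * \<psi> x \<partial>leg)"
      using weak_by_parts[OF g0 t(1), of 0] t(2) by simp
    finally have eq: "(\<integral>x. indicator {0..} x * (f0 x * \<psi> x) \<partial>lborel)
        = (\<integral>x. indicator {0..} x * (prim g0 x * \<psi> x) \<partial>lborel)"
      by (simp add: integral_leg)
    have supp: "indicator {0..} x * (h * \<psi> x) = h * \<psi> x" for h x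
      using \<psi>(2) \<psi>(3)[of x] by (cases "x \<in> {c..d}") auto
    have i1: "integrable lborel (\<lambda>x. f0 x * \<psi> x)"
      by (rule sqi_integrable_mult[OF f0 \<psi>_sqi])
    have i2: "integrable lborel (\<lambda>x. prim g0 x * \<psi> x)"
      using sqi_integrable_mult[OF prim_sqi[of c d] \<psi>_sqi]
      by (rule Bochner_Integration.integrable_cong[THEN iffD1, OF refl, rotated])
        (use \<psi>(3) in \<open>auto split: split_indicator\<close>)
    show ?thesis
      using eq i1 i2 by (simp add: supp u_def left_diff_distrib)
  qed
  define c where "c = (\<integral>x. indicator {1..2} x * u x \<partial>lborel)"
  have main: "(\<integral>x. indicator {a..b} x * u x \<partial>lborel) = c * (b - a)" if "0 < a" "a < b" for a b
  proof -
    let ?m = "\<lambda>n a b. \<integral>x. plateau n a b x \<partial>lborel"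
    have m_lim: "(\<lambda>n. ?m n a b) \<longlonglongrightarrow> b - a" "integrable lborel (plateau n a b)" if "a < b" for a b n
      using plateau_integral_lim[of "\<lambda>_. 1" a b] that by simp_all
    let ?\<psi> = "\<lambda>n x. ?m n 1 2 * plateau n a b x - ?m n a b * plateau n 1 2 x"
    have zero: "(\<integral>x. u x * ?\<psi> n x \<partial>lborel) = 0" for n
    proof (rule test)
      show "continuous_on UNIV (?\<psi> n)"
        by (intro continuous_intros plateau_continuous)
      show "0 < min a 1"
        using \<open>0 < a\<close> by simp
      show "?\<psi> n x = 0" if "x \<notin> {min a 1..max b 2}" for x
      proof -
        have "x \<notin> {a<..<b}" "x \<notin> {1<..<2}"
          using that by auto
        then show ?thesis
          by (simp add: plateau_outside)
      qed
      show "(\<integral>x. ?\<psi> n x \<partial>lborel) = 0"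
        using m_lim(2)[OF \<open>a < b\<close>, of n] m_lim(2)[of 1 2 n] by simp
    qed
    have "?m n 1 2 * (\<integral>x. u x * plateau n a b x \<partial>lborel)
        = ?m n a b * (\<integral>x. u x * plateau n 1 2 x \<partial>lborel)" for n
    proof -
      note int = plateau_integral_lim(2)[OF _ u_int[of a b], of n] plateau_integral_lim(2)[OF _ u_int[of 1 2], of n]
      have "0 = (\<integral>x. ?m n 1 2 * (u x * plateau n a b x) - ?m n a b * (u x * plateau n 1 2 x) \<partial>lborel)"
        using zero[of n] by (simp add: right_diff_distrib mult.left_commute[of "u _"])
      also have "\<dots> = (\<integral>x. ?m n 1 2 * (u x * plateau n a b x) \<partial>lborel) - (\<integral>x. ?m n a b * (u x * plateau n 1 2 x) \<partial>lborel)"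
        using int by (intro Bochner_Integration.integral_diff Bochner_Integration.integrable_mult_right) auto
      finally show ?thesis
        by simp
    qed
    moreover have "(\<lambda>n. ?m n 1 2 * (\<integral>x. u x * plateau n a b x \<partial>lborel))
        \<longlonglongrightarrow> (2 - 1) * (\<integral>x. indicator {a..b} x * u x \<partial>lborel)"
      by (intro tendsto_mult m_lim plateau_integral_lim u_int) auto
    moreover have "(\<lambda>n. ?m n a b * (\<integral>x. u x * plateau n 1 2 x \<partial>lborel)) \<longlonglongrightarrow> (b - a) * c"
      unfolding c_def using \<open>a < b\<close> by (intro tendsto_mult m_lim plateau_integral_lim u_int) auto
    ultimately have "(2 - 1) * (\<integral>x. indicator {a..b} x * u x \<partial>lborel) = (b - a) * c"
      by (auto intro: LIMSEQ_unique)
    then show ?thesis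
      by (simp add: mult.commute)
  qed
  have "AE x in lborel. x > 0 \<longrightarrow> u x - c = 0"
  proof (rule AE_zero_half_line)
    fix a b :: real assume "0 < a"
    have eq: "indicator {a..b} x * (u x - c) = indicator {a..b} x * u x - c * indicator {a..b} x" for x
      by (simp add: algebra_simps)
    have ind: "integrable lborel (\<lambda>x. c * indicator {a..b} x)"
      by (intro Bochner_Integration.integrable_mult_right integrable_real_indicator)
        (auto simp: emeasure_lborel_Icc_eq)
    show "integrable lborel (\<lambda>x. indicator {a..b} x * (u x - c))"
      unfolding eq using u_int ind by (intro Bochner_Integration.integrable_diff)
    show "(\<integral>x. indicator {a..b} x * (u x - c) \<partial>lborel) = 0" if "a < b"
      unfolding eq using u_int ind main[OF \<open>0 < a\<close> that] that by simp
  qed measurable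
  moreover have "AE x in lborel. x \<noteq> (0::real)"
    by (rule AE_lborel_singleton)
  ultimately have "AE x in leg. f x = c + prim g0 x"
    using f_eq unfolding AE_leg by eventually_elim (auto simp: u_def)
  then show ?thesis
    by blast
qed

lemma continuous_AE_zero_half_line:
  fixes h :: "real \<Rightarrow> real"
  assumes cont: "continuous_on {0..} h" and ae: "AE x in leg. h x = 0" and "x \<ge> 0"
  shows "h x = 0"
proof (rule ccontr)
  assume "h x \<noteq> 0"
  then have "\<exists>d>0. \<forall>y\<in>{0..}. dist y x < d \<longrightarrow> dist (h y) (h x) < \<bar>h x\<bar>"
    using cont \<open>x \<ge> 0\<close> unfolding continuous_on_iff by (metis atLeast_iff zero_less_abs_iff)
  then obtain d where d: "d > 0" "\<And>y. y \<ge> 0 \<Longrightarrow> dist y x < d \<Longrightarrow> dist (h y) (h x) < \<bar>h x\<bar>"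
    by auto
  have "AE y in lborel. y \<notin> {x..x + d / 2}"
    using ae unfolding AE_leg
  proof eventually_elim
    case (elim y)
    show ?case
    proof
      assume y: "y \<in> {x..x + d / 2}"
      then have "dist (h y) (h x) < \<bar>h x\<bar>"
        using \<open>x \<ge> 0\<close> d(1) by (intro d(2)) (auto simp: dist_real_def)
      moreover have "h y = 0"
        using elim y \<open>x \<ge> 0\<close> by auto
      ultimately show False
        by (simp add: dist_real_def)
    qed
  qed
  then have "emeasure lborel {x..x + d / 2} = 0"
    by (subst (asm) AE_iff_measurable[of "{x..x + d / 2}"]) auto
  then show False
    using d(1) by simp
qed

text \<open>The working description of $H^1$: \<open>H1rep f c g\<close> says that $f$ is a.e. equal to the
  continuous function with value $c$ at 0 and derivative $g$, a square-integrable Borel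
  function.\<close>

definition H1rep :: "(real \<Rightarrow> real) \<Rightarrow> real \<Rightarrow> (real \<Rightarrow> real) \<Rightarrow> bool" where
  "H1rep f c g \<longleftrightarrow> f \<in> sqi leg \<and> g \<in> sqi lborel \<and> (AE x in leg. f x = c + prim g x)"

lemma H1rep_has_weak_deriv:
  assumes "H1rep f c g"
  shows "has_weak_deriv f g"
  unfolding has_weak_deriv_def
proof (intro allI impI)
  fix \<phi> assume \<phi>: "test_fun \<phi>"
  have f[measurable]: "f \<in> borel_measurable leg" and g: "g \<in> sqi lborel"
    using assms sqi_measurable[of f leg] by (simp_all add: H1rep_def)
  have "continuous_on UNIV (deriv \<phi>)"
    using test_fun_facts[OF \<phi>] by metis
  then have [measurable]: "deriv \<phi> \<in> borel_measurable leg" "prim g \<in> borel_measurable leg"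
    by (simp_all only: measurable_leg borel_measurable_continuous_onI prim_measurable[OF g])
  have "(\<integral>x. f x * deriv \<phi> x \<partial>leg) = (\<integral>x. (c + prim g x) * deriv \<phi> x \<partial>leg)"
    using assms by (intro integral_cong_AE) (auto simp: H1rep_def)
  then show "(\<integral>x. f x * deriv \<phi> x \<partial>leg) = - (\<integral>x. g x * \<phi> x \<partial>leg)"
    using weak_by_parts[OF _ \<phi>, of g c] assms by (simp add: H1rep_def)
qed

lemma H1rep_unique:
  assumes "H1rep f c g" "H1rep f c' g'"
  shows "c = c'" and "AE x in leg. g x = g' x"
proof -
  have g: "g \<in> sqi lborel" "g' \<in> sqi lborel"
    using assms by (auto simp: H1rep_def)
  note d = sqi_diff[OF g]
  have [measurable]: "g \<in> borel_measurable borel" "g' \<in> borel_measurable borel"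
    using g by (auto dest: sqi_measurable)
  have pd: "prim (\<lambda>x. g x - g' x) x = prim g x - prim g' x" for x
    using prim_add[OF g, of 1 "-1"] by simp
  have "AE x in leg. f x = c + prim g x" "AE x in leg. f x = c' + prim g' x"
    using assms by (auto simp: H1rep_def)
  then have "AE x in leg. (c - c') + prim (\<lambda>x. g x - g' x) x = 0"
    by eventually_elim (simp add: pd)
  then have *: "(c - c') + prim (\<lambda>x. g x - g' x) x = 0" if "x \<ge> 0" for x
    using that by (intro continuous_AE_zero_half_line[of "\<lambda>x. (c - c') + prim (\<lambda>x. g x - g' x) x"]
        continuous_intros continuous_on_prim d)
  from *[of 0] show "c = c'"
    by simp
  have "AE x in lborel. x > 0 \<longrightarrow> g x - g' x = 0"
  proof (rule AE_zero_half_line)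
    fix a b :: real
    assume "0 < a"
    show "integrable lborel (\<lambda>x. indicator {a..b} x * (g x - g' x))"
      by (rule indicator_Icc_mult_integrable[OF d])
    show "(\<integral>x. indicator {a..b} x * (g x - g' x) \<partial>lborel) = 0" if "a < b"
      using prim_diff_le[OF d, of a b] *[of a] *[of b] \<open>0 < a\<close> that by simp
  qed measurable
  moreover have "AE x in lborel. x \<noteq> (0::real)"
    by (rule AE_lborel_singleton)
  ultimately show "AE x in leg. g x = g' x"
    unfolding AE_leg by eventually_elim auto
qed

lemma has_weak_deriv_H1rep:
  assumes "f \<in> L2_leg" "g \<in> L2_leg" "has_weak_deriv f g"
  obtains c g0 where "H1rep f c g0" "AE x in leg. g x = g0 x"
proof -
  obtain g0 where g0: "g0 \<in> sqi lborel" "AE x in leg. g x = g0 x"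
    using sqi_leg_borel_rep assms(2) by (auto simp: L2_leg_sqi)
  then obtain c where "AE x in leg. f x = c + prim g0 x"
    using weak_deriv_imp_prim[of f g g0] assms by (auto simp: L2_leg_sqi)
  then show ?thesis
    using that[of c g0] g0 assms(1) by (simp add: H1rep_def L2_leg_sqi)
qed

lemma H1_leg_iff: "f \<in> H1_leg \<longleftrightarrow> (\<exists>c g. H1rep f c g)"
proof
  assume "f \<in> H1_leg"
  then obtain g where "f \<in> L2_leg" "g \<in> L2_leg" "has_weak_deriv f g"
    by (auto simp: H1_leg_def)
  then show "\<exists>c g. H1rep f c g"
    by (rule has_weak_deriv_H1rep) blast
next
  assume "\<exists>c g. H1rep f c g"
  then obtain c g where *: "H1rep f c g"
    by blast
  then show "f \<in> H1_leg"
    using H1rep_has_weak_deriv[OF *] sqi_lborel_leg[of g]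
    by (auto simp: H1_leg_def H1rep_def L2_leg_sqi)
qed

lemma H1rep_weak_deriv:
  assumes "H1rep f c g"
  shows "AE x in leg. weak_deriv f x = g x" and "weak_deriv f \<in> sqi leg"
proof -
  have "g \<in> L2_leg \<and> has_weak_deriv f g"
    using H1rep_has_weak_deriv[OF assms] sqi_lborel_leg[of g] assms
    by (auto simp: H1rep_def L2_leg_sqi)
  then have *: "weak_deriv f \<in> L2_leg \<and> has_weak_deriv f (weak_deriv f)"
    unfolding weak_deriv_def by (rule someI[of "\<lambda>g. g \<in> L2_leg \<and> has_weak_deriv f g"])
  then show "weak_deriv f \<in> sqi leg"
    by (simp add: L2_leg_sqi)
  have "f \<in> L2_leg"
    using assms by (simp add: H1rep_def L2_leg_sqi)
  then obtain c' g' where "H1rep f c' g'" "AE x in leg. weak_deriv f x = g' x"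
    using has_weak_deriv_H1rep * by blast
  with H1rep_unique(2)[OF assms \<open>H1rep f c' g'\<close>] show "AE x in leg. weak_deriv f x = g x"
    by (auto elim: eventually_elim2)
qed

lemma H1rep_value_at_0:
  assumes "H1rep f c g"
  shows "value_at_0 f = c"
  unfolding value_at_0_def
proof (rule the_equality)
  have g: "g \<in> sqi lborel" and f: "AE x in leg. f x = c + prim g x"
    using assms by (auto simp: H1rep_def)
  show "\<exists>h. continuous_on {0..} h \<and> (AE x in leg. h x = f x) \<and> h 0 = c"
    using f by (intro exI[of _ "\<lambda>x. c + prim g x"] conjI continuous_intros continuous_on_prim g)
      (auto elim: eventually_mono)
  fix c' assume "\<exists>h. continuous_on {0..} h \<and> (AE x in leg. h x = f x) \<and> h 0 = c'"
  then obtain h where h: "continuous_on {0..} h" "AE x in leg. h x = f x" "h 0 = c'"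
    by blast
  have "AE x in leg. h x - (c + prim g x) = 0"
    using f h(2) by eventually_elim simp
  then have "h 0 - (c + prim g 0) = 0"
    by (intro continuous_AE_zero_half_line[of "\<lambda>x. h x - (c + prim g x)"]
        continuous_intros continuous_on_prim g h(1)) auto
  then show "c' = c"
    using h(3) by simp
qed

lemma H1rep_cong:
  assumes "H1rep f c g" "f' \<in> sqi leg" "AE x in leg. f x = f' x"
  shows "H1rep f' c g"
  using assms by (auto simp: H1rep_def elim: eventually_elim2)

lemma H1rep_add:
  assumes "H1rep f c g" "H1rep f' c' g'"
  shows "H1rep (\<lambda>x. a * f x + b * f' x) (a * c + b * c') (\<lambda>x. a * g x + b * g' x)"
proof -
  have "AE x in leg. f x = c + prim g x" "AE x in leg. f' x = c' + prim g' x"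
    using assms by (auto simp: H1rep_def)
  then have "AE x in leg. a * f x + b * f' x = a * c + b * c' + prim (\<lambda>x. a * g x + b * g' x) x"
    by eventually_elim (use assms in \<open>simp add: H1rep_def prim_add algebra_simps\<close>)
  then show ?thesis
    using assms by (auto simp: H1rep_def intro!: sqi_add sqi_cmult)
qed

lemma H1rep_sqi:
  assumes "H1rep f c g"
  shows "(\<lambda>x. indicator {0..} x * (c + prim g x)) \<in> sqi lborel"
proof -
  have g: "g \<in> sqi lborel"
    using assms by (simp add: H1rep_def)
  then have m: "(\<lambda>x. c + prim g x) \<in> borel_measurable borel"
    by measurable
  have "(\<lambda>x. c + prim g x) \<in> sqi leg"
    by (rule sqi_cong_AE[of f]) (use assms measurable_leg[OF m] in \<open>auto simp: H1rep_def\<close>)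
  then show ?thesis
    using sqi_leg_iff[OF m] by simp
qed

section \<open>Convolution and primitives\<close>

lemma prim_reflect: "prim h (- x) = - prim (\<lambda>s. h (- s)) x"
proof -
  have "prim (\<lambda>s. h (- s)) x = (LBINT y=ereal (- x)..ereal 0. h y)"
    unfolding prim_def using interval_integral_reflect[of "ereal 0" "ereal x" "\<lambda>s. h (- s)"] by simp
  then show ?thesis
    unfolding prim_def by (subst interval_integral_endpoints_reverse) simp
qed

lemma conv_prim_Fubini:
  assumes b: "b \<in> sqi lborel" and g: "g \<in> sqi lborel" and x: "x \<ge> 0"
  shows "(\<integral>y. (\<integral>z. indicator {0..x} z * b (z - y) \<partial>lborel) * g y \<partial>lborel) = prim (conv b g) x"
proof -
  have [measurable]: "b \<in> borel_measurable borel" "g \<in> borel_measurable borel"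
    using b g by (auto dest: sqi_measurable)
  let ?F = "\<lambda>z y. indicator {0..x} z * (b (z - y) * g y)"
  let ?C = "sqrt ((\<integral>y. (b y)\<^sup>2 \<partial>lborel) * (\<integral>y. (g y)\<^sup>2 \<partial>lborel))"
  have conv_le: "\<bar>conv (\<lambda>x. \<bar>b x\<bar>) (\<lambda>x. \<bar>g x\<bar>) z\<bar> \<le> ?C" for z
    using real_sqrt_le_mono[OF conv_bound[OF sqi_abs[OF b] sqi_abs[OF g], of z]] by simp
  have int: "integrable (lborel \<Otimes>\<^sub>M lborel) (\<lambda>(z, y). ?F z y)"
  proof (rule lborel_pair.Fubini_integrable)
    show "(\<lambda>(z, y). ?F z y) \<in> borel_measurable (lborel \<Otimes>\<^sub>M lborel)"
      by measurable
    have "integrable lborel (\<lambda>z. indicator {0..x} z * conv (\<lambda>x. \<bar>b x\<bar>) (\<lambda>x. \<bar>g x\<bar>) z)"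
    proof (rule Bochner_Integration.integrable_bound)
      show "integrable lborel (\<lambda>z. ?C * indicator {0..x} z)"
        by (intro Bochner_Integration.integrable_mult_right integrable_real_indicator)
          (auto simp: emeasure_lborel_Icc_eq)
      show "AE z in lborel. norm (indicator {0..x} z * conv (\<lambda>x. \<bar>b x\<bar>) (\<lambda>x. \<bar>g x\<bar>) z) \<le> norm (?C * indicator {0..x} z)"
        using conv_le by (auto split: split_indicator intro: order.trans[OF _ abs_ge_self])
    qed measurable
    moreover have "(\<integral>y. norm (?F z y) \<partial>lborel) = indicator {0..x} z * conv (\<lambda>x. \<bar>b x\<bar>) (\<lambda>x. \<bar>g x\<bar>) z" for z
      by (simp add: conv_def abs_mult)
    ultimately show "integrable lborel (\<lambda>z. \<integral>y. norm (case (z, y) of (z, y) \<Rightarrow> ?F z y) \<partial>lborel)"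
      by simp
    show "AE z in lborel. integrable lborel (\<lambda>y. case (z, y) of (z, y) \<Rightarrow> ?F z y)"
      using conv_integrable[OF b g] by simp
  qed
  have "(\<integral>y. (\<integral>z. ?F z y \<partial>lborel) \<partial>lborel) = (\<integral>z. (\<integral>y. ?F z y \<partial>lborel) \<partial>lborel)"
    by (rule lborel_pair.Fubini_integral[OF int])
  also have "\<dots> = prim (conv b g) x"
    using x by (simp add: prim_nonneg_eq conv_def)
  finally show ?thesis
    by (simp flip: mult.assoc)
qed

lemma prim_shift_diff:
  assumes b: "b \<in> sqi lborel" and x: "x \<ge> 0"
  shows "prim b (x - y) - prim b (- y) = (\<integral>z. indicator {0..x} z * b (z - y) \<partial>lborel)"
proof -
  have "prim b (x - y) - prim b (- y) = (\<integral>z. indicator {- y..x - y} z * b z \<partial>lborel)"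
    using x by (intro prim_diff_le b) simp
  also have "\<dots> = (\<integral>z. indicator {- y..x - y} (z - y) * b (z - y) \<partial>lborel)"
    using lborel_integral_shift_minus[of "\<lambda>z. indicator {- y..x - y} z * b z" y] by simp
  also have "\<dots> = (\<integral>z. indicator {0..x} z * b (z - y) \<partial>lborel)"
    by (intro Bochner_Integration.integral_cong) (auto split: split_indicator)
  finally show ?thesis .
qed

text \<open>Convolution commutes with differentiation.\<close>

lemma conv_prim:
  assumes b: "b \<in> sqi lborel" and a: "(\<lambda>u. c + prim b u) \<in> sqi lborel" and g: "g \<in> sqi lborel"
    and x: "x \<ge> 0"
  shows "conv (\<lambda>u. c + prim b u) g x = conv (\<lambda>u. c + prim b u) g 0 + prim (conv b g) x"
proof -
  have "conv (\<lambda>u. c + prim b u) g x - conv (\<lambda>u. c + prim b u) g 0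
      = (\<integral>y. (c + prim b (x - y)) * g y - (c + prim b (0 - y)) * g y \<partial>lborel)"
    unfolding conv_def using conv_integrable[OF a g] by (intro Bochner_Integration.integral_diff[symmetric])
  also have "\<dots> = (\<integral>y. (\<integral>z. indicator {0..x} z * b (z - y) \<partial>lborel) * g y \<partial>lborel)"
    unfolding prim_shift_diff[OF b x, symmetric] by (simp add: algebra_simps)
  also have "\<dots> = prim (conv b g) x"
    by (rule conv_prim_Fubini[OF b g x])
  finally show ?thesis
    by simp
qed

text \<open>The derivative of the resolvent kernel $r$; its own derivative is $r$ minus a point mass
  at 0.\<close>

definition res_kernel' :: "real \<Rightarrow> real" where
  "res_kernel' u = - sgn u * res_kernel u"

lemma bdd_L1_res_kernel': "bdd_L1 res_kernel'"
  unfolding bdd_L1_def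
proof (intro conjI exI allI)
  have m[measurable]: "res_kernel' \<in> borel_measurable borel"
    unfolding res_kernel'_def[abs_def] by measurable
  show "integrable lborel res_kernel'"
    by (rule Bochner_Integration.integrable_bound[OF bdd_L1_integrable[OF bdd_L1_res_kernel]])
      (auto simp: res_kernel'_def abs_mult sgn_if)
  show "\<bar>res_kernel' u\<bar> \<le> 1 / 2" for u
    by (auto simp: res_kernel'_def res_kernel_def abs_mult sgn_if)
qed

lemma prim_exp: "prim (\<lambda>s. exp (- s) / 2) u = (1 - exp (- u)) / 2"
proof -
  have "prim (\<lambda>s. exp (- s) / 2) u = - exp (- u) / 2 - - exp (- 0) / 2"
    by (rule prim_C1) (auto intro!: continuous_intros derivative_eq_intros)
  then show ?thesis
    by simp
qed

lemma prim_res_kernel: "prim res_kernel u = sgn u / 2 + res_kernel' u"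
proof -
  have pos: "prim res_kernel u = (1 - exp (- u)) / 2" if "u \<ge> 0" for u
  proof -
    have "prim res_kernel u = prim (\<lambda>s. exp (- s) / 2) u"
      unfolding prim_nonneg_eq[OF that]
      by (intro Bochner_Integration.integral_cong) (auto simp: res_kernel_def split: split_indicator)
    then show ?thesis
      by (simp add: prim_exp)
  qed
  show ?thesis
  proof (cases "u \<ge> 0")
    case True
    then show ?thesis
      using pos[OF True] by (auto simp: res_kernel'_def res_kernel_def sgn_if field_simps)
  next
    case False
    have "prim res_kernel u = - prim res_kernel (- u)"
      using prim_reflect[of res_kernel "- u"] by (simp add: res_kernel_even)
    then show ?thesis
      using False pos[of "- u"] by (auto simp: res_kernel'_def res_kernel_def sgn_if field_simps)
  qed
qed

lemma prim_res_kernel': "res_kernel u = 1 / 2 + prim res_kernel' u"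
proof -
  have pos: "prim res_kernel' u = (exp (- u) - 1) / 2" if "u \<ge> 0" for u
  proof -
    have AE: "AE s in lborel. s \<noteq> (0::real)"
      by (rule AE_lborel_singleton)
    have [measurable]: "res_kernel' \<in> borel_measurable borel"
      using bdd_L1_res_kernel' by measurable
    have "prim res_kernel' u = (\<integral>s. - (indicator {0..u} s * (exp (- s) / 2)) \<partial>lborel)"
      unfolding prim_nonneg_eq[OF that]
      by (intro integral_cong_AE; measurable?)
        (use AE in eventually_elim, auto simp: res_kernel'_def res_kernel_def sgn_if split: split_indicator)
    also have "\<dots> = - prim (\<lambda>s. exp (- s) / 2) u"
      using prim_nonneg_eq[OF that, of "\<lambda>s. exp (- s) / 2"] by simp
    finally show ?thesis
      by (simp add: prim_exp field_simps)
  qed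
  show ?thesis
  proof (cases "u \<ge> 0")
    case True
    then show ?thesis
      using pos[OF True] by (auto simp: res_kernel_def field_simps)
  next
    case False
    have "prim (\<lambda>s. res_kernel' (- s)) (- u) = - prim res_kernel' (- u)"
      by (simp add: res_kernel'_def res_kernel_even sgn_minus prim_def interval_lebesgue_integral_uminus
        flip: interval_lebesgue_integral_uminus)
    then show ?thesis
      using False pos[of "- u"] prim_reflect[of res_kernel' "- u"]
      by (auto simp: res_kernel_def field_simps)
  qed
qed

lemma res_conv_H1:
  assumes g: "g \<in> sqi lborel" and x: "x \<ge> 0"
  shows "conv res_kernel g x = conv res_kernel g 0 + prim (conv res_kernel' g) x"
proof -
  have eq: "res_kernel = (\<lambda>u. 1 / 2 + prim res_kernel' u)"
    by (rule ext, rule prim_res_kernel')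
  show ?thesis
    using conv_prim[of res_kernel' "1 / 2" g x] x g bdd_L1_sqi[OF bdd_L1_res_kernel']
      bdd_L1_sqi[OF bdd_L1_res_kernel] by (simp flip: eq)
qed

lemma res_conv'_H1:
  assumes g: "g \<in> sqi lborel" and x: "x \<ge> 0"
  shows "conv res_kernel' g x = conv res_kernel' g 0 + prim (\<lambda>z. conv res_kernel g z - g z) x"
proof -
  note r = bdd_L1_sqi[OF bdd_L1_res_kernel] and r' = bdd_L1_sqi[OF bdd_L1_res_kernel']
  have [measurable]: "g \<in> borel_measurable borel"
    using g by (auto dest: sqi_measurable)
  have int: "integrable lborel (\<lambda>y. (\<integral>z. indicator {0..x} z * res_kernel (z - y) \<partial>lborel) * g y)"
  proof -
    have "(\<integral>z. indicator {0..x} z * res_kernel (z - y) \<partial>lborel)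
       = (sgn (x - y) + sgn y) / 2 + (res_kernel' (x - y) - res_kernel' (0 - y))" for y
      unfolding prim_shift_diff[OF r x, symmetric] prim_res_kernel
      by (simp add: sgn_minus add_divide_distrib)
    moreover have "(sgn (x - y) + sgn y) / 2 = indicator {0..x} y - (indicator {0..0} y + indicator {x..x} y) / 2" for y
      using x by (auto simp: sgn_if split: split_indicator)
    moreover have "(\<lambda>y. (indicator {0..x} y + (-1/2) * (indicator {0..0} y + indicator {x..x} y))
        + (res_kernel' (x - y) - res_kernel' (0 - y))) \<in> sqi lborel"
      by (intro sqi_add sqi_cmult sqi_diff indicator_Icc_sqi sqi_reflect_shift r')
    ultimately show ?thesis
      by (intro sqi_integrable_mult g) simp
  qed
  have "conv res_kernel' g x - conv res_kernel' g 0
      = (\<integral>y. res_kernel' (x - y) * g y - res_kernel' (0 - y) * g y \<partial>lborel)"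
    unfolding conv_def using conv_integrable[OF r' g] by (intro Bochner_Integration.integral_diff[symmetric])
  also have "\<dots> = (\<integral>y. (\<integral>z. indicator {0..x} z * res_kernel (z - y) \<partial>lborel) * g y - indicator {0..x} y * g y \<partial>lborel)"
  proof (rule integral_cong_AE)
    have [measurable]: "res_kernel' \<in> borel_measurable borel"
      using bdd_L1_res_kernel' by measurable
    show "(\<lambda>y. res_kernel' (x - y) * g y - res_kernel' (0 - y) * g y) \<in> borel_measurable lborel"
      by measurable
    show "(\<lambda>y. (\<integral>z. indicator {0..x} z * res_kernel (z - y) \<partial>lborel) * g y - indicator {0..x} y * g y) \<in> borel_measurable lborel"
      by measurable
    have "AE y in lborel. y \<noteq> 0 \<and> y \<noteq> x"
      by (intro AE_conjI AE_lborel_singleton)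
    then show "AE y in lborel. res_kernel' (x - y) * g y - res_kernel' (0 - y) * g y
        = (\<integral>z. indicator {0..x} z * res_kernel (z - y) \<partial>lborel) * g y - indicator {0..x} y * g y"
    proof eventually_elim
      case (elim y)
      have "res_kernel' (x - y) - res_kernel' (0 - y)
          = (prim res_kernel (x - y) - prim res_kernel (- y)) - indicator {0..x} y"
        unfolding prim_res_kernel using elim x by (auto simp: sgn_if split: split_indicator)
      then show ?case
        unfolding prim_shift_diff[OF r x, symmetric] by (simp flip: left_diff_distrib)
    qed
  qed
  also have "\<dots> = prim (conv res_kernel g) x - prim g x"
    using conv_prim_Fubini[OF r g x] int indicator_Icc_mult_integrable[OF g] x
    by (simp add: prim_nonneg_eq)
  also have "\<dots> = prim (\<lambda>z. conv res_kernel g z - g z) x"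
    using prim_add[OF conv_L2(1)[OF bdd_L1_res_kernel g] g, of 1 "-1" x] by simp
  finally show ?thesis
    by simp
qed

section \<open>The Hilbert space of the spider\<close>

lemma L2_iff: "f \<in> L2 N \<longleftrightarrow> (\<forall>j<N. f j \<in> sqi leg)"
  by (simp add: L2_def L2_leg_sqi)

lemma L2_lin: "f \<in> L2 N \<Longrightarrow> g \<in> L2 N \<Longrightarrow> (\<lambda>j x. a * f j x + b * g j x) \<in> L2 N"
  by (auto simp: L2_iff intro!: sqi_add sqi_cmult)

lemma L2_add: "f \<in> L2 N \<Longrightarrow> g \<in> L2 N \<Longrightarrow> (\<lambda>j x. f j x + g j x) \<in> L2 N"
  using L2_lin[of f N g 1 1] by simp

lemma L2_diff: "f \<in> L2 N \<Longrightarrow> g \<in> L2 N \<Longrightarrow> (\<lambda>j x. f j x - g j x) \<in> L2 N"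
  using L2_lin[of f N g 1 "-1"] by simp

lemma L2_cmult: "f \<in> L2 N \<Longrightarrow> (\<lambda>j x. a * f j x) \<in> L2 N"
  using L2_lin[of f N f a 0] by simp

lemma L2_inner_commute: "L2_inner N f g = L2_inner N g f"
  by (simp add: L2_inner_def mult.commute)

lemma L2_inner_lin_left:
  assumes "f \<in> L2 N" "g \<in> L2 N" "h \<in> L2 N"
  shows "L2_inner N (\<lambda>j x. a * f j x + b * g j x) h = a * L2_inner N f h + b * L2_inner N g h"
proof -
  have "(\<integral>x. (a * f j x + b * g j x) * h j x \<partial>leg)
      = a * (\<integral>x. f j x * h j x \<partial>leg) + b * (\<integral>x. g j x * h j x \<partial>leg)" if "j < N" for j
  proof -
    have *: "integrable leg (\<lambda>x. f j x * h j x)" "integrable leg (\<lambda>x. g j x * h j x)"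
      using assms that by (auto simp: L2_iff intro!: sqi_integrable_mult)
    have "(\<integral>x. (a * f j x + b * g j x) * h j x \<partial>leg)
        = (\<integral>x. a * (f j x * h j x) + b * (g j x * h j x) \<partial>leg)"
      by (intro Bochner_Integration.integral_cong) (auto simp: algebra_simps)
    then show ?thesis
      using * by simp
  qed
  then show ?thesis
    by (simp add: L2_inner_def sum.distrib sum_distrib_left)
qed

lemma L2_inner_lin_right:
  assumes "f \<in> L2 N" "g \<in> L2 N" "h \<in> L2 N"
  shows "L2_inner N h (\<lambda>j x. a * f j x + b * g j x) = a * L2_inner N h f + b * L2_inner N h g"
  using L2_inner_lin_left[OF assms, of a b] by (simp add: L2_inner_commute[of N h])

lemma L2_inner_nonneg: "L2_inner N f f \<ge> 0"
  unfolding L2_inner_def by (intro sum_nonneg integral_nonneg_AE) auto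

lemma L2_norm_nonneg: "L2_norm N f \<ge> 0"
  by (simp add: L2_norm_def L2_inner_nonneg)

lemma L2_norm_square: "(L2_norm N f)\<^sup>2 = L2_inner N f f"
  by (simp add: L2_norm_def L2_inner_nonneg)

lemma L2_inner_square_lin:
  assumes "f \<in> L2 N" "g \<in> L2 N"
  shows "L2_inner N (\<lambda>j x. a * f j x + b * g j x) (\<lambda>j x. a * f j x + b * g j x)
    = a\<^sup>2 * L2_inner N f f + 2 * a * b * L2_inner N f g + b\<^sup>2 * L2_inner N g g"
  by (simp add: L2_inner_lin_left L2_inner_lin_right L2_lin assms L2_inner_commute[of N g f]
      power2_eq_square algebra_simps)

lemma L2_Cauchy_Schwarz:
  assumes "f \<in> L2 N" "g \<in> L2 N"
  shows "\<bar>L2_inner N f g\<bar> \<le> L2_norm N f * L2_norm N g"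
proof -
  have "(L2_inner N f g)\<^sup>2 \<le> L2_inner N f f * L2_inner N g g"
  proof (rule quadratic_discriminant_bound)
    fix s t :: real
    show "0 \<le> L2_inner N f f * s\<^sup>2 - 2 * L2_inner N f g * s * t + L2_inner N g g * t\<^sup>2"
      using L2_inner_nonneg[of N "\<lambda>j x. s * f j x + (- t) * g j x"]
      unfolding L2_inner_square_lin[OF assms] by (simp add: algebra_simps)
  qed
  from real_sqrt_le_mono[OF this] show ?thesis
    by (simp add: L2_norm_def real_sqrt_mult)
qed

lemma L2_norm_cmult:
  assumes "f \<in> L2 N"
  shows "L2_norm N (\<lambda>j x. a * f j x) = \<bar>a\<bar> * L2_norm N f"
  using L2_inner_square_lin[OF assms assms, of a 0] by (simp add: L2_norm_def real_sqrt_mult)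

lemma L2_norm_triangle:
  assumes "f \<in> L2 N" "g \<in> L2 N"
  shows "L2_norm N (\<lambda>j x. f j x + g j x) \<le> L2_norm N f + L2_norm N g"
proof (rule power2_le_imp_le)
  have "(L2_norm N (\<lambda>j x. f j x + g j x))\<^sup>2 = (L2_norm N f)\<^sup>2 + 2 * L2_inner N f g + (L2_norm N g)\<^sup>2"
    using L2_inner_square_lin[OF assms, of 1 1] by (simp add: L2_norm_square)
  also have "\<dots> \<le> (L2_norm N f + L2_norm N g)\<^sup>2"
    using L2_Cauchy_Schwarz[OF assms] by (simp add: power2_sum)
  finally show "(L2_norm N (\<lambda>j x. f j x + g j x))\<^sup>2 \<le> (L2_norm N f + L2_norm N g)\<^sup>2" .
qed (simp add: L2_norm_nonneg)

lemma L2_norm_triangle_diff: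
  assumes "f \<in> L2 N" "g \<in> L2 N"
  shows "L2_norm N (\<lambda>j x. f j x - g j x) \<le> L2_norm N f + L2_norm N g"
  using L2_norm_triangle[OF assms(1) L2_cmult[OF assms(2), of "-1"]] L2_norm_cmult[OF assms(2), of "-1"]
  by simp

lemma AE_eq_refl: "AE_eq N f f"
  by (simp add: AE_eq_def)

lemma AE_eq_sym: "AE_eq N f g \<Longrightarrow> AE_eq N g f"
  by (auto simp: AE_eq_def elim: eventually_mono)

lemma AE_eq_trans: "AE_eq N f g \<Longrightarrow> AE_eq N g h \<Longrightarrow> AE_eq N f h"
  unfolding AE_eq_def by (intro allI impI, elim allE impE, assumption+, rule eventually_elim2) auto

lemma AE_eq_lin:
  "AE_eq N f f' \<Longrightarrow> AE_eq N g g' \<Longrightarrow> AE_eq N (\<lambda>j x. a * f j x + b * g j x) (\<lambda>j x. a * f' j x + b * g' j x)"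
  unfolding AE_eq_def by (intro allI impI, elim allE impE, assumption+, rule eventually_elim2) auto

lemma AE_eq_diff:
  "AE_eq N f f' \<Longrightarrow> AE_eq N g g' \<Longrightarrow> AE_eq N (\<lambda>j x. f j x - g j x) (\<lambda>j x. f' j x - g' j x)"
  unfolding AE_eq_def by (intro allI impI, elim allE impE, assumption+, rule eventually_elim2) auto

lemma L2_inner_cong:
  assumes "AE_eq N f f'" "AE_eq N g g'" "f \<in> L2 N" "f' \<in> L2 N" "g \<in> L2 N" "g' \<in> L2 N"
  shows "L2_inner N f g = L2_inner N f' g'"
  unfolding L2_inner_def
proof (rule sum.cong[OF refl])
  fix j assume "j \<in> {..<N}"
  then have j: "j < N"
    by simp
  then have [measurable]: "f j \<in> borel_measurable leg" "f' j \<in> borel_measurable leg"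
      "g j \<in> borel_measurable leg" "g' j \<in> borel_measurable leg"
    using assms by (auto simp: L2_iff sqi_measurable)
  have "AE x in leg. f j x = f' j x" "AE x in leg. g j x = g' j x"
    using assms(1,2) j by (auto simp: AE_eq_def)
  then show "(\<integral>x. f j x * g j x \<partial>leg) = (\<integral>x. f' j x * g' j x \<partial>leg)"
    by (intro integral_cong_AE) (auto elim: eventually_elim2)
qed

lemma L2_norm_cong:
  "AE_eq N f g \<Longrightarrow> f \<in> L2 N \<Longrightarrow> g \<in> L2 N \<Longrightarrow> L2_norm N f = L2_norm N g"
  unfolding L2_norm_def by (simp add: L2_inner_cong)

lemma L2_norm_zero_imp:
  assumes f: "f \<in> L2 N" and 0: "L2_norm N f = 0"
  shows "AE_eq N f (\<lambda>j x. 0)"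
  unfolding AE_eq_def
proof (intro allI impI)
  fix j assume j: "j < N"
  have "(\<Sum>j<N. \<integral>x. f j x * f j x \<partial>leg) = 0"
    using 0 L2_norm_square[of N f] by (simp add: L2_inner_def)
  then have "(\<integral>x. f j x * f j x \<partial>leg) = 0"
    using j by (subst (asm) sum_nonneg_eq_0_iff) auto
  moreover have "integrable leg (\<lambda>x. f j x * f j x)"
    using f j by (auto simp: L2_iff intro: sqi_integrable_mult)
  ultimately have "AE x in leg. f j x * f j x = 0"
    by (subst (asm) integral_nonneg_eq_0_iff_AE) auto
  then show "AE x in leg. f j x = 0"
    by simp
qed

lemma L2_norm_AE_zero: "AE_eq N f (\<lambda>j x. 0) \<Longrightarrow> f \<in> L2 N \<Longrightarrow> L2_norm N f = 0"
  using L2_norm_cong[of N f "\<lambda>j x. 0"] by (simp add: L2_iff sqi_zero L2_norm_def L2_inner_def)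

section \<open>Unfolding the spider on the line\<close>

text \<open>Tuples of square-integrable Borel functions on the whole line, for every index: the bound
  $N$ is left out so that no side conditions on indices arise.\<close>

definition line_L2 :: "spider_fun \<Rightarrow> bool" where
  "line_L2 f \<longleftrightarrow> (\<forall>i. f i \<in> sqi lborel)"

lemma line_L2_sqi: "line_L2 f \<Longrightarrow> f i \<in> sqi lborel"
  by (simp add: line_L2_def)

lemma line_L2_measurable: "line_L2 f \<Longrightarrow> f i \<in> borel_measurable borel"
  using sqi_measurable[OF line_L2_sqi, of f i] by simp

text \<open>Leg $j$ extended to the line: beyond the vertex stands the Kirchhoff reflection
  $2 \bar f - f_j$, where $\bar f$ is the mean over the legs.  Convolution with an even kernel
  preserves this symmetry, so the spider semigroup becomes a convolution on the line.  Only the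
  values of the $f_i$ on $[0,\infty)$ enter.\<close>

definition unfold :: "nat \<Rightarrow> spider_fun \<Rightarrow> spider_fun" where
  "unfold N f j y = (if y > 0 then f j y else 2 / real N * (\<Sum>i<N. f i (- y)) - f j (- y))"

lemma line_L2_unfold:
  assumes "line_L2 f"
  shows "line_L2 (unfold N f)"
  unfolding line_L2_def
proof
  fix j
  note f = line_L2_sqi[OF assms]
  let ?h = "\<lambda>y. 2 / real N * (\<Sum>i<N. f i (- y)) - f j (- y)"
  have h: "?h \<in> sqi lborel"
    by (intro sqi_diff sqi_cmult sqi_sum sqi_reflect f)
  have [measurable]: "f j \<in> borel_measurable borel" "?h \<in> borel_measurable borel"
    using line_L2_measurable[OF assms] sqi_measurable[OF h] by auto
  have "(\<lambda>y. indicator {0<..} y * f j y + indicator {..0} y * ?h y) \<in> sqi lborel"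
    by (rule sqi_add[OF sqi_bound[OF f[of j]] sqi_bound[OF h]]; measurable?)
      (auto split: split_indicator)
  also have "(\<lambda>y. indicator {0<..} y * f j y + indicator {..0} y * ?h y) = unfold N f j"
    by (auto simp: unfold_def split: split_indicator)
  finally show "unfold N f j \<in> sqi lborel" .
qed

lemmas unfold_sqi = line_L2_sqi[OF line_L2_unfold]
lemmas unfold_measurable = line_L2_measurable[OF line_L2_unfold]

lemma unfold_reflect:
  assumes "N > 0" "y \<noteq> 0"
  shows "unfold N f j (- y) = 2 / real N * (\<Sum>i<N. unfold N f i y) - unfold N f j y"
  using assms by (cases "y > 0")
    (auto simp: unfold_def sum_subtractf algebra_simps simp flip: sum_distrib_left)

lemma unfold_lin:
  "unfold N (\<lambda>i y. a * f i y + b * g i y) j y = a * unfold N f j y + b * unfold N g j y"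
  by (simp add: unfold_def sum.distrib sum_distrib_left algebra_simps)

lemma conv_sum:
  assumes "k \<in> sqi lborel" "\<And>i. i \<in> I \<Longrightarrow> g i \<in> sqi lborel"
  shows "conv k (\<lambda>y. \<Sum>i\<in>I. g i y) x = (\<Sum>i\<in>I. conv k (g i) x)"
proof -
  have "conv k (\<lambda>y. \<Sum>i\<in>I. g i y) x = (\<integral>y. (\<Sum>i\<in>I. k (x - y) * g i y) \<partial>lborel)"
    by (simp add: conv_def sum_distrib_left)
  also have "\<dots> = (\<Sum>i\<in>I. conv k (g i) x)"
    unfolding conv_def using assms by (intro Bochner_Integration.integral_sum conv_integrable)
  finally show ?thesis .
qed

lemma conv_unfold_reflect:
  assumes N: "N > 0" and k: "k \<in> sqi lborel" and f: "line_L2 f"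
  shows "conv (\<lambda>u. k (- u)) (unfold N f j) (- x)
    = 2 / real N * (\<Sum>i<N. conv k (unfold N f i) x) - conv k (unfold N f j) x"
proof -
  note e = unfold_sqi[OF f]
  have [measurable]: "k \<in> borel_measurable borel" "unfold N f i \<in> borel_measurable borel" for i
    using sqi_measurable[OF k] unfold_measurable[OF f] by auto
  have "conv (\<lambda>u. k (- u)) (unfold N f j) (- x) = (\<integral>y. k (x - y) * unfold N f j (- y) \<partial>lborel)"
    using lborel_integral_reflect[of "\<lambda>y. k (x + y) * unfold N f j y"]
    by (simp add: conv_def add.commute)
  also have "\<dots> = conv k (\<lambda>y. 2 / real N * (\<Sum>i<N. unfold N f i y) + (-1) * unfold N f j y) x"
    unfolding conv_def
  proof (rule integral_cong_AE)
    have "AE y in lborel. y \<noteq> (0::real)"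
      by (rule AE_lborel_singleton)
    then show "AE y in lborel. k (x - y) * unfold N f j (- y)
        = k (x - y) * (2 / real N * (\<Sum>i<N. unfold N f i y) + (-1) * unfold N f j y)"
      by eventually_elim (simp add: unfold_reflect[OF N])
  qed measurable
  also have "\<dots> = 2 / real N * (\<Sum>i<N. conv k (unfold N f i) x) - conv k (unfold N f j) x"
    by (subst conv_add_right) (auto intro!: k e sqi_sum simp: conv_sum[OF k e])
  finally show ?thesis .
qed

lemma unfold_conv:
  assumes N: "N > 0" and k: "bdd_L1 k" "\<And>u. k (- u) = k u" and f: "line_L2 f"
  shows "unfold N (\<lambda>i. conv k (unfold N f i)) j y = conv k (unfold N f j) y"
  using conv_unfold_reflect[OF N bdd_L1_sqi[OF k(1)] f, of j "- y"] k(2)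
  by (simp add: unfold_def)

lemma integral_fold:
  fixes h :: "real \<Rightarrow> real"
  assumes h: "integrable lborel h"
  shows "(\<integral>y. h y \<partial>lborel) = (\<integral>y. indicator {0..} y * (h y + h (- y)) \<partial>lborel)"
    and "integrable lborel (\<lambda>y. indicator {0..} y * (h y + h (- y)))"
proof -
  have [measurable]: "h \<in> borel_measurable borel"
    using h by auto
  have h': "integrable lborel (\<lambda>y. h (- y))"
    using h by (simp add: lborel_integrable_reflect)
  have i1: "integrable lborel (\<lambda>y. indicator {0..} y * h y)"
    by (rule Bochner_Integration.integrable_bound[OF h]) (auto split: split_indicator)
  have i2: "integrable lborel (\<lambda>y. indicator {0..} y * h (- y))"
    by (rule Bochner_Integration.integrable_bound[OF h']) (auto split: split_indicator)
  have i3: "integrable lborel (\<lambda>y. indicator {..0} y * h y)"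
    by (rule Bochner_Integration.integrable_bound[OF h]) (auto split: split_indicator)
  show "integrable lborel (\<lambda>y. indicator {0..} y * (h y + h (- y)))"
    using Bochner_Integration.integrable_add[OF i1 i2] by (simp add: distrib_left)
  have "(\<integral>y. indicator {0..} y * (h y + h (- y)) \<partial>lborel)
      = (\<integral>y. indicator {0..} y * h y \<partial>lborel) + (\<integral>y. indicator {0..} y * h (- y) \<partial>lborel)"
    using i1 i2 by (simp add: distrib_left)
  also have "(\<integral>y. indicator {0..} y * h (- y) \<partial>lborel) = (\<integral>y. indicator {..0} y * h y \<partial>lborel)"
    using lborel_integral_reflect[of "\<lambda>y. indicator {..0} y * h y"] by (simp add: indicator_def)
  also have "(\<integral>y. indicator {0..} y * h y \<partial>lborel) + (\<integral>y. indicator {..0} y * h y \<partial>lborel)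
      = (\<integral>y. indicator {0..} y * h y + indicator {..0} y * h y \<partial>lborel)"
    using i1 i3 by simp
  also have "\<dots> = (\<integral>y. h y \<partial>lborel)"
  proof (rule integral_cong_AE)
    have "AE y in lborel. y \<noteq> (0::real)"
      by (rule AE_lborel_singleton)
    then show "AE y in lborel. indicator {0..} y * h y + indicator {..0} y * h y = h y"
      by eventually_elim (auto split: split_indicator)
  qed measurable
  finally show "(\<integral>y. h y \<partial>lborel) = (\<integral>y. indicator {0..} y * (h y + h (- y)) \<partial>lborel)" ..
qed

text \<open>Reflections are orthogonal, hence unfolding is $\sqrt2$ times an isometry.\<close>

lemma unfold_inner:
  assumes N: "N > 0" and f: "line_L2 f" and g: "line_L2 g"
  shows "(\<Sum>j<N. \<integral>y. unfold N f j y * unfold N g j y \<partial>lborel) = 2 * L2_inner N f g"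
proof -
  let ?h = "\<lambda>j y. unfold N f j y * unfold N g j y"
  have int: "integrable lborel (?h j)" for j
    by (intro sqi_integrable_mult unfold_sqi f g)
  have [measurable]: "f i \<in> borel_measurable borel" "g i \<in> borel_measurable borel"
     "unfold N f i \<in> borel_measurable borel" "unfold N g i \<in> borel_measurable borel" for i
    using f g by (simp_all add: line_L2_measurable unfold_measurable)
  have fg: "integrable lborel (\<lambda>y. indicator {0..} y * (f j y * g j y))" for j
    by (rule Bochner_Integration.integrable_bound[OF sqi_integrable_mult[OF line_L2_sqi[OF f] line_L2_sqi[OF g]]])
      (auto split: split_indicator)
  have key: "(\<Sum>j<N. ?h j y + ?h j (- y)) = (\<Sum>j<N. 2 * (f j y * g j y))" if "y > 0" for y
  proof -
    let ?F = "\<Sum>i<N. f i y" and ?G = "\<Sum>i<N. g i y"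
    have "(\<Sum>j<N. ?h j y + ?h j (- y))
        = (\<Sum>j<N. 2 * (f j y * g j y) + (2 / real N * ?F) * (2 / real N * ?G)
            - (2 / real N * ?F) * g j y - (2 / real N * ?G) * f j y)"
      using that by (intro sum.cong) (auto simp: unfold_def algebra_simps)
    also have "\<dots> = (\<Sum>j<N. 2 * (f j y * g j y)) + real N * ((2 / real N * ?F) * (2 / real N * ?G))
        - (2 / real N * ?F) * ?G - (2 / real N * ?G) * ?F"
      by (simp only: sum.distrib sum_subtractf sum_constant card_lessThan sum_distrib_left of_nat_id)
    also have "\<dots> = (\<Sum>j<N. 2 * (f j y * g j y))"
      using N by (simp add: field_simps)
    finally show ?thesis .
  qed
  have "(\<Sum>j<N. \<integral>y. ?h j y \<partial>lborel) = (\<Sum>j<N. \<integral>y. indicator {0..} y * (?h j y + ?h j (- y)) \<partial>lborel)"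
    by (intro sum.cong refl integral_fold(1) int)
  also have "\<dots> = (\<integral>y. (\<Sum>j<N. indicator {0..} y * (?h j y + ?h j (- y))) \<partial>lborel)"
    by (intro Bochner_Integration.integral_sum[symmetric] integral_fold(2) int)
  also have "\<dots> = (\<integral>y. (\<Sum>j<N. 2 * (indicator {0..} y * (f j y * g j y))) \<partial>lborel)"
  proof (rule integral_cong_AE)
    have "AE y in lborel. y \<noteq> (0::real)"
      by (rule AE_lborel_singleton)
    then show "AE y in lborel. (\<Sum>j<N. indicator {0..} y * (?h j y + ?h j (- y)))
        = (\<Sum>j<N. 2 * (indicator {0..} y * (f j y * g j y)))"
    proof eventually_elim
      case (elim y)
      then show ?case
        using key[of y] by (cases "y > 0") auto
    qed
  qed measurable
  also have "\<dots> = (\<Sum>j<N. 2 * (\<integral>y. indicator {0..} y * (f j y * g j y) \<partial>lborel))"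
    using fg by (subst Bochner_Integration.integral_sum) auto
  also have "\<dots> = 2 * L2_inner N f g"
    by (simp add: L2_inner_def integral_leg sum_distrib_left)
  finally show ?thesis .
qed

text \<open>A Borel representative, legwise.  Convolutions integrate against \<open>lborel\<close>, whereas the
  functions on the legs are only Lebesgue measurable.  Off the legs $j < N$ it is set to zero.\<close>

definition borel_rep :: "nat \<Rightarrow> spider_fun \<Rightarrow> spider_fun" where
  "borel_rep N f j = (if j < N \<and> f j \<in> sqi leg
     then SOME g. g \<in> sqi lborel \<and> (AE x in leg. f j x = g x) else (\<lambda>x. 0))"

lemma line_L2_borel_rep: "line_L2 (borel_rep N f)"
  unfolding line_L2_def
proof
  fix j
  show "borel_rep N f j \<in> sqi lborel"
  proof (cases "j < N \<and> f j \<in> sqi leg")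
    case True
    then have "\<exists>g. g \<in> sqi lborel \<and> (AE x in leg. f j x = g x)"
      using sqi_leg_borel_rep by blast
    from someI_ex[OF this] True show ?thesis
      by (simp add: borel_rep_def)
  qed (auto simp: borel_rep_def sqi_zero)
qed

lemmas borel_rep_sqi = line_L2_sqi[OF line_L2_borel_rep]

lemma borel_rep_AE: "f \<in> L2 N \<Longrightarrow> AE_eq N f (borel_rep N f)"
  unfolding AE_eq_def
proof (intro allI impI)
  fix j assume "f \<in> L2 N" "j < N"
  then have *: "j < N \<and> f j \<in> sqi leg"
    by (simp add: L2_iff)
  then have "\<exists>g. g \<in> sqi lborel \<and> (AE x in leg. f j x = g x)"
    using sqi_leg_borel_rep by blast
  from someI_ex[OF this] * show "AE x in leg. f j x = borel_rep N f j x"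
    by (simp add: borel_rep_def)
qed

lemma line_L2_L2: "line_L2 f \<Longrightarrow> f \<in> L2 N"
  by (simp add: L2_iff sqi_lborel_leg line_L2_sqi)

text \<open>The operator on the spider with convolution kernel \<open>k\<close> on the unfolding.  For even
  \<open>k\<close> these operators compose like the kernels.\<close>

definition spread :: "nat \<Rightarrow> (real \<Rightarrow> real) \<Rightarrow> spider_fun \<Rightarrow> spider_fun" where
  "spread N k f j = conv k (unfold N (borel_rep N f) j)"

lemma AE_lborel_reflect:
  assumes "AE x in lborel. P (x::real)" "Measurable.pred borel P"
  shows "AE x in lborel. P (- x)"
  using AE_borel_affine[of "-1" P 0] assms by simp

lemma unfold_AE_cong:
  assumes f: "line_L2 f" and g: "line_L2 g" and eq: "AE_eq N f g" and j: "j < N"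
  shows "AE y in lborel. unfold N f j y = unfold N g j y"
proof -
  have [measurable]: "f i \<in> borel_measurable borel" "g i \<in> borel_measurable borel" for i
    using f g by (simp_all add: line_L2_measurable)
  have "AE x in lborel. x \<ge> 0 \<longrightarrow> f i x = g i x" if "i < N" for i
    using eq that by (simp add: AE_eq_def AE_leg)
  then have *: "AE x in lborel. \<forall>i\<in>{..<N}. x \<ge> 0 \<longrightarrow> f i x = g i x"
    by (intro AE_finite_allI) auto
  moreover have "AE x in lborel. \<forall>i\<in>{..<N}. - x \<ge> 0 \<longrightarrow> f i (- x) = g i (- x)"
    using AE_lborel_reflect[OF *] by simp
  ultimately show ?thesis
    by eventually_elim (use j in \<open>auto simp: unfold_def\<close>)
qed

lemma spread_eq:
  assumes f: "f \<in> L2 N" and f': "line_L2 f'" "AE_eq N f f'" and j: "j < N"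
    and k: "k \<in> borel_measurable borel"
  shows "spread N k f j = conv k (unfold N f' j)"
proof -
  have "AE_eq N (borel_rep N f) f'"
    using AE_eq_trans[OF AE_eq_sym[OF borel_rep_AE[OF f]] f'(2)] .
  then have "AE y in lborel. unfold N (borel_rep N f) j y = unfold N f' j y"
    by (intro unfold_AE_cong line_L2_borel_rep f' j)
  moreover have "unfold N (borel_rep N f) j \<in> borel_measurable borel" "unfold N f' j \<in> borel_measurable borel"
    by (simp_all add: unfold_measurable line_L2_borel_rep f')
  ultimately show ?thesis
    unfolding spread_def using k by (intro ext conv_cong_AE)
qed

lemma line_L2_spread: "bdd_L1 k \<Longrightarrow> line_L2 (spread N k f)"
  unfolding line_L2_def spread_def by (intro allI conv_L2 unfold_sqi line_L2_borel_rep)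

lemma spread_L2: "bdd_L1 k \<Longrightarrow> spread N k f \<in> L2 N"
  by (intro line_L2_L2 line_L2_spread)

lemma unfold_spread:
  assumes "N > 0" "bdd_L1 k" "\<And>u. k (- u) = k u"
  shows "unfold N (spread N k f) j y = conv k (unfold N (borel_rep N f) j) y"
  using unfold_conv[OF assms line_L2_borel_rep[of N f], of j y] by (simp add: spread_def[abs_def])

lemma spread_comp:
  assumes N: "N > 0" and k: "bdd_L1 k" and l: "bdd_L1 l" "\<And>u. l (- u) = l u" and j: "j < N"
  shows "spread N k (spread N l f) j = spread N (conv k l) f j"
proof
  fix x
  have "spread N k (spread N l f) j x = conv k (unfold N (spread N l f) j) x"
    by (subst spread_eq[OF spread_L2[OF l(1)] line_L2_spread[OF l(1)] AE_eq_refl j bdd_L1_measurable[OF k]]) simp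
  also have "\<dots> = conv k (conv l (unfold N (borel_rep N f) j)) x"
    using unfold_spread[OF N l, of f j] by (simp add: conv_def)
  also have "\<dots> = spread N (conv k l) f j x"
    unfolding spread_def by (intro conv_assoc k l unfold_sqi line_L2_borel_rep)
  finally show "spread N k (spread N l f) j x = spread N (conv k l) f j x" .
qed

lemma spread_lin:
  assumes k: "bdd_L1 k" and f: "f \<in> L2 N" and g: "g \<in> L2 N" and j: "j < N"
  shows "spread N k (\<lambda>j x. a * f j x + b * g j x) j x = a * spread N k f j x + b * spread N k g j x"
proof -
  let ?h = "\<lambda>i y. a * borel_rep N f i y + b * borel_rep N g i y"
  have "spread N k (\<lambda>j x. a * f j x + b * g j x) j x = conv k (unfold N ?h j) x"
    by (intro fun_cong[OF spread_eq] L2_lin f g AE_eq_lin borel_rep_AE j bdd_L1_measurable k)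
      (auto simp: line_L2_def intro!: sqi_add sqi_cmult borel_rep_sqi)
  also have "unfold N ?h j = (\<lambda>y. a * unfold N (borel_rep N f) j y + b * unfold N (borel_rep N g) j y)"
    by (rule ext) (rule unfold_lin)
  also have "conv k \<dots> x = a * spread N k f j x + b * spread N k g j x"
    unfolding spread_def by (intro conv_add_right bdd_L1_sqi k unfold_sqi line_L2_borel_rep)
  finally show ?thesis .
qed

lemma spread_lin_kernel:
  assumes "bdd_L1 k" "bdd_L1 l"
  shows "spread N (\<lambda>x. a * k x + b * l x) f j x = a * spread N k f j x + b * spread N l f j x"
  unfolding spread_def by (intro conv_add_left bdd_L1_sqi unfold_sqi line_L2_borel_rep assms)

lemma L2_norm_unfold:
  assumes N: "N > 0" and f: "f \<in> L2 N" and f': "line_L2 f'" "AE_eq N f f'"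
  shows "2 * (L2_norm N f)\<^sup>2 = (\<Sum>j<N. \<integral>y. (unfold N f' j y)\<^sup>2 \<partial>lborel)"
  using unfold_inner[OF N f'(1) f'(1)] L2_inner_cong[OF f'(2) f'(2) f line_L2_L2[OF f'(1)] f line_L2_L2[OF f'(1)]]
  unfolding L2_norm_square power2_eq_square[of "unfold _ _ _ _"] by simp

lemma spread_norm_le:
  assumes N: "N > 0" and k: "bdd_L1 k" "\<And>u. k (- u) = k u" and f: "f \<in> L2 N"
  shows "L2_norm N (spread N k f) \<le> (\<integral>x. \<bar>k x\<bar> \<partial>lborel) * L2_norm N f"
proof (rule power2_le_imp_le)
  let ?m = "\<integral>x. \<bar>k x\<bar> \<partial>lborel"
  have "2 * (L2_norm N (spread N k f))\<^sup>2
      = (\<Sum>j<N. \<integral>y. (unfold N (spread N k f) j y)\<^sup>2 \<partial>lborel)"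
    by (intro L2_norm_unfold N spread_L2 line_L2_spread k AE_eq_refl)
  also have "\<dots> \<le> (\<Sum>j<N. ?m\<^sup>2 * (\<integral>y. (unfold N (borel_rep N f) j y)\<^sup>2 \<partial>lborel))"
    unfolding unfold_spread[OF N k] by (intro sum_mono conv_L2 k unfold_sqi line_L2_borel_rep)
  also have "\<dots> = ?m\<^sup>2 * (2 * (L2_norm N f)\<^sup>2)"
    unfolding sum_distrib_left[symmetric]
    by (subst L2_norm_unfold[OF N f line_L2_borel_rep borel_rep_AE[OF f]]) simp
  finally show "(L2_norm N (spread N k f))\<^sup>2 \<le> (?m * L2_norm N f)\<^sup>2"
    by (simp add: power_mult_distrib)
qed (simp add: L2_norm_nonneg)

lemma spread_diff_norm:
  assumes N: "N > 0" and k: "bdd_L1 k" "\<And>u. k (- u) = k u" and f: "f \<in> L2 N"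
  shows "2 * (L2_norm N (\<lambda>j x. spread N k f j x - f j x))\<^sup>2
    = (\<Sum>j<N. \<integral>y. (conv k (unfold N (borel_rep N f) j) y - unfold N (borel_rep N f) j y)\<^sup>2 \<partial>lborel)"
proof -
  let ?h = "\<lambda>j x. spread N k f j x - borel_rep N f j x"
  have "2 * (L2_norm N (\<lambda>j x. spread N k f j x - f j x))\<^sup>2 = (\<Sum>j<N. \<integral>y. (unfold N ?h j y)\<^sup>2 \<partial>lborel)"
    using line_L2_sqi[OF line_L2_spread[OF k(1)]] line_L2_sqi[OF line_L2_borel_rep]
    by (intro L2_norm_unfold N L2_diff spread_L2 k f AE_eq_diff AE_eq_refl borel_rep_AE)
      (auto simp: line_L2_def intro!: sqi_diff)
  moreover have "unfold N ?h j y = unfold N (spread N k f) j y - unfold N (borel_rep N f) j y" for j y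
    using unfold_lin[of N 1 "spread N k f" "-1" "borel_rep N f" j y] by simp
  ultimately show ?thesis
    by (simp add: unfold_spread[OF N k])
qed

lemma spread_approx_identity:
  assumes N: "N > 0" and f: "f \<in> L2 N"
    and k: "\<And>t. t > 0 \<Longrightarrow> bdd_L1 (k t)" "\<And>t u. k t (- u) = k t u"
    and lim: "\<And>g. g \<in> sqi lborel \<Longrightarrow>
        ((\<lambda>t. \<integral>x. (conv (k t) g x - g x)\<^sup>2 \<partial>lborel) \<longlongrightarrow> 0) (at_right (0::real))"
  shows "((\<lambda>t. L2_norm N (\<lambda>j x. spread N (k t) f j x - f j x)) \<longlongrightarrow> 0) (at_right 0)"
proof -
  let ?e = "\<lambda>j. unfold N (borel_rep N f) j"
  have "((\<lambda>t. sqrt (1 / 2 * (\<Sum>j<N. \<integral>y. (conv (k t) (?e j) y - ?e j y)\<^sup>2 \<partial>lborel))) \<longlongrightarrow> sqrt (1 / 2 * (\<Sum>j<N. 0))) (at_right 0)"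
    by (intro tendsto_intros lim unfold_sqi line_L2_borel_rep)
  then have "((\<lambda>t. sqrt (1 / 2 * (\<Sum>j<N. \<integral>y. (conv (k t) (?e j) y - ?e j y)\<^sup>2 \<partial>lborel))) \<longlongrightarrow> 0) (at_right 0)"
    by simp
  then show ?thesis
  proof (rule Lim_transform_eventually)
    show "\<forall>\<^sub>F t in at_right 0. sqrt (1 / 2 * (\<Sum>j<N. \<integral>y. (conv (k t) (?e j) y - ?e j y)\<^sup>2 \<partial>lborel))
        = L2_norm N (\<lambda>j x. spread N (k t) f j x - f j x)"
      using eventually_at_right_less[of "0::real"]
    proof eventually_elim
      case (elim t)
      have "1 / 2 * (\<Sum>j<N. \<integral>y. (conv (k t) (?e j) y - ?e j y)\<^sup>2 \<partial>lborel)
          = (L2_norm N (\<lambda>j x. spread N (k t) f j x - f j x))\<^sup>2"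
        using spread_diff_norm[OF N k(1)[OF elim] k(2) f] by simp
      then show ?case
        by (simp only: real_sqrt_abs abs_of_nonneg[OF L2_norm_nonneg])
    qed
  qed
qed

section \<open>The explicit semigroup\<close>

text \<open>The heat semigroup written down explicitly.  Time 0 is separate, since the kernel
  degenerates there.\<close>

definition heat_sg :: "nat \<Rightarrow> real \<Rightarrow> spider_fun \<Rightarrow> spider_fun" where
  "heat_sg N t f = (if t = 0 then f else spread N (heat_kernel t) f)"

lemma heat_sg_contraction:
  assumes "N > 0" "t \<ge> 0" "f \<in> L2 N"
  shows "L2_norm N (heat_sg N t f) \<le> L2_norm N f"
proof (cases "t = 0")
  case False
  then show ?thesis
    using spread_norm_le[OF assms(1) bdd_L1_heat_kernel heat_kernel_even assms(3), of t] assms(2)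
    by (simp add: heat_sg_def heat_kernel_nonneg heat_kernel_integral)
qed (simp add: heat_sg_def)

lemma heat_sg_C0:
  assumes N: "N > 0"
  shows "C0_semigroup N (heat_sg N)"
  unfolding C0_semigroup_def
proof (intro conjI allI impI ballI)
  fix t :: real and f assume "0 \<le> t" "f \<in> L2 N"
  then show "heat_sg N t f \<in> L2 N"
    by (simp add: heat_sg_def spread_L2 bdd_L1_heat_kernel)
next
  fix t :: real and f g and a b assume "0 \<le> t" "f \<in> L2 N" "g \<in> L2 N"
  then show "AE_eq N (heat_sg N t (\<lambda>j x. a * f j x + b * g j x))
      (\<lambda>j x. a * heat_sg N t f j x + b * heat_sg N t g j x)"
    by (auto simp: heat_sg_def AE_eq_def spread_lin bdd_L1_heat_kernel)
next
  fix t :: real assume "0 \<le> t"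
  then show "\<exists>M. \<forall>f\<in>L2 N. L2_norm N (heat_sg N t f) \<le> M * L2_norm N f"
    using heat_sg_contraction[OF N] by (intro exI[of _ 1]) simp
next
  fix f show "AE_eq N (heat_sg N 0 f) f"
    by (simp add: heat_sg_def AE_eq_refl)
next
  fix s t :: real and f assume "0 \<le> s" "0 \<le> t" "f \<in> L2 N"
  then show "AE_eq N (heat_sg N (s + t) f) (heat_sg N s (heat_sg N t f))"
    by (auto simp: heat_sg_def AE_eq_def spread_comp[OF N] bdd_L1_heat_kernel heat_kernel_even heat_kernel_semigroup)
next
  fix f assume f: "f \<in> L2 N"
  have "((\<lambda>t. L2_norm N (\<lambda>j x. spread N (heat_kernel t) f j x - f j x)) \<longlongrightarrow> 0) (at_right 0)"
    by (intro spread_approx_identity N f bdd_L1_heat_kernel heat_kernel_even heat_kernel_approx_identity)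
  then show "((\<lambda>t. L2_norm N (\<lambda>j x. heat_sg N t f j x - f j x)) \<longlongrightarrow> 0) (at_right 0)"
    by (rule Lim_transform_eventually)
      (use eventually_at_right_less[of "0::real"] in eventually_elim, simp add: heat_sg_def)
qed

text \<open>The operator $(1 - \Delta)^{-1}$ of the spider.\<close>

definition resolvent :: "nat \<Rightarrow> spider_fun \<Rightarrow> spider_fun" where
  "resolvent N = spread N res_kernel"

lemma resolvent_L2: "resolvent N f \<in> L2 N"
  by (simp add: resolvent_def spread_L2 bdd_L1_res_kernel)

lemma resolvent_generator:
  assumes N: "N > 0" and f: "f \<in> L2 N"
  shows "infinitesimal_generator N (heat_sg N) (resolvent N f) (\<lambda>j x. resolvent N f j x - f j x)"
  unfolding infinitesimal_generator_def
proof (intro conjI resolvent_L2 L2_diff f)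
  let ?R = "resolvent N f"
  let ?D = "\<lambda>t j x. spread N (diff_kernel t) f j x - f j x"
  have D: "((\<lambda>t. L2_norm N (?D t)) \<longlongrightarrow> 0) (at_right 0)"
    by (intro spread_approx_identity N f bdd_L1_diff_kernel diff_kernel_even diff_kernel_approx_identity)
  have "((\<lambda>t::real. \<bar>(exp t - 1) / t - 1\<bar>) \<longlongrightarrow> 0) (at_right 0)"
    by real_asymp
  from tendsto_add[OF tendsto_mult_left_zero[OF this, of "L2_norm N ?R"] D]
  have lim: "((\<lambda>t. \<bar>(exp t - 1) / t - 1\<bar> * L2_norm N ?R + L2_norm N (?D t)) \<longlongrightarrow> 0) (at_right 0)"
    by simp
  show "((\<lambda>t. L2_norm N (\<lambda>j x. (heat_sg N t ?R j x - ?R j x) / t - (?R j x - f j x))) \<longlongrightarrow> 0) (at_right 0)"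
  proof (rule Lim_null_comparison[OF _ lim])
    show "\<forall>\<^sub>F t in at_right 0. norm (L2_norm N (\<lambda>j x. (heat_sg N t ?R j x - ?R j x) / t - (?R j x - f j x)))
        \<le> \<bar>(exp t - 1) / t - 1\<bar> * L2_norm N ?R + L2_norm N (?D t)"
      using eventually_at_right_less[of "0::real"]
    proof eventually_elim
      case (elim t)
      let ?c = "(exp t - 1) / t - 1"
      have cL2: "(\<lambda>j x. ?c * ?R j x) \<in> L2 N" "?D t \<in> L2 N"
        using elim by (auto intro!: L2_cmult L2_diff resolvent_L2 spread_L2 bdd_L1_diff_kernel f)
      have eq: "(heat_sg N t ?R j x - ?R j x) / t - (?R j x - f j x) = ?c * ?R j x - ?D t j x"
        if "j < N" for j x
      proof -
        have "heat_sg N t ?R j x = spread N (conv (heat_kernel t) res_kernel) f j x"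
          using elim that by (simp add: heat_sg_def resolvent_def spread_comp N bdd_L1_heat_kernel
              bdd_L1_res_kernel res_kernel_even)
        moreover have "spread N (diff_kernel t) f j x
            = exp t / t * ?R j x + (- 1 / t) * spread N (conv (heat_kernel t) res_kernel) f j x"
          unfolding diff_kernel_def[abs_def] resolvent_def using elim
          by (intro spread_lin_kernel bdd_L1_conv bdd_L1_heat_kernel bdd_L1_res_kernel)
        ultimately show ?thesis
          using elim by (simp add: field_simps)
      qed
      have "L2_norm N (\<lambda>j x. (heat_sg N t ?R j x - ?R j x) / t - (?R j x - f j x))
          = L2_norm N (\<lambda>j x. ?c * ?R j x - ?D t j x)"
        unfolding L2_norm_def L2_inner_def by (simp add: eq)
      also have "\<dots> \<le> L2_norm N (\<lambda>j x. ?c * ?R j x) + L2_norm N (?D t)"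
        by (rule L2_norm_triangle_diff[OF cL2])
      also have "L2_norm N (\<lambda>j x. ?c * ?R j x) = \<bar>?c\<bar> * L2_norm N ?R"
        by (rule L2_norm_cmult[OF resolvent_L2])
      finally show ?case
        by (simp add: L2_norm_nonneg)
    qed
  qed
qed

section \<open>The Laplacian and its resolvent\<close>

text \<open>Membership in the form domain, with the common vertex value and the derivatives on the legs
  made explicit.\<close>

definition H1spider :: "nat \<Rightarrow> spider_fun \<Rightarrow> real \<Rightarrow> spider_fun \<Rightarrow> bool" where
  "H1spider N f c g \<longleftrightarrow> (\<forall>j<N. H1rep (f j) c (g j))"

lemma H1spiderD: "H1spider N f c g \<Longrightarrow> j < N \<Longrightarrow> H1rep (f j) c (g j)"
  by (simp add: H1spider_def)

lemma H1spider_L2: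
  assumes "H1spider N f c g"
  shows "f \<in> L2 N" "g \<in> L2 N"
  using assms by (auto simp: H1spider_def L2_iff H1rep_def sqi_lborel_leg)

lemma Dom_E_iff: "f \<in> Dom_E N \<longleftrightarrow> (\<exists>c g. H1spider N f c g)"
  unfolding H1spider_def
proof
  assume f: "f \<in> Dom_E N"
  then have "\<forall>j. \<exists>c g. j < N \<longrightarrow> H1rep (f j) c g"
    by (auto simp: Dom_E_def H1_leg_iff)
  then obtain c g where cg: "\<And>j. j < N \<Longrightarrow> H1rep (f j) (c j) (g j)"
    by metis
  have "c i = c j" if "i < N" "j < N" for i j
  proof -
    have "value_at_0 (f i) = value_at_0 (f j)"
      using f that unfolding Dom_E_def by blast
    then show ?thesis
      unfolding H1rep_value_at_0[OF cg[OF that(1)]] H1rep_value_at_0[OF cg[OF that(2)]] .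
  qed
  then have "c j = c 0" if "j < N" for j
    using that by (intro \<open>\<And>i j. i < N \<Longrightarrow> j < N \<Longrightarrow> c i = c j\<close>) auto
  then have "\<forall>j<N. H1rep (f j) (c 0) (g j)"
    using cg by metis
  then show "\<exists>c g. \<forall>j<N. H1rep (f j) c (g j)"
    by blast
next
  assume "\<exists>c g. \<forall>j<N. H1rep (f j) c (g j)"
  then obtain c g where cg: "\<And>j. j < N \<Longrightarrow> H1rep (f j) c (g j)"
    by blast
  then show "f \<in> Dom_E N"
    unfolding Dom_E_def L2_iff H1_leg_iff
  proof (intro CollectI conjI allI impI)
    show "f j \<in> sqi leg" if "j < N" for j
      using cg[OF that] by (simp add: H1rep_def)
    show "\<exists>c g. H1rep (f j) c g" if "j < N" for j
      using cg[OF that] by blast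
    show "value_at_0 (f i) = value_at_0 (f j)" if "i < N" "j < N" for i j
      using H1rep_value_at_0[OF cg[OF that(1)]] H1rep_value_at_0[OF cg[OF that(2)]] by simp
  qed
qed

lemma Dom_E_L2: "f \<in> Dom_E N \<Longrightarrow> f \<in> L2 N"
  by (simp add: Dom_E_def)

lemma E_form_eq:
  assumes u: "H1spider N u c g" and v: "H1spider N v c' h"
  shows "E_form N u v = L2_inner N g h"
  unfolding E_form_def L2_inner_def
proof (rule sum.cong[OF refl])
  fix j assume "j \<in> {..<N}"
  then have j: "j < N"
    by simp
  have g: "g j \<in> sqi lborel" "h j \<in> sqi lborel"
    using H1spiderD[OF u j] H1spiderD[OF v j] by (auto simp: H1rep_def)
  note wu = H1rep_weak_deriv[OF H1spiderD[OF u j]] and wv = H1rep_weak_deriv[OF H1spiderD[OF v j]]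
  have [measurable]: "weak_deriv (u j) \<in> borel_measurable leg" "weak_deriv (v j) \<in> borel_measurable leg"
     "g j \<in> borel_measurable leg" "h j \<in> borel_measurable leg"
    using sqi_measurable[OF wu(2)] sqi_measurable[OF wv(2)] g[THEN sqi_lborel_leg, THEN sqi_measurable] by auto
  have "AE x in leg. weak_deriv (u j) x * weak_deriv (v j) x = g j x * h j x"
    using wu(1) wv(1) by eventually_elim simp
  then show "(\<integral>x. weak_deriv (u j) x * weak_deriv (v j) x \<partial>leg) = (\<integral>x. g j x * h j x \<partial>leg)"
    by (intro integral_cong_AE) auto
qed

lemma is_Laplacian_L2: "is_Laplacian N u w \<Longrightarrow> u \<in> L2 N \<and> w \<in> L2 N"
  by (simp add: is_Laplacian_def Dom_E_L2)

lemma is_Laplacian_lin: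
  assumes 1: "is_Laplacian N u w" and 2: "is_Laplacian N u' w'"
  shows "is_Laplacian N (\<lambda>j x. a * u j x + b * u' j x) (\<lambda>j x. a * w j x + b * w' j x)"
proof -
  obtain c g c' g' where g: "H1spider N u c g" "H1spider N u' c' g'"
    using assms unfolding is_Laplacian_def Dom_E_iff by blast
  note gL2 = H1spider_L2(2)[OF g(1)] H1spider_L2(2)[OF g(2)]
  have lin: "H1spider N (\<lambda>j x. a * u j x + b * u' j x) (a * c + b * c') (\<lambda>j x. a * g j x + b * g' j x)"
    unfolding H1spider_def by (intro allI impI H1rep_add H1spiderD[OF g(1)] H1spiderD[OF g(2)])
  show ?thesis
    unfolding is_Laplacian_def
  proof (intro conjI ballI)
    show "(\<lambda>j x. a * u j x + b * u' j x) \<in> Dom_E N"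
      unfolding Dom_E_iff using lin by (intro exI)
    show "(\<lambda>j x. a * w j x + b * w' j x) \<in> L2 N"
      using assms by (intro L2_lin) (auto simp: is_Laplacian_def)
    fix v assume v: "v \<in> Dom_E N"
    then obtain d h where h: "H1spider N v d h"
      unfolding Dom_E_iff by blast
    note hL2 = H1spider_L2(2)[OF h]
    have "E_form N (\<lambda>j x. a * u j x + b * u' j x) v = a * L2_inner N g h + b * L2_inner N g' h"
      using E_form_eq[OF lin h] L2_inner_lin_left[OF gL2 hL2, of a b] by simp
    also have "L2_inner N g h = - L2_inner N v w"
      using E_form_eq[OF g(1) h] 1 v by (simp add: is_Laplacian_def)
    also have "L2_inner N g' h = - L2_inner N v w'"
      using E_form_eq[OF g(2) h] 2 v by (simp add: is_Laplacian_def)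
    finally show "E_form N (\<lambda>j x. a * u j x + b * u' j x) v = - L2_inner N v (\<lambda>j x. a * w j x + b * w' j x)"
      using L2_inner_lin_right[of w N w' v a b] assms v by (simp add: is_Laplacian_def Dom_E_L2)
  qed
qed

lemma is_Laplacian_cong:
  assumes L: "is_Laplacian N u w" and u: "AE_eq N u u'" "u' \<in> L2 N" and w: "AE_eq N w w'" "w' \<in> L2 N"
  shows "is_Laplacian N u' w'"
proof -
  obtain c g where g: "H1spider N u c g"
    using L unfolding is_Laplacian_def Dom_E_iff by blast
  then have g': "H1spider N u' c g"
    using u by (auto intro: H1rep_cong simp: AE_eq_def L2_iff H1spider_def)
  show ?thesis
    unfolding is_Laplacian_def
  proof (intro conjI ballI w)
    show "u' \<in> Dom_E N"
      using g' unfolding Dom_E_iff by (intro exI)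
    fix v assume v: "v \<in> Dom_E N"
    then obtain d h where h: "H1spider N v d h"
      unfolding Dom_E_iff by blast
    have "E_form N u' v = E_form N u v"
      using E_form_eq[OF g h] E_form_eq[OF g' h] by simp
    also have "\<dots> = - L2_inner N v w"
      using L v by (simp add: is_Laplacian_def)
    also have "L2_inner N v w = L2_inner N v w'"
      using L v w by (intro L2_inner_cong AE_eq_refl) (auto simp: is_Laplacian_def Dom_E_L2)
    finally show "E_form N u' v = - L2_inner N v w'" .
  qed
qed

lemma is_Laplacian_dissipative:
  assumes "is_Laplacian N u w"
  shows "L2_inner N w u \<le> 0"
proof -
  have "0 \<le> E_form N u u"
    unfolding E_form_def by (intro sum_nonneg integral_nonneg_AE) auto
  also have "\<dots> = - L2_inner N u w"
    using assms by (simp add: is_Laplacian_def)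
  finally show ?thesis
    by (simp add: L2_inner_commute)
qed

text \<open>With $e_j$ the unfolding of $f$, the function $u_j = r * e_j$ has derivative
  $u_j' = r' * e_j$ and $u_j'' = u_j - e_j$.  The fluxes $u_j'(0)$ add up to zero because
  $\sum_j e_j$ is even and $r'$ is odd.\<close>

lemma resolvent_Laplacian:
  assumes N: "N > 0" and f: "f \<in> L2 N"
  shows "is_Laplacian N (resolvent N f) (\<lambda>j x. resolvent N f j x - f j x)"
proof -
  let ?R = "resolvent N f" and ?e = "unfold N (borel_rep N f)"
  define V where "V = (\<lambda>j. conv res_kernel' (?e j))"
  define W where "W = (\<lambda>j x. conv res_kernel (?e j) x - ?e j x)"
  note e = unfold_sqi[OF line_L2_borel_rep]
  have R_eq: "?R j = conv res_kernel (?e j)" for j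
    by (simp add: resolvent_def spread_def)
  have V_sqi: "V j \<in> sqi lborel" for j
    unfolding V_def by (intro conv_L2 bdd_L1_res_kernel' e)
  have W_sqi: "W j \<in> sqi lborel" for j
    unfolding W_def by (intro sqi_diff conv_L2 bdd_L1_res_kernel e)
  have R_AE: "AE x in leg. ?R j x = ?R j 0 + prim (V j) x" for j
    unfolding AE_leg R_eq V_def by (intro AE_I2 impI res_conv_H1[OF e])
  define c where "c = 1 / real N * (\<Sum>i<N. ?R i 0)"
  have R_c: "?R j 0 = c" for j
  proof -
    have "?R j 0 = 2 / real N * (\<Sum>i<N. ?R i 0) - ?R j 0"
      using conv_unfold_reflect[OF N bdd_L1_sqi[OF bdd_L1_res_kernel] line_L2_borel_rep[of N f], of j 0]
      unfolding R_eq res_kernel_even minus_zero .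
    moreover have "2 / real N * (\<Sum>i<N. ?R i 0) = 2 * c"
      by (simp add: c_def)
    ultimately show ?thesis
      by linarith
  qed
  have R_H1: "H1spider N ?R c V"
    unfolding H1spider_def using resolvent_L2[of N f] R_AE V_sqi R_c by (simp add: H1rep_def L2_iff)
  \<comment> \<open>the Kirchhoff condition\<close>
  have V_0: "(\<Sum>j<N. V j 0) = 0"
  proof -
    have "- V j 0 = 2 / real N * (\<Sum>i<N. V i 0) - V j 0" for j
    proof -
      have "conv (\<lambda>u. res_kernel' (- u)) (?e j) (- 0) = - V j 0"
        by (simp add: V_def conv_def res_kernel'_def res_kernel_even sgn_minus)
      from trans[OF this[symmetric]
          conv_unfold_reflect[OF N bdd_L1_sqi[OF bdd_L1_res_kernel'] line_L2_borel_rep[of N f], of j 0]]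
      show ?thesis
        unfolding V_def .
    qed
    from this[of 0] show ?thesis
      using N by simp
  qed
  have V_prim: "V j x = V j 0 + prim (W j) x" if "x \<ge> 0" for j x
    unfolding V_def W_def by (rule res_conv'_H1[OF e that])
  have RmF: "AE_eq N (\<lambda>j x. ?R j x - f j x) W"
    unfolding AE_eq_def
  proof (intro allI impI)
    fix j assume j: "j < N"
    have "AE x in leg. f j x = borel_rep N f j x"
      using borel_rep_AE[OF f] j by (simp add: AE_eq_def)
    moreover have "AE x in leg. x \<noteq> 0 \<and> x \<ge> 0"
      unfolding AE_leg using AE_lborel_singleton[of "0::real"] by eventually_elim auto
    ultimately show "AE x in leg. ?R j x - f j x = W j x"
      by eventually_elim (simp add: W_def R_eq unfold_def)
  qed
  have W_L2: "W \<in> L2 N"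
    using W_sqi by (simp add: L2_iff sqi_lborel_leg)
  show ?thesis
    unfolding is_Laplacian_def
  proof (intro conjI ballI L2_diff resolvent_L2 f)
    show "?R \<in> Dom_E N"
      unfolding Dom_E_iff using R_H1 by (intro exI)
    fix v assume v: "v \<in> Dom_E N"
    then obtain d h where h: "H1spider N v d h"
      unfolding Dom_E_iff by blast
    have parts: "(\<integral>x. V j x * h j x \<partial>leg) = - (V j 0 * d) - (\<integral>x. v j x * W j x \<partial>leg)" if j: "j < N" for j
    proof -
      have hj: "h j \<in> sqi lborel"
        using H1spiderD[OF h j] by (simp add: H1rep_def)
      have [measurable]: "V j \<in> borel_measurable borel" "W j \<in> borel_measurable borel"
        "h j \<in> borel_measurable borel" "prim (h j) \<in> borel_measurable borel" "prim (W j) \<in> borel_measurable borel"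
        using sqi_measurable[OF V_sqi[of j]] sqi_measurable[OF W_sqi[of j]] sqi_measurable[OF hj]
          prim_measurable[OF hj] prim_measurable[OF W_sqi[of j]] by simp_all
      have V_eq: "indicator {0..} x * (V j 0 + prim (W j) x) = indicator {0..} x * V j x" for x
        using V_prim[of x j] by (auto split: split_indicator)
      have "(\<lambda>x. indicator {0..} x * (V j 0 + prim (W j) x)) \<in> sqi lborel"
        unfolding V_eq by (rule sqi_bound[OF V_sqi[of j]]) (auto split: split_indicator)
      from half_line_by_parts[OF W_sqi hj this H1rep_sqi[OF H1spiderD[OF h j]]]
      have "(\<integral>x. indicator {0..} x * (W j x * (d + prim (h j) x)) \<partial>lborel)
          + (\<integral>x. indicator {0..} x * ((V j 0 + prim (W j) x) * h j x) \<partial>lborel) = - (V j 0 * d)" .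
      also have "(\<integral>x. indicator {0..} x * ((V j 0 + prim (W j) x) * h j x) \<partial>lborel) = (\<integral>x. V j x * h j x \<partial>leg)"
        by (subst integral_leg) (simp_all add: V_eq flip: mult.assoc)
      also have "(\<integral>x. indicator {0..} x * (W j x * (d + prim (h j) x)) \<partial>lborel) = (\<integral>x. W j x * (d + prim (h j) x) \<partial>leg)"
        by (subst integral_leg) auto
      also have "\<dots> = (\<integral>x. v j x * W j x \<partial>leg)"
      proof (rule integral_cong_AE)
        show "(\<lambda>x. W j x * (d + prim (h j) x)) \<in> borel_measurable leg"
          by (rule measurable_leg) measurable
        have "v j \<in> borel_measurable leg"
          using H1spiderD[OF h j] by (auto simp: H1rep_def dest: sqi_measurable)
        moreover have "W j \<in> borel_measurable leg"
          by (rule measurable_leg) measurable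
        ultimately show "(\<lambda>x. v j x * W j x) \<in> borel_measurable leg"
          by measurable
        show "AE x in leg. W j x * (d + prim (h j) x) = v j x * W j x"
          using H1spiderD[OF h j] by (auto simp: H1rep_def)
      qed
      finally show ?thesis
        by simp
    qed
    have "E_form N ?R v = (\<Sum>j<N. - (V j 0 * d) - (\<integral>x. v j x * W j x \<partial>leg))"
      unfolding E_form_eq[OF R_H1 h] L2_inner_def by (intro sum.cong refl parts) simp
    also have "\<dots> = - ((\<Sum>j<N. V j 0) * d) - L2_inner N v W"
      by (simp add: L2_inner_def sum_subtractf sum_negf sum_distrib_right)
    also have "\<dots> = - L2_inner N v W"
      by (simp add: V_0)
    also have "L2_inner N v W = L2_inner N v (\<lambda>j x. ?R j x - f j x)"
      by (intro L2_inner_cong AE_eq_refl AE_eq_sym[OF RmF] Dom_E_L2 v W_L2 L2_diff resolvent_L2 f)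
    finally show "E_form N ?R v = - L2_inner N v (\<lambda>j x. ?R j x - f j x)" .
  qed
qed

section \<open>Strongly continuous semigroups on the spider\<close>

lemma C0_semigroup_D:
  assumes "C0_semigroup N P"
  shows "t \<ge> 0 \<Longrightarrow> f \<in> L2 N \<Longrightarrow> P t f \<in> L2 N"
    and "t \<ge> 0 \<Longrightarrow> f \<in> L2 N \<Longrightarrow> g \<in> L2 N \<Longrightarrow>
      AE_eq N (P t (\<lambda>j x. a * f j x + b * g j x)) (\<lambda>j x. a * P t f j x + b * P t g j x)"
    and "t \<ge> 0 \<Longrightarrow> \<exists>M\<ge>0. \<forall>f\<in>L2 N. L2_norm N (P t f) \<le> M * L2_norm N f"
    and "f \<in> L2 N \<Longrightarrow> AE_eq N (P 0 f) f"
    and "s \<ge> 0 \<Longrightarrow> t \<ge> 0 \<Longrightarrow> f \<in> L2 N \<Longrightarrow> AE_eq N (P (s + t) f) (P s (P t f))"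
    and "f \<in> L2 N \<Longrightarrow> ((\<lambda>t. L2_norm N (\<lambda>j x. P t f j x - f j x)) \<longlongrightarrow> 0) (at_right 0)"
proof -
  note c = assms[unfolded C0_semigroup_def]
  note c2 = c[THEN conjunct2] note c3 = c2[THEN conjunct2] note c4 = c3[THEN conjunct2]
  note c5 = c4[THEN conjunct2] note c6 = c5[THEN conjunct2]
  show "t \<ge> 0 \<Longrightarrow> f \<in> L2 N \<Longrightarrow> P t f \<in> L2 N"
    by (rule c[THEN conjunct1, rule_format])
  show "t \<ge> 0 \<Longrightarrow> f \<in> L2 N \<Longrightarrow> g \<in> L2 N \<Longrightarrow>
      AE_eq N (P t (\<lambda>j x. a * f j x + b * g j x)) (\<lambda>j x. a * P t f j x + b * P t g j x)"
    by (rule c2[THEN conjunct1, rule_format])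
  show "f \<in> L2 N \<Longrightarrow> AE_eq N (P 0 f) f"
    by (rule c4[THEN conjunct1, rule_format])
  show "s \<ge> 0 \<Longrightarrow> t \<ge> 0 \<Longrightarrow> f \<in> L2 N \<Longrightarrow> AE_eq N (P (s + t) f) (P s (P t f))"
    by (rule c5[THEN conjunct1, rule_format])
  show "f \<in> L2 N \<Longrightarrow> ((\<lambda>t. L2_norm N (\<lambda>j x. P t f j x - f j x)) \<longlongrightarrow> 0) (at_right 0)"
    by (rule c6[rule_format])
  show "\<exists>M\<ge>0. \<forall>f\<in>L2 N. L2_norm N (P t f) \<le> M * L2_norm N f" if t: "t \<ge> 0"
  proof -
    obtain M where M: "\<forall>f\<in>L2 N. L2_norm N (P t f) \<le> M * L2_norm N f"
      using c3[THEN conjunct1] t by blast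
    have "L2_norm N (P t f) \<le> max M 0 * L2_norm N f" if "f \<in> L2 N" for f
      by (rule order.trans[OF M[rule_format, OF that]]) (auto intro: mult_right_mono L2_norm_nonneg)
    then show ?thesis
      by (intro exI[of _ "max M 0"]) auto
  qed
qed

lemma C0_diff:
  assumes P: "C0_semigroup N P" and t: "t \<ge> 0" and f: "f \<in> L2 N" and g: "g \<in> L2 N"
  shows "AE_eq N (P t (\<lambda>j x. f j x - g j x)) (\<lambda>j x. P t f j x - P t g j x)"
  using C0_semigroup_D(2)[OF P t f g, of 1 "-1"] by simp

lemma AE_eq_zero_diff: "AE_eq N (\<lambda>j x. f j x - g j x) (\<lambda>j x. 0) \<longleftrightarrow> AE_eq N f g"
  by (simp add: AE_eq_def)

lemma L2_zero: "(\<lambda>j x. 0) \<in> L2 N"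
  by (simp add: L2_iff sqi_zero)

lemma C0_cong:
  assumes P: "C0_semigroup N P" and t: "t \<ge> 0" and f: "f \<in> L2 N" and g: "g \<in> L2 N" and eq: "AE_eq N f g"
  shows "AE_eq N (P t f) (P t g)"
proof -
  obtain M where M: "M \<ge> 0" "\<forall>f\<in>L2 N. L2_norm N (P t f) \<le> M * L2_norm N f"
    using C0_semigroup_D(3)[OF P t] by blast
  have fg: "(\<lambda>j x. f j x - g j x) \<in> L2 N"
    by (rule L2_diff[OF f g])
  have "L2_norm N (\<lambda>j x. f j x - g j x) = 0"
    using eq fg by (intro L2_norm_AE_zero) (simp add: AE_eq_zero_diff)
  then have "L2_norm N (P t (\<lambda>j x. f j x - g j x)) = 0"
    using M(2)[rule_format, OF fg] L2_norm_nonneg[of N "P t (\<lambda>j x. f j x - g j x)"] by simp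
  then have "AE_eq N (P t (\<lambda>j x. f j x - g j x)) (\<lambda>j x. 0)"
    by (intro L2_norm_zero_imp C0_semigroup_D(1)[OF P t] fg)
  then have "AE_eq N (\<lambda>j x. P t f j x - P t g j x) (\<lambda>j x. 0)"
    using AE_eq_trans[OF AE_eq_sym[OF C0_diff[OF P t f g]]] by blast
  then show ?thesis
    by (simp add: AE_eq_zero_diff)
qed

text \<open>The increments of an orbit, transported by the semigroup.\<close>

lemma C0_orbit_diff:
  assumes P: "C0_semigroup N P" and u: "u \<in> L2 N" and t: "t \<ge> 0"
  obtains M where "M \<ge> 0" "\<And>x y. x \<ge> 0 \<Longrightarrow> y \<ge> 0 \<Longrightarrow>
    L2_norm N (\<lambda>j z. P (t + x) u j z - P (t + y) u j z) \<le> M * L2_norm N (\<lambda>j z. P x u j z - P y u j z)"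
proof -
  obtain M where M: "M \<ge> 0" "\<forall>f\<in>L2 N. L2_norm N (P t f) \<le> M * L2_norm N f"
    using C0_semigroup_D(3)[OF P t] by blast
  note inL2 = C0_semigroup_D(1)[OF P]
  have "L2_norm N (\<lambda>j z. P (t + x) u j z - P (t + y) u j z) \<le> M * L2_norm N (\<lambda>j z. P x u j z - P y u j z)"
    if xy: "x \<ge> 0" "y \<ge> 0" for x y
  proof -
    have L: "P x u \<in> L2 N" "P y u \<in> L2 N" "P (t + x) u \<in> L2 N" "P (t + y) u \<in> L2 N"
      using t u xy by (auto intro!: inL2)
    have "AE_eq N (\<lambda>j z. P (t + x) u j z - P (t + y) u j z) (\<lambda>j z. P t (P x u) j z - P t (P y u) j z)"
      using t u xy by (intro AE_eq_diff C0_semigroup_D(5)[OF P])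
    also have "AE_eq N \<dots> (P t (\<lambda>j z. P x u j z - P y u j z))"
      using C0_diff[OF P t L(1,2)] by (rule AE_eq_sym)
    finally (AE_eq_trans) have "L2_norm N (\<lambda>j z. P (t + x) u j z - P (t + y) u j z)
        = L2_norm N (P t (\<lambda>j z. P x u j z - P y u j z))"
      by (rule L2_norm_cong) (intro L2_diff L inL2[OF t])+
    then show ?thesis
      using M(2)[rule_format, OF L2_diff[OF L(1,2)]] by simp
  qed
  then show ?thesis
    using that M(1) by blast
qed

lemma C0_right_continuous:
  assumes P: "C0_semigroup N P" and u: "u \<in> L2 N" and t: "t \<ge> 0"
  shows "((\<lambda>h. L2_norm N (\<lambda>j z. P (t + h) u j z - P t u j z)) \<longlongrightarrow> 0) (at_right 0)"
proof -
  obtain M where M: "M \<ge> 0" "\<And>x y. x \<ge> 0 \<Longrightarrow> y \<ge> 0 \<Longrightarrow>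
    L2_norm N (\<lambda>j z. P (t + x) u j z - P (t + y) u j z) \<le> M * L2_norm N (\<lambda>j z. P x u j z - P y u j z)"
    using C0_orbit_diff[OF P u t] by blast
  have P0: "P 0 u \<in> L2 N"
    by (rule C0_semigroup_D(1)[OF P _ u]) simp
  have eq: "L2_norm N (\<lambda>j z. P h u j z - P 0 u j z) = L2_norm N (\<lambda>j z. P h u j z - u j z)" if "h \<ge> 0" for h
    by (intro L2_norm_cong AE_eq_diff AE_eq_refl C0_semigroup_D(4)[OF P] L2_diff u P0
        C0_semigroup_D(1)[OF P that u])
  have lim: "((\<lambda>h. M * L2_norm N (\<lambda>j z. P h u j z - u j z)) \<longlongrightarrow> 0) (at_right 0)"
    by (rule tendsto_mult_right_zero[OF C0_semigroup_D(6)[OF P u]])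
  show ?thesis
  proof (rule Lim_null_comparison[OF _ lim])
    show "\<forall>\<^sub>F h in at_right 0. norm (L2_norm N (\<lambda>j z. P (t + h) u j z - P t u j z))
        \<le> M * L2_norm N (\<lambda>j z. P h u j z - u j z)"
      using eventually_at_right_less[of "0::real"]
    proof eventually_elim
      case (elim h)
      then show ?case
        using M(2)[of h 0] eq[of h] by (simp add: L2_norm_nonneg)
    qed
  qed
qed

text \<open>A right-continuous orbit has a point of continuity in every interval, by Baire's theorem;
  the semigroup law transports left continuity from there to all later times.  This replaces
  the uniform boundedness principle.\<close>

lemma C0_continuity_point:
  assumes P: "C0_semigroup N P" and u: "u \<in> L2 N" and t: "t > 0"
  obtains r where "0 < r" "r < t"
    "\<And>e. e > 0 \<Longrightarrow> \<exists>d>0. \<forall>x\<ge>0. \<bar>x - r\<bar> < d \<longrightarrow> L2_norm N (\<lambda>j z. P x u j z - P r u j z) < e"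
proof -
  let ?D = "\<lambda>x y. L2_norm N (\<lambda>j z. P x u j z - P y u j z)"
  \<comment> \<open>points where the orbit oscillates by less than \<open>1 / Suc n\<close>; negative \<open>r\<close> qualify vacuously\<close>
  define G where "G = (\<lambda>n. {r. \<exists>d>0. \<forall>x y. \<bar>x - r\<bar> < d \<and> \<bar>y - r\<bar> < d \<and> 0 \<le> x \<and> 0 \<le> y
      \<longrightarrow> ?D x y < 1 / real (Suc n)})"
  have inL2: "P x u \<in> L2 N" if "x \<ge> 0" for x
    by (rule C0_semigroup_D(1)[OF P that u])
  have tri: "?D x y \<le> ?D x r + ?D y r" if "x \<ge> 0" "y \<ge> 0" "r \<ge> 0" for x y r
    using L2_norm_triangle_diff[OF L2_diff[OF inL2[OF that(1)] inL2[OF that(3)]] L2_diff[OF inL2[OF that(2)] inL2[OF that(3)]]]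
    by simp
  have "open (G n)" for n
    unfolding open_dist
  proof
    fix r assume "r \<in> G n"
    then obtain d where d: "d > 0" "\<And>x y. \<bar>x - r\<bar> < d \<Longrightarrow> \<bar>y - r\<bar> < d \<Longrightarrow> 0 \<le> x \<Longrightarrow> 0 \<le> y
      \<Longrightarrow> ?D x y < 1 / real (Suc n)"
      by (auto simp: G_def)
    have "r' \<in> G n" if "dist r' r < d / 2" for r'
    proof -
      have "?D x y < 1 / real (Suc n)" if xy: "\<bar>x - r'\<bar> < d / 2" "\<bar>y - r'\<bar> < d / 2" "0 \<le> x" "0 \<le> y" for x y
        using xy \<open>dist r' r < d / 2\<close> unfolding dist_real_def by (intro d(2)) linarith+
      then show ?thesis
        unfolding G_def using d(1) by (intro CollectI exI[of _ "d / 2"]) auto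
    qed
    then show "\<exists>e>0. \<forall>r'. dist r' r < e \<longrightarrow> r' \<in> G n"
      using d(1) by (intro exI[of _ "d / 2"]) auto
  qed
  moreover have "UNIV \<subseteq> closure (G n)" for n
  proof (clarsimp simp: closure_approachable)
    fix r e :: real assume "e > 0"
    show "\<exists>r'\<in>G n. dist r' r < e"
    proof (cases "r < 0")
      case True
      have "r \<in> G n"
        unfolding G_def using True by (intro CollectI exI[of _ "- r"] conjI allI impI) auto
      then show ?thesis
        using \<open>e > 0\<close> by (intro bexI[of _ r]) auto
    next
      case False
      have "\<forall>\<^sub>F h in at_right 0. dist (?D (r + h) r) 0 < 1 / (2 * real (Suc n))"
        using False by (intro tendstoD[OF C0_right_continuous[OF P u]]) auto
      then obtain b where b: "b > 0" "\<And>h. 0 < h \<Longrightarrow> h < b \<Longrightarrow> ?D (r + h) r < 1 / (2 * real (Suc n))"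
        by (auto simp: eventually_at_right_field dist_real_def L2_norm_nonneg)
      define m where "m = min b e / 2"
      have m: "m > 0" "2 * m \<le> b" "m < e"
        using b(1) \<open>e > 0\<close> by (auto simp: m_def)
      have "r + m \<in> G n"
        unfolding G_def
      proof (intro CollectI exI[of _ m] conjI allI impI m)
        fix x y assume xy: "\<bar>x - (r + m)\<bar> < m \<and> \<bar>y - (r + m)\<bar> < m \<and> 0 \<le> x \<and> 0 \<le> y"
        then have "0 < x - r" "x - r < b" "0 < y - r" "y - r < b"
          using m by (auto simp: abs_if split: if_splits)
        then have "?D x r < 1 / (2 * real (Suc n))" "?D y r < 1 / (2 * real (Suc n))"
          using b(2)[of "x - r"] b(2)[of "y - r"] by simp_all
        then show "?D x y < 1 / real (Suc n)"
        proof -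
          have "?D x y < 1 / (2 * real (Suc n)) + 1 / (2 * real (Suc n))"
            using tri[of x y r] xy False \<open>?D x r < _\<close> \<open>?D y r < _\<close> by linarith
          also have "\<dots> = 1 / real (Suc n)"
            by (simp add: field_simps)
          finally show ?thesis .
        qed
      qed
      then show ?thesis
        using m by (intro bexI[of _ "r + m"]) (auto simp: dist_real_def)
    qed
  qed
  ultimately have "UNIV \<subseteq> closure (\<Inter>(range G))"
    by (intro Baire) auto
  then have "t / 2 \<in> closure (\<Inter>(range G))"
    by blast
  then obtain r where r: "r \<in> \<Inter>(range G)" "dist r (t / 2) < t / 2"
    using t unfolding closure_approachable by (metis half_gt_zero)
  have r0: "0 < r" "r < t"
    using r(2) by (auto simp: dist_real_def abs_if split: if_splits)
  have "\<exists>d>0. \<forall>x\<ge>0. \<bar>x - r\<bar> < d \<longrightarrow> ?D x r < e" if "e > 0" for e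
  proof -
    obtain n where n: "1 / real (Suc n) < e"
      using nat_approx_posE[OF \<open>e > 0\<close>] by blast
    have "r \<in> G n"
      using r(1) by blast
    then obtain d where "d > 0" and d: "\<And>x y. \<bar>x - r\<bar> < d \<Longrightarrow> \<bar>y - r\<bar> < d \<Longrightarrow> 0 \<le> x \<Longrightarrow> 0 \<le> y
      \<Longrightarrow> ?D x y < 1 / real (Suc n)"
      by (auto simp: G_def)
    have "?D x r < e" if "x \<ge> 0" "\<bar>x - r\<bar> < d" for x
      using d[of x r] that r0 n \<open>d > 0\<close> by simp
    then show ?thesis
      using \<open>d > 0\<close> by (intro exI[of _ d]) simp
  qed
  with r0 show ?thesis
    using that by blast
qed

lemma C0_left_continuous:
  assumes P: "C0_semigroup N P" and u: "u \<in> L2 N" and t: "t > 0"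
  shows "((\<lambda>s. L2_norm N (\<lambda>j z. P s u j z - P t u j z)) \<longlongrightarrow> 0) (at_left t)"
proof (rule tendstoI)
  fix e :: real assume "e > 0"
  obtain r where r: "0 < r" "r < t"
    "\<And>e. e > 0 \<Longrightarrow> \<exists>d>0. \<forall>x\<ge>0. \<bar>x - r\<bar> < d \<longrightarrow> L2_norm N (\<lambda>j z. P x u j z - P r u j z) < e"
    using C0_continuity_point[OF P u t] by blast
  obtain M where M: "M \<ge> 0" "\<And>x y. x \<ge> 0 \<Longrightarrow> y \<ge> 0 \<Longrightarrow>
    L2_norm N (\<lambda>j z. P ((t - r) + x) u j z - P ((t - r) + y) u j z) \<le> M * L2_norm N (\<lambda>j z. P x u j z - P y u j z)"
    by (rule C0_orbit_diff[OF P u, of "t - r"]) (use r(2) in auto)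
  have "e / (M + 1) > 0"
    using M(1) \<open>e > 0\<close> by simp
  then obtain d where d: "d > 0" "\<And>x. x \<ge> 0 \<Longrightarrow> \<bar>x - r\<bar> < d \<Longrightarrow> L2_norm N (\<lambda>j z. P x u j z - P r u j z) < e / (M + 1)"
    using r(3) by blast
  define b where "b = max (t - d) (t - r)"
  have "b < t"
    using d(1) r(1) by (auto simp: b_def)
  have "dist (L2_norm N (\<lambda>j z. P s u j z - P t u j z)) 0 < e" if "b < s" "s < t" for s
  proof -
    let ?x = "s - (t - r)"
    have x: "?x \<ge> 0" "\<bar>?x - r\<bar> < d"
      using that by (auto simp: b_def)
    have "L2_norm N (\<lambda>j z. P s u j z - P t u j z) \<le> M * L2_norm N (\<lambda>j z. P ?x u j z - P r u j z)"
      using M(2)[of ?x r] x(1) r(1) by simp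
    also have "\<dots> \<le> M * (e / (M + 1))"
      using d(2)[OF x] M(1) by (intro mult_left_mono) auto
    also have "\<dots> < e"
      using M(1) \<open>e > 0\<close> by (simp add: field_simps)
    finally show ?thesis
      by (simp add: L2_norm_nonneg)
  qed
  then show "\<forall>\<^sub>F s in at_left t. dist (L2_norm N (\<lambda>j z. P s u j z - P t u j z)) 0 < e"
    using \<open>b < t\<close> unfolding eventually_at_left_field by blast
qed

lemma generator_L2: "infinitesimal_generator N P u w \<Longrightarrow> u \<in> L2 N \<and> w \<in> L2 N"
  by (simp add: infinitesimal_generator_def)

lemma L2_difference_quotient:
  assumes "f \<in> L2 N" "g \<in> L2 N" "w \<in> L2 N"
  shows "(\<lambda>j x. (f j x - g j x) / t - w j x) \<in> L2 N"
  using L2_diff[OF L2_cmult[OF L2_diff[OF assms(1,2)], of "1 / t"] assms(3)] by simp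

lemma generator_lin:
  assumes P: "C0_semigroup N P" and 1: "infinitesimal_generator N P u w" and 2: "infinitesimal_generator N P u' w'"
  shows "infinitesimal_generator N P (\<lambda>j x. a * u j x + b * u' j x) (\<lambda>j x. a * w j x + b * w' j x)"
  unfolding infinitesimal_generator_def
proof (intro conjI)
  have L: "u \<in> L2 N" "w \<in> L2 N" "u' \<in> L2 N" "w' \<in> L2 N"
    using 1 2 by (auto simp: infinitesimal_generator_def)
  let ?u = "\<lambda>j x. a * u j x + b * u' j x" and ?w = "\<lambda>j x. a * w j x + b * w' j x"
  show uL: "?u \<in> L2 N" and wL: "?w \<in> L2 N"
    by (intro L2_lin L)+
  let ?q = "\<lambda>t j x. (P t u j x - u j x) / t - w j x" and ?q' = "\<lambda>t j x. (P t u' j x - u' j x) / t - w' j x"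
  have "((\<lambda>t. \<bar>a\<bar> * L2_norm N (?q t) + \<bar>b\<bar> * L2_norm N (?q' t)) \<longlongrightarrow> \<bar>a\<bar> * 0 + \<bar>b\<bar> * 0) (at_right 0)"
    using 1 2 by (intro tendsto_intros) (auto simp: infinitesimal_generator_def)
  then have lim: "((\<lambda>t. \<bar>a\<bar> * L2_norm N (?q t) + \<bar>b\<bar> * L2_norm N (?q' t)) \<longlongrightarrow> 0) (at_right 0)"
    by simp
  show "((\<lambda>t. L2_norm N (\<lambda>j x. (P t ?u j x - ?u j x) / t - ?w j x)) \<longlongrightarrow> 0) (at_right 0)"
  proof (rule Lim_null_comparison[OF _ lim])
    show "\<forall>\<^sub>F t in at_right 0. norm (L2_norm N (\<lambda>j x. (P t ?u j x - ?u j x) / t - ?w j x))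
        \<le> \<bar>a\<bar> * L2_norm N (?q t) + \<bar>b\<bar> * L2_norm N (?q' t)"
      using eventually_at_right_less[of "0::real"]
    proof eventually_elim
      case (elim t)
      then have Pt: "P t u \<in> L2 N" "P t u' \<in> L2 N" "P t ?u \<in> L2 N"
        by (auto intro!: C0_semigroup_D(1)[OF P] L uL)
      have q: "?q t \<in> L2 N" "?q' t \<in> L2 N"
        by (intro L2_difference_quotient L Pt)+
      have "AE_eq N (P t ?u) (\<lambda>j x. a * P t u j x + b * P t u' j x)"
        using elim by (intro C0_semigroup_D(2)[OF P] L) simp
      then have "AE_eq N (\<lambda>j x. (P t ?u j x - ?u j x) / t - ?w j x) (\<lambda>j x. a * ?q t j x + b * ?q' t j x)"
        unfolding AE_eq_def
      proof (intro allI impI)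
        fix j assume *: "\<forall>j<N. AE x in leg. P t ?u j x = a * P t u j x + b * P t u' j x" and "j < N"
        then have "AE x in leg. P t ?u j x = a * P t u j x + b * P t u' j x"
          by blast
        then show "AE x in leg. (P t ?u j x - ?u j x) / t - ?w j x = a * ?q t j x + b * ?q' t j x"
          by eventually_elim (use elim in \<open>simp add: field_simps\<close>)
      qed
      then have "L2_norm N (\<lambda>j x. (P t ?u j x - ?u j x) / t - ?w j x) = L2_norm N (\<lambda>j x. a * ?q t j x + b * ?q' t j x)"
        by (intro L2_norm_cong L2_difference_quotient Pt uL wL L2_lin q)
      also have "\<dots> \<le> L2_norm N (\<lambda>j x. a * ?q t j x) + L2_norm N (\<lambda>j x. b * ?q' t j x)"
        by (intro L2_norm_triangle L2_cmult q)
      finally show ?case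
        by (simp add: L2_norm_cmult[OF q(1)] L2_norm_cmult[OF q(2)] L2_norm_nonneg)
    qed
  qed
qed

lemma generator_cong:
  assumes P: "C0_semigroup N P" and G: "infinitesimal_generator N P u w"
    and u: "AE_eq N u u'" "u' \<in> L2 N" and w: "AE_eq N w w'" "w' \<in> L2 N"
  shows "infinitesimal_generator N P u' w'"
  unfolding infinitesimal_generator_def
proof (intro conjI u w)
  have L: "u \<in> L2 N" "w \<in> L2 N"
    using G by (auto simp: infinitesimal_generator_def)
  have "((\<lambda>t. L2_norm N (\<lambda>j x. (P t u j x - u j x) / t - w j x)) \<longlongrightarrow> 0) (at_right 0)"
    using G by (simp add: infinitesimal_generator_def)
  then show "((\<lambda>t. L2_norm N (\<lambda>j x. (P t u' j x - u' j x) / t - w' j x)) \<longlongrightarrow> 0) (at_right 0)"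
  proof (rule Lim_transform_eventually)
    show "\<forall>\<^sub>F t in at_right 0. L2_norm N (\<lambda>j x. (P t u j x - u j x) / t - w j x)
        = L2_norm N (\<lambda>j x. (P t u' j x - u' j x) / t - w' j x)"
      using eventually_at_right_less[of "0::real"]
    proof eventually_elim
      case (elim t)
      have "AE_eq N (P t u) (P t u')"
        using elim by (intro C0_cong[OF P] L u) simp
      then have "AE_eq N (\<lambda>j x. (P t u j x - u j x) / t - w j x) (\<lambda>j x. (P t u' j x - u' j x) / t - w' j x)"
        unfolding AE_eq_def
      proof (intro allI impI)
        fix j assume *: "\<forall>j<N. AE x in leg. P t u j x = P t u' j x" and "j < N"
        then have "AE x in leg. P t u j x = P t u' j x" "AE x in leg. u j x = u' j x" "AE x in leg. w j x = w' j x"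
          using u w by (auto simp: AE_eq_def)
        then show "AE x in leg. (P t u j x - u j x) / t - w j x = (P t u' j x - u' j x) / t - w' j x"
          by eventually_elim simp
      qed
      then show ?case
        using elim by (intro L2_norm_cong L2_difference_quotient L u w C0_semigroup_D(1)[OF P]) auto
    qed
  qed
qed

lemma generator_dissipative:
  assumes P: "C0_semigroup N P" and contr: "\<And>t f. t \<ge> 0 \<Longrightarrow> f \<in> L2 N \<Longrightarrow> L2_norm N (P t f) \<le> L2_norm N f"
    and G: "infinitesimal_generator N P u w"
  shows "L2_inner N w u \<le> 0"
proof -
  have L: "u \<in> L2 N" "w \<in> L2 N"
    using G by (auto simp: infinitesimal_generator_def)
  let ?q = "\<lambda>t j x. (P t u j x - u j x) / t - w j x"
  have lim: "((\<lambda>t. L2_norm N (?q t) * L2_norm N u) \<longlongrightarrow> 0) (at_right 0)"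
    using G by (intro tendsto_mult_left_zero) (simp add: infinitesimal_generator_def)
  have "\<forall>\<^sub>F t in at_right 0. L2_inner N w u \<le> L2_norm N (?q t) * L2_norm N u"
    using eventually_at_right_less[of "0::real"]
  proof eventually_elim
    case (elim t)
    have Pt: "P t u \<in> L2 N"
      using elim by (intro C0_semigroup_D(1)[OF P] L) simp
    have q: "?q t \<in> L2 N"
      by (intro L2_difference_quotient L Pt)
    let ?s = "\<lambda>j x. 1 / t * P t u j x + (- 1 / t) * u j x"
    have s: "?s \<in> L2 N"
      by (intro L2_lin L Pt)
    have "L2_inner N (P t u) u \<le> L2_norm N (P t u) * L2_norm N u"
      using L2_Cauchy_Schwarz[OF Pt L(1)] by linarith
    also have "\<dots> \<le> L2_norm N u * L2_norm N u"
      using elim by (intro mult_right_mono contr L L2_norm_nonneg) simp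
    also have "\<dots> = L2_inner N u u"
      using L2_norm_square[of N u] by (simp add: power2_eq_square)
    finally have "1 / t * L2_inner N (P t u) u + (- 1 / t) * L2_inner N u u \<le> 0"
      using elim by (simp add: field_simps)
    then have s_le: "L2_inner N ?s u \<le> 0"
      using L2_inner_lin_left[OF Pt L(1) L(1), of "1 / t" "- 1 / t"] by simp
    have "w = (\<lambda>j x. 1 * ?s j x + (-1) * ?q t j x)"
      by (intro ext) (simp add: diff_divide_distrib)
    then have "L2_inner N w u = L2_inner N ?s u - L2_inner N (?q t) u"
      using L2_inner_lin_left[OF s q L(1), of 1 "-1"] by simp
    also have "\<dots> \<le> L2_norm N (?q t) * L2_norm N u"
      using s_le L2_Cauchy_Schwarz[OF q L(1)] by linarith
    finally show ?case .
  qed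
  from tendsto_lowerbound[OF lim this] show ?thesis
    by simp
qed

text \<open>A dissipative operator \<open>A\<close> (given by its graph) for which $1 - A$ has the right inverse
  $R$ is determined by $R$, because $1 - A$ is injective.  Applied to the generator of the explicit
  semigroup and to the Laplacian, it identifies the two.\<close>

lemma dissipative_resolvent:
  assumes L2: "\<And>u w. A u w \<Longrightarrow> u \<in> L2 N \<and> w \<in> L2 N"
    and lin: "\<And>u w u' w' a b. A u w \<Longrightarrow> A u' w' \<Longrightarrow> A (\<lambda>j x. a * u j x + b * u' j x) (\<lambda>j x. a * w j x + b * w' j x)"
    and cong: "\<And>u w u' w'. A u w \<Longrightarrow> AE_eq N u u' \<Longrightarrow> u' \<in> L2 N \<Longrightarrow> AE_eq N w w' \<Longrightarrow> w' \<in> L2 N \<Longrightarrow> A u' w'"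
    and diss: "\<And>u w. A u w \<Longrightarrow> L2_inner N w u \<le> 0"
    and R: "\<And>f. f \<in> L2 N \<Longrightarrow> A (R f) (\<lambda>j x. R f j x - f j x)"
  shows "A u w \<longleftrightarrow> u \<in> L2 N \<and> w \<in> L2 N \<and> AE_eq N (R (\<lambda>j x. u j x - w j x)) u"
proof
  let ?f = "\<lambda>j x. u j x - w j x"
  assume A: "A u w"
  then have L: "u \<in> L2 N" "w \<in> L2 N"
    using L2 by auto
  then have f: "?f \<in> L2 N"
    by (rule L2_diff)
  let ?z = "\<lambda>j x. R ?f j x - u j x"
  have "A (\<lambda>j x. 1 * R ?f j x + (-1) * u j x) (\<lambda>j x. 1 * (R ?f j x - ?f j x) + (-1) * w j x)"
    by (rule lin[OF R[OF f] A])
  then have Az: "A ?z ?z"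
    by simp
  then have z: "?z \<in> L2 N"
    using L2 by auto
  have "L2_inner N ?z ?z = 0"
    using diss[OF Az] L2_inner_nonneg[of N ?z] by simp
  then have "AE_eq N ?z (\<lambda>j x. 0)"
    by (intro L2_norm_zero_imp z) (simp add: L2_norm_def)
  then show "u \<in> L2 N \<and> w \<in> L2 N \<and> AE_eq N (R ?f) u"
    using L by (simp add: AE_eq_zero_diff)
next
  let ?f = "\<lambda>j x. u j x - w j x"
  assume *: "u \<in> L2 N \<and> w \<in> L2 N \<and> AE_eq N (R ?f) u"
  then have f: "?f \<in> L2 N"
    by (auto intro: L2_diff)
  have "AE_eq N (\<lambda>j x. R ?f j x - ?f j x) (\<lambda>j x. u j x - ?f j x)"
    using * by (intro AE_eq_diff AE_eq_refl) auto
  then have "AE_eq N (\<lambda>j x. R ?f j x - ?f j x) w"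
    by simp
  then show "A u w"
    using * cong[OF R[OF f]] by blast
qed

theorem heat_sg_generator:
  assumes N: "N > 0"
  shows "infinitesimal_generator N (heat_sg N) u w \<longleftrightarrow> is_Laplacian N u w"
proof -
  note P = heat_sg_C0[OF N]
  have "infinitesimal_generator N (heat_sg N) u w \<longleftrightarrow>
      u \<in> L2 N \<and> w \<in> L2 N \<and> AE_eq N (resolvent N (\<lambda>j x. u j x - w j x)) u"
  proof (rule dissipative_resolvent[of "infinitesimal_generator N (heat_sg N)"])
    show "L2_inner N w u \<le> 0" if "infinitesimal_generator N (heat_sg N) u w" for u w
      by (rule generator_dissipative[OF P heat_sg_contraction[OF N] that])
    show "infinitesimal_generator N (heat_sg N) (resolvent N f) (\<lambda>j x. resolvent N f j x - f j x)" if "f \<in> L2 N" for f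
      by (rule resolvent_generator[OF N that])
  qed (fact generator_L2 generator_lin[OF P] generator_cong[OF P])+
  moreover have "is_Laplacian N u w \<longleftrightarrow>
      u \<in> L2 N \<and> w \<in> L2 N \<and> AE_eq N (resolvent N (\<lambda>j x. u j x - w j x)) u"
    by (rule dissipative_resolvent[of "is_Laplacian N"])
      (fact is_Laplacian_L2 is_Laplacian_lin is_Laplacian_cong is_Laplacian_dissipative
        resolvent_Laplacian[OF N])+
  ultimately show ?thesis
    by simp
qed

section \<open>Uniqueness of the semigroup\<close>

lemma generator_invariant:
  assumes P: "C0_semigroup N P" and G: "infinitesimal_generator N P u w" and t: "t \<ge> 0"
  shows "infinitesimal_generator N P (P t u) (P t w)"
  unfolding infinitesimal_generator_def
proof (intro conjI)
  have L: "u \<in> L2 N" "w \<in> L2 N"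
    using G by (auto simp: infinitesimal_generator_def)
  show uL: "P t u \<in> L2 N" and wL: "P t w \<in> L2 N"
    by (intro C0_semigroup_D(1)[OF P t] L)+
  obtain M where M: "M \<ge> 0" "\<forall>f\<in>L2 N. L2_norm N (P t f) \<le> M * L2_norm N f"
    using C0_semigroup_D(3)[OF P t] by blast
  let ?q = "\<lambda>h j x. (P h u j x - u j x) / h - w j x"
  have lim: "((\<lambda>h. M * L2_norm N (?q h)) \<longlongrightarrow> 0) (at_right 0)"
    using G by (intro tendsto_mult_right_zero) (simp add: infinitesimal_generator_def)
  show "((\<lambda>h. L2_norm N (\<lambda>j x. (P h (P t u) j x - P t u j x) / h - P t w j x)) \<longlongrightarrow> 0) (at_right 0)"
  proof (rule Lim_null_comparison[OF _ lim])
    show "\<forall>\<^sub>F h in at_right 0. norm (L2_norm N (\<lambda>j x. (P h (P t u) j x - P t u j x) / h - P t w j x))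
        \<le> M * L2_norm N (?q h)"
      using eventually_at_right_less[of "0::real"]
    proof eventually_elim
      case (elim h)
      then have h: "h \<ge> 0"
        by simp
      have Ph: "P h u \<in> L2 N" "P h (P t u) \<in> L2 N" "P t (P h u) \<in> L2 N"
        by (intro C0_semigroup_D(1)[OF P] h t L)+
      let ?s = "\<lambda>j x. 1 / h * P h u j x + (- 1 / h) * u j x"
      have s: "?s \<in> L2 N"
        by (intro L2_lin Ph L)
      have q_eq: "?q h = (\<lambda>j x. ?s j x - w j x)"
        by (intro ext) (simp add: diff_divide_distrib)
      have q: "?q h \<in> L2 N"
        by (intro L2_difference_quotient L Ph)
      have comm: "AE_eq N (P h (P t u)) (P t (P h u))"
        using AE_eq_trans[OF AE_eq_sym[OF C0_semigroup_D(5)[OF P h t L(1)]]] C0_semigroup_D(5)[OF P t h L(1)]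
        by (simp add: add.commute)
      have lin: "AE_eq N (P t ?s) (\<lambda>j x. 1 / h * P t (P h u) j x + (- 1 / h) * P t u j x)"
        by (intro C0_semigroup_D(2)[OF P] t Ph L)
      have dif: "AE_eq N (P t (?q h)) (\<lambda>j x. P t ?s j x - P t w j x)"
        unfolding q_eq by (intro C0_diff[OF P] t s L)
      have "AE_eq N (\<lambda>j x. (P h (P t u) j x - P t u j x) / h - P t w j x) (P t (?q h))"
        unfolding AE_eq_def
      proof (intro allI impI)
        fix j assume j: "j < N"
        have "AE x in leg. P h (P t u) j x = P t (P h u) j x"
          using comm j by (simp add: AE_eq_def)
        moreover have "AE x in leg. P t ?s j x = 1 / h * P t (P h u) j x + (- 1 / h) * P t u j x"
          using lin j unfolding AE_eq_def by blast
        moreover have "AE x in leg. P t (?q h) j x = P t ?s j x - P t w j x"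
          using dif j unfolding AE_eq_def by blast
        ultimately show "AE x in leg. (P h (P t u) j x - P t u j x) / h - P t w j x = P t (?q h) j x"
          by eventually_elim (simp add: diff_divide_distrib)
      qed
      then have "L2_norm N (\<lambda>j x. (P h (P t u) j x - P t u j x) / h - P t w j x) = L2_norm N (P t (?q h))"
        by (intro L2_norm_cong L2_difference_quotient C0_semigroup_D(1)[OF P] h t uL wL Ph q)
      then show ?case
        using M(2)[rule_format, OF q] by (simp add: L2_norm_nonneg)
    qed
  qed
qed

lemma right_Dini_nonincreasing:
  fixes F :: "real \<Rightarrow> real"
  assumes T: "T > 0"
    and right: "\<And>t e. 0 \<le> t \<Longrightarrow> t < T \<Longrightarrow> e > 0 \<Longrightarrow> \<forall>\<^sub>F h in at_right 0. F (t + h) \<le> F t + e * h"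
    and left: "\<And>t. 0 < t \<Longrightarrow> t \<le> T \<Longrightarrow> (F \<longlongrightarrow> F t) (at_left t)"
  shows "F T \<le> F 0"
proof -
  have *: "F T \<le> F 0 + e * T" if e: "e > 0" for e
  proof -
    define A where "A = {t. 0 \<le> t \<and> t \<le> T \<and> (\<forall>s. 0 \<le> s \<and> s \<le> t \<longrightarrow> F s \<le> F 0 + e * s)}"
    define m where "m = Sup A"
    have A0: "0 \<in> A"
      using T by (auto simp: A_def)
    have bdd: "bdd_above A"
      by (auto simp: A_def bdd_above_def)
    have m0: "0 \<le> m"
      unfolding m_def by (rule cSup_upper[OF A0 bdd])
    have mT: "m \<le> T"
      unfolding m_def using A0 by (intro cSup_least) (auto simp: A_def)
    have below: "F s \<le> F 0 + e * s" if "0 \<le> s" "s < m" for s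
    proof -
      have "\<exists>t\<in>A. s < t"
        using less_cSup_iff[of A s] that A0 bdd unfolding m_def by blast
      then show ?thesis
        using that by (auto simp: A_def)
    qed
    have Fm: "F m \<le> F 0 + e * m"
    proof (cases "m = 0")
      case False
      then have "0 < m"
        using m0 by simp
      have "((\<lambda>s. F 0 + e * s) \<longlongrightarrow> F 0 + e * m) (at_left m)"
        by (intro tendsto_intros)
      moreover have "\<forall>\<^sub>F s in at_left m. F s \<le> F 0 + e * s"
        unfolding eventually_at_left_field using below \<open>0 < m\<close> by (intro exI[of _ 0]) auto
      ultimately show ?thesis
        using left[OF \<open>0 < m\<close> mT] by (intro tendsto_le[of "at_left m"]) auto
    qed simp
    have upto: "F s \<le> F 0 + e * s" if "0 \<le> s" "s \<le> m" for s
      using below[of s] Fm that by (cases "s = m") auto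
    have "m = T"
    proof (rule ccontr)
      assume "m \<noteq> T"
      then have "m < T"
        using mT by simp
      then obtain b where b: "b > 0" "\<And>h. 0 < h \<Longrightarrow> h < b \<Longrightarrow> F (m + h) \<le> F m + e * h"
        using right[OF m0 _ e] by (auto simp: eventually_at_right_field)
      define k where "k = min (b / 2) (T - m)"
      have k: "0 < k" "k < b" "m + k \<le> T"
        using b(1) \<open>m < T\<close> by (auto simp: k_def)
      have "F s \<le> F 0 + e * s" if "0 \<le> s" "s \<le> m + k" for s
      proof (cases "s \<le> m")
        case False
        then have "F s \<le> F m + e * (s - m)"
          using b(2)[of "s - m"] that k by auto
        then show ?thesis
          using Fm by (simp add: algebra_simps)
      qed (use upto that in auto)
      then have "m + k \<in> A"
        using m0 k by (auto simp: A_def)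
      then have "m + k \<le> m"
        unfolding m_def using bdd by (rule cSup_upper)
      then show False
        using k by simp
    qed
    then show ?thesis
      using Fm by simp
  qed
  show ?thesis
  proof (rule field_le_epsilon)
    fix e :: real assume "e > 0"
    then show "F T \<le> F 0 + e"
      using *[of "e / T"] T by simp
  qed
qed

text \<open>On the domain of the Laplacian, the difference of two orbits with the same start has
  nonincreasing norm, because the Laplacian is dissipative.\<close>

lemma semigroup_unique_on_domain:
  assumes P: "C0_semigroup N P" and S: "C0_semigroup N S"
    and GP: "\<And>u w. infinitesimal_generator N P u w \<longleftrightarrow> is_Laplacian N u w"
    and GS: "\<And>u w. infinitesimal_generator N S u w \<longleftrightarrow> is_Laplacian N u w"
    and u: "is_Laplacian N u w" and T: "T \<ge> 0"
  shows "AE_eq N (P T u) (S T u)"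
proof (cases "T = 0")
  case True
  have "u \<in> L2 N"
    using is_Laplacian_L2[OF u] by simp
  then show ?thesis
    using AE_eq_trans[OF C0_semigroup_D(4)[OF P] AE_eq_sym[OF C0_semigroup_D(4)[OF S]]] True by simp
next
  case False
  then have T: "T > 0"
    using T by simp
  have L: "u \<in> L2 N" "w \<in> L2 N"
    using is_Laplacian_L2[OF u] by auto
  define z where "z = (\<lambda>t j x. P t u j x - S t u j x)"
  have PL: "P t f \<in> L2 N" "S t f \<in> L2 N" if "t \<ge> 0" "f \<in> L2 N" for t f
    using that by (auto intro: C0_semigroup_D(1)[OF P] C0_semigroup_D(1)[OF S])
  have zL: "z t \<in> L2 N" if "t \<ge> 0" for t
    unfolding z_def using that by (intro L2_diff PL L)
  let ?F = "\<lambda>t. (L2_norm N (z t))\<^sup>2"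
  have "?F T \<le> ?F 0"
  proof (rule right_Dini_nonincreasing[OF T])
    fix t e :: real assume t: "0 \<le> t" "t < T" and e: "e > 0"
    define q where "q = (\<lambda>j x. P t w j x - S t w j x)"
    have gP: "infinitesimal_generator N P (P t u) (P t w)"
      using generator_invariant[OF P _ t(1)] GP u by blast
    have gS: "infinitesimal_generator N S (S t u) (S t w)"
      using generator_invariant[OF S _ t(1)] GS u by blast
    have "is_Laplacian N (\<lambda>j x. 1 * P t u j x + (-1) * S t u j x) (\<lambda>j x. 1 * P t w j x + (-1) * S t w j x)"
      using gP gS GP GS by (intro is_Laplacian_lin) auto
    then have zq: "is_Laplacian N (z t) q"
      by (simp add: z_def q_def)
    then have qL: "q \<in> L2 N"
      using is_Laplacian_L2 by blast
    note zt = zL[OF t(1)]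
    let ?p = "\<lambda>h j x. (P h (P t u) j x - P t u j x) / h - P t w j x"
    let ?s = "\<lambda>h j x. (S h (S t u) j x - S t u j x) / h - S t w j x"
    let ?r = "\<lambda>h. L2_norm N (?p h) + L2_norm N (?s h)"
    have r0: "(?r \<longlongrightarrow> 0 + 0) (at_right 0)"
      using gP gS by (intro tendsto_add) (auto simp: infinitesimal_generator_def)
    have "((\<lambda>h. 2 * L2_norm N (z t) * ?r h + h * (L2_norm N q + ?r h)\<^sup>2)
        \<longlongrightarrow> 2 * L2_norm N (z t) * (0 + 0) + 0 * (L2_norm N q + (0 + 0))\<^sup>2) (at_right 0)"
      by (intro tendsto_intros r0)
    then have "((\<lambda>h. 2 * L2_norm N (z t) * ?r h + h * (L2_norm N q + ?r h)\<^sup>2) \<longlongrightarrow> 0) (at_right 0)"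
      by simp
    then have "\<forall>\<^sub>F h in at_right 0. 2 * L2_norm N (z t) * ?r h + h * (L2_norm N q + ?r h)\<^sup>2 < e"
      using e by (rule order_tendstoD)
    then show "\<forall>\<^sub>F h in at_right 0. ?F (t + h) \<le> ?F t + e * h"
      using eventually_at_right_less[of "0::real"]
    proof eventually_elim
      case (elim h)
      then have h: "h \<ge> 0" "h > 0"
        by auto
      have pL: "?p h \<in> L2 N" "?s h \<in> L2 N"
        using h t by (intro L2_difference_quotient PL L; simp)+
      define \<rho> where "\<rho> = (\<lambda>j x. ?p h j x - ?s h j x)"
      have \<rho>L: "\<rho> \<in> L2 N"
        unfolding \<rho>_def by (intro L2_diff pL)
      have \<rho>_le: "L2_norm N \<rho> \<le> ?r h"
        unfolding \<rho>_def by (rule L2_norm_triangle_diff[OF pL])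
      define y where "y = (\<lambda>j x. q j x + \<rho> j x)"
      have yL: "y \<in> L2 N"
        unfolding y_def by (intro L2_add qL \<rho>L)
      have "AE_eq N (P (h + t) u) (P h (P t u))" "AE_eq N (S (h + t) u) (S h (S t u))"
        using h t L by (auto intro: C0_semigroup_D(5)[OF P] C0_semigroup_D(5)[OF S])
      then have "AE_eq N (z (t + h)) (\<lambda>j x. P h (P t u) j x - S h (S t u) j x)"
        unfolding z_def by (intro AE_eq_diff) (auto simp: add.commute)
      also have "(\<lambda>j x. P h (P t u) j x - S h (S t u) j x) = (\<lambda>j x. 1 * z t j x + h * y j x)"
        using h by (intro ext) (simp add: z_def y_def q_def \<rho>_def field_simps)
      finally have eq: "AE_eq N (z (t + h)) (\<lambda>j x. 1 * z t j x + h * y j x)" .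
      have "z (t + h) \<in> L2 N"
        using h t by (intro zL) simp
      then have "?F (t + h) = (L2_norm N (\<lambda>j x. 1 * z t j x + h * y j x))\<^sup>2"
        by (simp only: L2_norm_cong[OF eq _ L2_lin[OF zt yL]])
      also have "\<dots> = ?F t + 2 * h * L2_inner N (z t) y + h\<^sup>2 * (L2_norm N y)\<^sup>2"
        unfolding L2_norm_square L2_inner_square_lin[OF zt yL] by simp
      finally have expand: "?F (t + h) = ?F t + 2 * h * L2_inner N (z t) y + h\<^sup>2 * (L2_norm N y)\<^sup>2" .
      have "L2_inner N (z t) y = L2_inner N (z t) q + L2_inner N (z t) \<rho>"
        using L2_inner_lin_right[OF qL \<rho>L zt, of 1 1] by (simp add: y_def)
      also have "\<dots> \<le> 0 + L2_norm N (z t) * L2_norm N \<rho>"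
        using is_Laplacian_dissipative[OF zq] L2_inner_commute[of N q "z t"] L2_Cauchy_Schwarz[OF zt \<rho>L]
        by linarith
      also have "\<dots> \<le> L2_norm N (z t) * ?r h"
        using mult_left_mono[OF \<rho>_le L2_norm_nonneg] by simp
      finally have "2 * h * L2_inner N (z t) y \<le> 2 * h * (L2_norm N (z t) * ?r h)"
        using h by (intro mult_left_mono) auto
      moreover have "L2_norm N y \<le> L2_norm N q + ?r h"
        using L2_norm_triangle[OF qL \<rho>L] \<rho>_le unfolding y_def by linarith
      then have "h\<^sup>2 * (L2_norm N y)\<^sup>2 \<le> h\<^sup>2 * (L2_norm N q + ?r h)\<^sup>2"
        by (intro mult_left_mono power_mono L2_norm_nonneg) auto
      moreover have "h * (2 * L2_norm N (z t) * ?r h + h * (L2_norm N q + ?r h)\<^sup>2) \<le> h * e"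
        using elim(1) h by (intro mult_left_mono) auto
      then have "2 * h * (L2_norm N (z t) * ?r h) + h\<^sup>2 * (L2_norm N q + ?r h)\<^sup>2 \<le> e * h"
        unfolding power2_eq_square[of h] distrib_left by (simp only: mult_ac)
      ultimately show ?case
        unfolding expand by linarith
    qed
  next
    fix t assume t: "0 < t" "t \<le> T"
    let ?d = "\<lambda>s. L2_norm N (\<lambda>j x. P s u j x - P t u j x) + L2_norm N (\<lambda>j x. S s u j x - S t u j x)"
    have d0: "(?d \<longlongrightarrow> 0 + 0) (at_left t)"
      by (rule tendsto_add[OF C0_left_continuous[OF P L(1) t(1)] C0_left_continuous[OF S L(1) t(1)]])
    then have d0: "(?d \<longlongrightarrow> 0) (at_left t)"
      by simp
    have "((\<lambda>s. L2_norm N (z s) - L2_norm N (z t)) \<longlongrightarrow> 0) (at_left t)"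
    proof (rule Lim_null_comparison[OF _ d0])
      show "\<forall>\<^sub>F s in at_left t. norm (L2_norm N (z s) - L2_norm N (z t)) \<le> ?d s"
        unfolding eventually_at_left_field
      proof (intro exI[of _ 0] conjI t allI impI)
        fix s assume s: "0 < s" "s < t"
        then have zs: "z s \<in> L2 N" "z t \<in> L2 N"
          using t by (auto intro: zL)
        let ?z = "\<lambda>j x. z s j x - z t j x"
        have "L2_norm N ?z \<le> ?d s"
        proof -
          have "?z = (\<lambda>j x. (P s u j x - P t u j x) - (S s u j x - S t u j x))"
            by (intro ext) (simp add: z_def)
          moreover have "P s u \<in> L2 N" "P t u \<in> L2 N" "S s u \<in> L2 N" "S t u \<in> L2 N"
            using s t L by (auto intro: PL)
          ultimately show ?thesis
            by (simp only: L2_norm_triangle_diff L2_diff)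
        qed
        moreover have "L2_norm N (z s) \<le> L2_norm N ?z + L2_norm N (z t)"
          using L2_norm_triangle[OF L2_diff[OF zs] zs(2)] by simp
        moreover have "L2_norm N (z t) \<le> L2_norm N (z s) + L2_norm N ?z"
          using L2_norm_triangle_diff[OF zs(1) L2_diff[OF zs]] by simp
        ultimately show "norm (L2_norm N (z s) - L2_norm N (z t)) \<le> ?d s"
          by simp
      qed
    qed
    then have "((\<lambda>s. L2_norm N (z s)) \<longlongrightarrow> L2_norm N (z t)) (at_left t)"
      by (simp add: LIM_zero_iff)
    then show "(?F \<longlongrightarrow> ?F t) (at_left t)"
      by (intro tendsto_intros)
  qed
  moreover have "AE_eq N (z 0) (\<lambda>j x. 0)"
    unfolding z_def AE_eq_zero_diff
    by (rule AE_eq_trans[OF C0_semigroup_D(4)[OF P L(1)] AE_eq_sym[OF C0_semigroup_D(4)[OF S L(1)]]])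
  then have "?F 0 = 0"
    by (simp add: L2_norm_AE_zero zL)
  ultimately have "L2_norm N (z T) = 0"
    by simp
  then have "AE_eq N (z T) (\<lambda>j x. 0)"
    using T by (intro L2_norm_zero_imp zL) simp
  then show ?thesis
    by (simp add: z_def AE_eq_zero_diff)
qed

lemma generator_zero_imp:
  assumes S: "C0_semigroup N S" and G: "infinitesimal_generator N S u w" and u: "AE_eq N u (\<lambda>j x. 0)"
  shows "AE_eq N w (\<lambda>j x. 0)"
proof -
  have L: "u \<in> L2 N" "w \<in> L2 N"
    using generator_L2[OF G] by auto
  have G0: "infinitesimal_generator N S (\<lambda>j x. 0) w"
    by (rule generator_cong[OF S G u L2_zero AE_eq_refl L(2)])
  have S0: "AE_eq N (S t (\<lambda>j x. 0)) (\<lambda>j x. 0)" if "t \<ge> 0" for t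
    using C0_semigroup_D(2)[OF S that L2_zero L2_zero, of 0 0] by simp
  have "((\<lambda>t. L2_norm N (\<lambda>j x. (S t (\<lambda>j x. 0) j x - 0) / t - w j x)) \<longlongrightarrow> 0) (at_right 0)"
    using G0 by (simp add: infinitesimal_generator_def)
  then have "((\<lambda>t::real. L2_norm N w) \<longlongrightarrow> 0) (at_right 0)"
  proof (rule Lim_transform_eventually)
    show "\<forall>\<^sub>F t in at_right 0. L2_norm N (\<lambda>j x. (S t (\<lambda>j x. 0) j x - 0) / t - w j x) = L2_norm N w"
      using eventually_at_right_less[of "0::real"]
    proof eventually_elim
      case (elim t)
      have St: "S t (\<lambda>j x. 0) \<in> L2 N"
        by (rule C0_semigroup_D(1)[OF S _ L2_zero]) (use elim in simp)
      have "AE_eq N (\<lambda>j x. (S t (\<lambda>j x. 0) j x - 0) / t - w j x) (\<lambda>j x. (-1) * w j x)"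
        using S0[of t] elim by (auto simp: AE_eq_def elim!: eventually_mono)
      then have "L2_norm N (\<lambda>j x. (S t (\<lambda>j x. 0) j x - 0) / t - w j x) = L2_norm N (\<lambda>j x. (-1) * w j x)"
        by (rule L2_norm_cong[OF _ L2_difference_quotient[OF St L2_zero L(2)] L2_cmult[OF L(2)]])
      then show ?case
        using L2_norm_cmult[OF L(2), of "-1"] by simp
    qed
  qed
  then have "L2_norm N w = 0"
    by (simp add: tendsto_const_iff)
  then show ?thesis
    by (rule L2_norm_zero_imp[OF L(2)])
qed

text \<open>Uniqueness passes from the domain to $L^2$ without a density argument: both semigroups
  commute with $\Delta$, hence $P_t f$ is recovered from $P_t R f$ as $(1 - \Delta) P_t R f$.\<close>

theorem heat_eq:
  assumes N: "N > 0"
  shows "C0_semigroup N (heat N)"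
    and "f \<in> L2 N \<Longrightarrow> t \<ge> 0 \<Longrightarrow> AE_eq N (heat N t f) (heat_sg N t f)"
proof -
  note S = heat_sg_C0[OF N] and GS = heat_sg_generator[OF N]
  have "C0_semigroup N (heat N) \<and> (\<forall>u w. infinitesimal_generator N (heat N) u w \<longleftrightarrow> is_Laplacian N u w)"
    unfolding heat_def by (rule someI[of _ "heat_sg N"]) (use S GS in blast)
  then have P: "C0_semigroup N (heat N)"
    and GP: "\<And>u w. infinitesimal_generator N (heat N) u w \<longleftrightarrow> is_Laplacian N u w"
    by auto
  show "C0_semigroup N (heat N)"
    by (rule P)
  assume f: "f \<in> L2 N" and t: "t \<ge> 0"
  let ?P = "heat N t" and ?S = "heat_sg N t" and ?R = "resolvent N f"
  let ?Q = "\<lambda>j x. ?R j x - f j x"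
  have R: "is_Laplacian N ?R ?Q"
    by (rule resolvent_Laplacian[OF N f])
  have RL: "?R \<in> L2 N" "?Q \<in> L2 N"
    using is_Laplacian_L2[OF R] by auto
  have eqR: "AE_eq N (?P ?R) (?S ?R)"
    by (rule semigroup_unique_on_domain[OF P S GP GS R t])
  have "infinitesimal_generator N (heat_sg N) (?P ?R) (?P ?Q)"
    using generator_invariant[OF P _ t] GP GS R by blast
  moreover have "infinitesimal_generator N (heat_sg N) (?S ?R) (?S ?Q)"
    using generator_invariant[OF S _ t] GS R by blast
  ultimately have "infinitesimal_generator N (heat_sg N) (\<lambda>j x. 1 * ?P ?R j x + (-1) * ?S ?R j x)
      (\<lambda>j x. 1 * ?P ?Q j x + (-1) * ?S ?Q j x)"
    by (rule generator_lin[OF S])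
  moreover have "AE_eq N (\<lambda>j x. 1 * ?P ?R j x + (-1) * ?S ?R j x) (\<lambda>j x. 0)"
    using eqR by (simp add: AE_eq_zero_diff)
  ultimately have "AE_eq N (\<lambda>j x. 1 * ?P ?Q j x + (-1) * ?S ?Q j x) (\<lambda>j x. 0)"
    by (rule generator_zero_imp[OF S])
  then have eqQ: "AE_eq N (?P ?Q) (?S ?Q)"
    by (simp add: AE_eq_zero_diff)
  show "AE_eq N (?P f) (?S f)"
    unfolding AE_eq_def
  proof (intro allI impI)
    fix j assume j: "j < N"
    have "AE x in leg. ?P ?R j x = ?S ?R j x" "AE x in leg. ?P ?Q j x = ?S ?Q j x"
      using eqR eqQ j by (auto simp: AE_eq_def)
    moreover have "AE x in leg. ?P ?Q j x = ?P ?R j x - ?P f j x"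
      using C0_diff[OF P t RL(1) f] j unfolding AE_eq_def by blast
    moreover have "AE x in leg. ?S ?Q j x = ?S ?R j x - ?S f j x"
      using C0_diff[OF S t RL(1) f] j unfolding AE_eq_def by blast
    ultimately show "AE x in leg. ?P f j x = ?S f j x"
      by eventually_elim simp
  qed
qed

section \<open>The gradient of the heat flow\<close>

lemma Dom_E_obtains:
  assumes "f \<in> Dom_E N"
  obtains c \<phi> where "H1spider N f c \<phi>" "line_L2 \<phi>"
proof -
  obtain c \<phi>0 where h: "H1spider N f c \<phi>0"
    using assms unfolding Dom_E_iff by blast
  define \<phi> where "\<phi> = (\<lambda>j. if j < N then \<phi>0 j else (\<lambda>x. 0))"
  have "H1spider N f c \<phi>"
    using h by (simp add: H1spider_def \<phi>_def)
  moreover have "line_L2 \<phi>"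
    using h by (auto simp: line_L2_def \<phi>_def H1spider_def H1rep_def sqi_zero)
  ultimately show ?thesis
    using that by blast
qed

text \<open>The derivative of the unfolding: on the reflected half-line the sign changes.\<close>

definition unfold_deriv :: "nat \<Rightarrow> spider_fun \<Rightarrow> spider_fun" where
  "unfold_deriv N \<phi> j y = (if y > 0 then 1 else -1) * unfold N \<phi> j y"

lemma unfold_deriv_sqi:
  assumes "line_L2 \<phi>"
  shows "unfold_deriv N \<phi> j \<in> sqi lborel"
proof (rule sqi_bound[OF unfold_sqi[OF assms, of N j]])
  have [measurable]: "unfold N \<phi> j \<in> borel_measurable borel"
    by (rule unfold_measurable[OF assms])
  show "unfold_deriv N \<phi> j \<in> borel_measurable lborel"
    unfolding unfold_deriv_def[abs_def] by measurable
qed (simp add: unfold_deriv_def)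

lemma prim_sum:
  assumes "\<And>i. i \<in> I \<Longrightarrow> g i \<in> sqi lborel" "x \<ge> 0"
  shows "prim (\<lambda>y. \<Sum>i\<in>I. g i y) x = (\<Sum>i\<in>I. prim (g i) x)"
proof -
  have "prim (\<lambda>y. \<Sum>i\<in>I. g i y) x = (\<integral>y. (\<Sum>i\<in>I. indicator {0..x} y * g i y) \<partial>lborel)"
    by (simp add: prim_nonneg_eq[OF assms(2)] sum_distrib_left)
  also have "\<dots> = (\<Sum>i\<in>I. prim (g i) x)"
    unfolding prim_nonneg_eq[OF assms(2)]
    by (intro Bochner_Integration.integral_sum indicator_Icc_mult_integrable assms)
  finally show ?thesis .
qed

lemma prim_cong_pos:
  assumes "x \<ge> 0" "\<And>y. y > 0 \<Longrightarrow> g y = h y" "g \<in> borel_measurable borel" "h \<in> borel_measurable borel"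
  shows "prim g x = prim h x"
  unfolding prim_nonneg_eq[OF assms(1)]
proof (rule integral_cong_AE)
  show "(\<lambda>y. indicator {0..x} y * g y) \<in> borel_measurable lborel"
       "(\<lambda>y. indicator {0..x} y * h y) \<in> borel_measurable lborel"
    using assms(3,4) by measurable
  show "AE y in lborel. indicator {0..x} y * g y = indicator {0..x} y * h y"
    using AE_lborel_singleton[of "0::real"]
    by eventually_elim (use assms(2) in \<open>auto split: split_indicator\<close>)
qed

text \<open>The unfolding of a function in the form domain has no jump at the vertex.\<close>

lemma unfold_prim:
  assumes N: "N > 0" and \<phi>: "line_L2 \<phi>" and j: "j < N"
    and F: "\<And>i x. i < N \<Longrightarrow> x \<ge> 0 \<Longrightarrow> F i x = c + prim (\<phi> i) x"
  shows "unfold N F j y = c + prim (unfold_deriv N \<phi> j) y"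
proof -
  have m: "\<phi> i \<in> borel_measurable borel" "unfold_deriv N \<phi> i \<in> borel_measurable borel" for i
    using line_L2_measurable[OF \<phi>] sqi_measurable[OF unfold_deriv_sqi[OF \<phi>]] by auto
  show ?thesis
  proof (cases "y > 0")
    case True
    have "prim (unfold_deriv N \<phi> j) y = prim (\<phi> j) y"
      using True m by (intro prim_cong_pos) (auto simp: unfold_deriv_def unfold_def)
    then show ?thesis
      using True F[OF j, of y] by (simp add: unfold_def)
  next
    case False
    define x where "x = - y"
    have x: "x \<ge> 0" "y = - x"
      using False by (auto simp: x_def)
    have S: "(\<lambda>s. \<Sum>i<N. \<phi> i s) \<in> sqi lborel"
      by (intro sqi_sum line_L2_sqi[OF \<phi>])
    have "prim (unfold_deriv N \<phi> j) y = - prim (\<lambda>s. unfold_deriv N \<phi> j (- s)) x"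
      unfolding x(2) by (rule prim_reflect)
    also have "prim (\<lambda>s. unfold_deriv N \<phi> j (- s)) x
        = prim (\<lambda>s. (- 2 / real N) * (\<Sum>i<N. \<phi> i s) + 1 * \<phi> j s) x"
      using sqi_measurable[OF S] m by (intro prim_cong_pos[OF x(1)]) (auto simp: unfold_deriv_def unfold_def)
    also have "\<dots> = (- 2 / real N) * (\<Sum>i<N. prim (\<phi> i) x) + 1 * prim (\<phi> j) x"
      by (simp only: prim_add[OF S line_L2_sqi[OF \<phi>]] prim_sum[OF line_L2_sqi[OF \<phi>] x(1)])
    finally have *: "prim (unfold_deriv N \<phi> j) y = 2 / real N * (\<Sum>i<N. prim (\<phi> i) x) - prim (\<phi> j) x"
      by simp
    have "unfold N F j y = 2 / real N * (\<Sum>i<N. F i x) - F j x"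
      using False by (simp add: unfold_def x_def)
    also have "(\<Sum>i<N. F i x) = (\<Sum>i<N. c + prim (\<phi> i) x)"
      by (intro sum.cong refl F x) simp
    also have "\<dots> = real N * c + (\<Sum>i<N. prim (\<phi> i) x)"
      by (simp add: sum.distrib)
    also have "F j x = c + prim (\<phi> j) x"
      by (rule F[OF j x(1)])
    finally show ?thesis
      using N unfolding * by (simp add: field_simps)
  qed
qed

lemma spread_H1:
  assumes N: "N > 0" and t: "t > 0" and f: "H1spider N f c \<phi>" and \<phi>: "line_L2 \<phi>" and j: "j < N"
  shows "\<exists>c'. H1rep (spread N (heat_kernel t) f j) c' (conv (heat_kernel t) (unfold_deriv N \<phi> j))"
proof -
  let ?p = "heat_kernel t" and ?\<gamma> = "unfold_deriv N \<phi> j"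
  note p = bdd_L1_heat_kernel[OF t]
  define F where "F = (\<lambda>i x. if i < N then indicator {0..} x * (c + prim (\<phi> i) x) else 0)"
  have F_L2: "line_L2 F"
    unfolding line_L2_def
  proof
    fix i show "F i \<in> sqi lborel"
      using H1rep_sqi[OF H1spiderD[OF f]] by (cases "i < N") (auto simp: F_def sqi_zero)
  qed
  have F_AE: "AE_eq N f F"
    unfolding AE_eq_def
  proof (intro allI impI)
    fix i assume i: "i < N"
    have "AE x in leg. f i x = c + prim (\<phi> i) x" "AE x in leg. x \<ge> 0"
      using H1spiderD[OF f i] by (auto simp: H1rep_def AE_leg)
    then show "AE x in leg. f i x = F i x"
      by eventually_elim (simp add: F_def i)
  qed
  have uF: "unfold N F j = (\<lambda>u. c + prim ?\<gamma> u)"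
    by (rule ext, rule unfold_prim[OF N \<phi> j]) (simp add: F_def)
  have a: "(\<lambda>u. c + prim ?\<gamma> u) \<in> sqi lborel"
    using unfold_sqi[OF F_L2, of N j] by (simp only: uF)
  note \<gamma> = unfold_deriv_sqi[OF \<phi>, of N j]
  have eq: "spread N ?p f j = conv ?p (\<lambda>u. c + prim ?\<gamma> u)"
    using spread_eq[OF H1spider_L2(1)[OF f] F_L2 F_AE j bdd_L1_measurable[OF p]] by (simp only: uF)
  let ?c = "conv ?p (\<lambda>u. c + prim ?\<gamma> u) 0"
  have comm: "conv ?\<gamma> ?p = conv ?p ?\<gamma>"
    by (rule ext) (rule conv_commute)
  have "spread N ?p f j x = ?c + prim (conv ?p ?\<gamma>) x" if "x \<ge> 0" for x
    using conv_prim[OF \<gamma> a bdd_L1_sqi[OF p] that] unfolding eq comm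
    by (simp only: conv_commute[of "\<lambda>u. c + prim ?\<gamma> u" ?p])
  then have AE: "AE x in leg. spread N ?p f j x = ?c + prim (conv ?p ?\<gamma>) x"
    unfolding AE_leg by (intro AE_I2 impI)
  have "spread N ?p f j \<in> sqi leg"
    using spread_L2[OF p, of N f] j by (simp add: L2_iff)
  then have "H1rep (spread N ?p f j) ?c (conv ?p ?\<gamma>)"
    unfolding H1rep_def using conv_L2(1)[OF p \<gamma>] AE by blast
  then show ?thesis
    by blast
qed

lemma sqrt_Gam_AE:
  assumes f: "H1spider N f c \<phi>" and j: "j < N"
  shows "AE x in leg. sqrt (Gam f j x) = \<bar>\<phi> j x\<bar>"
  using H1rep_weak_deriv(1)[OF H1spiderD[OF f j]] by eventually_elim (simp add: Gam_def)

lemma sqrt_Gam_L2: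
  assumes f: "H1spider N f c \<phi>"
  shows "(\<lambda>i y. sqrt (Gam f i y)) \<in> L2 N"
  unfolding L2_iff
proof (intro allI impI)
  fix j assume j: "j < N"
  have "(\<lambda>y. \<bar>weak_deriv (f j) y\<bar>) \<in> sqi leg"
    by (intro sqi_abs H1rep_weak_deriv(2)[OF H1spiderD[OF f j]])
  then show "(\<lambda>y. sqrt (Gam f j y)) \<in> sqi leg"
    by (simp add: Gam_def)
qed

lemma line_L2_abs: "line_L2 \<phi> \<Longrightarrow> line_L2 (\<lambda>i y. \<bar>\<phi> i y\<bar>)"
  by (simp add: line_L2_def sqi_abs)

text \<open>Both sides of the gradient estimate as convolutions on the line.\<close>

lemma sqrt_Gam_heat:
  assumes N: "N > 0" and t: "t > 0" and f: "H1spider N f c \<phi>" and \<phi>: "line_L2 \<phi>" and j: "j < N"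
  shows "AE x in leg. sqrt (Gam (heat N t f) j x) = \<bar>conv (heat_kernel t) (unfold_deriv N \<phi> j) x\<bar>"
proof -
  have fL: "f \<in> L2 N"
    by (rule H1spider_L2(1)[OF f])
  have "AE_eq N (heat N t f) (heat_sg N t f)"
    using t by (intro heat_eq(2)[OF N] fL) simp
  then have eq: "AE x in leg. spread N (heat_kernel t) f j x = heat N t f j x"
    using t j by (auto simp: AE_eq_def heat_sg_def elim: eventually_mono)
  have L: "heat N t f j \<in> sqi leg"
    using C0_semigroup_D(1)[OF heat_eq(1)[OF N] _ fL, of t] t j by (simp add: L2_iff)
  obtain c' where H: "H1rep (spread N (heat_kernel t) f j) c' (conv (heat_kernel t) (unfold_deriv N \<phi> j))"
    using spread_H1[OF assms] by blast
  have "H1rep (heat N t f j) c' (conv (heat_kernel t) (unfold_deriv N \<phi> j))"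
    by (rule H1rep_cong[OF H L eq])
  from H1rep_weak_deriv(1)[OF this] show ?thesis
    by eventually_elim (simp add: Gam_def)
qed

lemma heat_sqrt_Gam:
  assumes N: "N > 0" and t: "t > 0" and f: "H1spider N f c \<phi>" and \<phi>: "line_L2 \<phi>" and j: "j < N"
  shows "AE x in leg. heat N t (\<lambda>i y. sqrt (Gam f i y)) j x
     = conv (heat_kernel t) (unfold N (\<lambda>i y. \<bar>\<phi> i y\<bar>) j) x"
proof -
  let ?g = "\<lambda>i y. sqrt (Gam f i y)"
  have "AE_eq N (heat N t ?g) (heat_sg N t ?g)"
    using t by (intro heat_eq(2)[OF N] sqrt_Gam_L2[OF f]) simp
  then have "AE x in leg. heat N t ?g j x = spread N (heat_kernel t) ?g j x"
    using t j by (simp add: AE_eq_def heat_sg_def)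
  moreover have "AE_eq N ?g (\<lambda>i y. \<bar>\<phi> i y\<bar>)"
    unfolding AE_eq_def using sqrt_Gam_AE[OF f] by blast
  then have "spread N (heat_kernel t) ?g j = conv (heat_kernel t) (unfold N (\<lambda>i y. \<bar>\<phi> i y\<bar>) j)"
    by (intro spread_eq sqrt_Gam_L2[OF f] line_L2_abs \<phi> j bdd_L1_measurable bdd_L1_heat_kernel t)
  ultimately show ?thesis
    by simp
qed

text \<open>Folding the line at the vertex reduces the estimate to a pointwise inequality for the weights
  $p_t(x - y) \ge p_t(x + y)$.\<close>

lemma reflected_weight_nonneg:
  fixes a :: "nat \<Rightarrow> real"
  assumes N: "N \<ge> 2" and j: "j < N"
  shows "(real N - 2) * \<bar>a j\<bar> + ((real N - 1) * (2 / real N * (\<Sum>i<N. \<bar>a i\<bar>) - \<bar>a j\<bar>)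
      - \<bar>2 / real N * (\<Sum>i<N. a i) - a j\<bar>) \<ge> 0"
proof -
  let ?A = "\<Sum>i<N. \<bar>a i\<bar>" and ?S = "\<Sum>i<N. a i"
  have n: "real N \<ge> 2"
    using N by simp
  have A: "?A = \<bar>a j\<bar> + (\<Sum>i\<in>{..<N} - {j}. \<bar>a i\<bar>)" and S: "?S = a j + (\<Sum>i\<in>{..<N} - {j}. a i)"
    using j by (auto intro: sum.remove)
  define B where "B = (\<Sum>i\<in>{..<N} - {j}. \<bar>a i\<bar>)"
  define U where "U = (\<Sum>i\<in>{..<N} - {j}. a i)"
  have B: "\<bar>U\<bar> \<le> B" "0 \<le> B"
    unfolding B_def U_def by (rule sum_abs) (rule sum_nonneg, simp)
  have "2 / real N * (a j + U) - a j = 2 / real N * U - (1 - 2 / real N) * a j"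
    by (simp add: algebra_simps add_divide_distrib)
  then have "\<bar>2 / real N * (a j + U) - a j\<bar> = \<bar>2 / real N * U - (1 - 2 / real N) * a j\<bar>"
    by (rule arg_cong)
  also have "\<dots> \<le> 2 / real N * \<bar>U\<bar> + (1 - 2 / real N) * \<bar>a j\<bar>"
  proof -
    have "0 \<le> 1 - 2 / real N"
      using n by simp
    then show ?thesis
      using abs_triangle_ineq4[of "2 / real N * U" "(1 - 2 / real N) * a j"] by (simp add: abs_mult)
  qed
  also have "\<dots> \<le> 2 / real N * B + (1 - 2 / real N) * \<bar>a j\<bar>"
    using B n by (intro add_right_mono mult_left_mono) auto
  finally have le: "\<bar>2 / real N * (a j + U) - a j\<bar> \<le> 2 / real N * B + (1 - 2 / real N) * \<bar>a j\<bar>" .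
  have "(real N - 2) * \<bar>a j\<bar> + ((real N - 1) * (2 / real N * (\<bar>a j\<bar> + B) - \<bar>a j\<bar>)
      - (2 / real N * B + (1 - 2 / real N) * \<bar>a j\<bar>)) = 2 / real N * (real N - 2) * B"
    using n by (simp add: field_simps)
  also have "\<dots> \<ge> 0"
    using n B by simp
  finally show ?thesis
    using le unfolding A S B_def[symmetric] U_def[symmetric] by linarith
qed

lemma conv_unfold_deriv_le:
  assumes N: "N \<ge> 2" and t: "t > 0" and \<phi>: "line_L2 \<phi>" and j: "j < N" and x: "x \<ge> 0"
  shows "\<bar>conv (heat_kernel t) (unfold_deriv N \<phi> j) x\<bar>
    \<le> (real N - 1) * conv (heat_kernel t) (unfold N (\<lambda>i y. \<bar>\<phi> i y\<bar>) j) x"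
proof -
  let ?p = "heat_kernel t" and ?\<gamma> = "unfold_deriv N \<phi> j" and ?e = "unfold N (\<lambda>i y. \<bar>\<phi> i y\<bar>) j"
  note p = bdd_L1_sqi[OF bdd_L1_heat_kernel[OF t]]
  note \<gamma> = unfold_deriv_sqi[OF \<phi>, of N j] and e = unfold_sqi[OF line_L2_abs[OF \<phi>], of N j]
  define H where "H = (\<lambda>y. (real N - 1) * ?e y + (-1) * \<bar>?\<gamma> y\<bar>)"
  have H: "H \<in> sqi lborel"
    unfolding H_def by (intro sqi_add sqi_cmult sqi_abs e \<gamma>)
  have nonneg: "conv ?p H x \<ge> 0"
  proof -
    let ?h = "\<lambda>y. ?p (x - y) * H y"
    have "conv ?p H x = (\<integral>y. indicator {0..} y * (?h y + ?h (- y)) \<partial>lborel)"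
      unfolding conv_def by (rule integral_fold(1)[OF conv_integrable[OF p H]])
    also have "\<dots> \<ge> 0"
    proof (rule integral_nonneg_AE)
      show "AE y in lborel. 0 \<le> indicator {0..} y * (?h y + ?h (- y))"
        using AE_lborel_singleton[of "0::real"]
      proof eventually_elim
        case (elim y)
        show ?case
        proof (cases "y > 0")
          case True
          have H_pos: "H y = (real N - 2) * \<bar>\<phi> j y\<bar>"
            using True by (simp add: H_def unfold_deriv_def unfold_def algebra_simps)
          have H_neg: "H (- y) = (real N - 1) * (2 / real N * (\<Sum>i<N. \<bar>\<phi> i y\<bar>) - \<bar>\<phi> j y\<bar>)
              - \<bar>2 / real N * (\<Sum>i<N. \<phi> i y) - \<phi> j y\<bar>"
            using True by (simp add: H_def unfold_deriv_def unfold_def)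
          have "?p (x + y) * (H y + H (- y)) \<ge> 0"
            unfolding H_pos H_neg
            by (intro mult_nonneg_nonneg heat_kernel_nonneg reflected_weight_nonneg[OF N j])
          moreover have "?p (x + y) * H y \<le> ?p (x - y) * H y"
            unfolding H_pos using N x True
            by (intro mult_right_mono heat_kernel_mono[OF t]) auto
          ultimately show ?thesis
            using True by (simp add: distrib_left)
        qed (use elim in simp)
      qed
    qed
    finally show ?thesis .
  qed
  have "conv ?p H x = (real N - 1) * conv ?p ?e x + (-1) * conv ?p (\<lambda>y. \<bar>?\<gamma> y\<bar>) x"
    unfolding H_def by (rule conv_add_right[OF p e sqi_abs[OF \<gamma>]])
  moreover have "\<bar>conv ?p ?\<gamma> x\<bar> \<le> conv ?p (\<lambda>y. \<bar>?\<gamma> y\<bar>) x"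
    using integral_abs_bound[of lborel "\<lambda>y. ?p (x - y) * ?\<gamma> y"]
    by (simp add: conv_def abs_mult heat_kernel_nonneg)
  ultimately show ?thesis
    using nonneg by linarith
qed

lemma gradient_bound:
  assumes N: "N \<ge> 2" and f: "f \<in> Dom_E N" and t: "t \<ge> 0" and j: "j < N"
  shows "AE x in leg. sqrt (Gam (heat N t f) j x) \<le> (real N - 1) * heat N t (\<lambda>i y. sqrt (Gam f i y)) j x"
proof -
  have N0: "N > 0"
    using N by simp
  obtain c \<phi> where h: "H1spider N f c \<phi>" "line_L2 \<phi>"
    using Dom_E_obtains[OF f] by blast
  show ?thesis
  proof (cases "t = 0")
    case False
    then have t: "t > 0"
      using t by simp
    have "AE x in leg. x \<ge> 0"
      by (simp add: AE_leg)
    with sqrt_Gam_heat[OF N0 t h j] heat_sqrt_Gam[OF N0 t h j] show ?thesis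
      by eventually_elim (simp add: conv_unfold_deriv_le[OF N t h(2) j])
  next
    case True
    note P = heat_eq(1)[OF N0]
    let ?g = "\<lambda>i y. sqrt (Gam f i y)"
    have fL: "f \<in> L2 N"
      by (rule H1spider_L2(1)[OF h(1)])
    have eq: "AE x in leg. f j x = heat N 0 f j x"
      using AE_eq_sym[OF C0_semigroup_D(4)[OF P fL]] j by (simp add: AE_eq_def)
    have L: "heat N 0 f j \<in> sqi leg"
      using C0_semigroup_D(1)[OF P _ fL, of 0] j by (simp add: L2_iff)
    have "H1rep (heat N 0 f j) c (\<phi> j)"
      by (rule H1rep_cong[OF H1spiderD[OF h(1) j] L eq])
    note 1 = H1rep_weak_deriv(1)[OF this]
    have 2: "AE x in leg. heat N 0 ?g j x = ?g j x"
      using C0_semigroup_D(4)[OF P sqrt_Gam_L2[OF h(1)]] j by (simp add: AE_eq_def)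
    from 1 2 sqrt_Gam_AE[OF h(1) j] show ?thesis
      unfolding True
    proof eventually_elim
      case (elim x)
      have "1 * \<bar>\<phi> j x\<bar> \<le> (real N - 1) * \<bar>\<phi> j x\<bar>"
        using N by (intro mult_right_mono) auto
      then show ?case
        using elim by (simp add: Gam_def)
    qed
  qed
qed

section \<open>Optimality of the constant\<close>

lemma exp_half_line_sqi:
  assumes "a > 0"
  shows "(\<lambda>x::real. indicator {0..} x * exp (- (a * x))) \<in> sqi lborel"
proof (rule sqiI)
  have "integrable lborel (\<lambda>x::real. indicator {0..} x * exp (- x))"
    using power_exp_half_line[of 0] by (simp add: has_bochner_integral_iff)
  from lborel_integrable_real_affine[OF this, of "2 * a" 0]
  have "integrable lborel (\<lambda>x. indicator {0..} (2 * a * x) * exp (- (2 * a * x)))"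
    using assms by simp
  also have "(\<lambda>x. indicator {0..} (2 * a * x) * exp (- (2 * a * x)))
      = (\<lambda>x. (indicator {0..} x * exp (- (a * x)))\<^sup>2)"
    using assms by (intro ext) (auto simp: power2_eq_square zero_le_mult_iff simp flip: exp_add split: split_indicator)
  finally show "integrable lborel (\<lambda>x. (indicator {0..} x * exp (- (a * x)))\<^sup>2)" .
qed measurable

text \<open>The extremal functions, with small $e$: on leg 0 a rise of unit scale followed by a slow
  decay, zero elsewhere.  The decay is needed for square-integrability, but its contribution to
  the gradient is of order $e$.\<close>

definition peak :: "real \<Rightarrow> spider_fun" where
  "peak e j x = (if j = 0 then exp (- (e * x)) - exp (- (1 * x)) else 0)"

text \<open>The derivative of \<open>peak e\<close> on the half-line.\<close>

definition peak' :: "real \<Rightarrow> spider_fun" where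
  "peak' e j x = (if j = 0 then 1 * (indicator {0..} x * exp (- (1 * x)))
     + (- e) * (indicator {0..} x * exp (- (e * x))) else 0)"

lemma line_L2_peak': "e > 0 \<Longrightarrow> line_L2 (peak' e)"
  unfolding line_L2_def
proof
  fix i assume "e > 0"
  then have "(\<lambda>x::real. 1 * (indicator {0..} x * exp (- (1 * x)))
      + (- e) * (indicator {0..} x * exp (- (e * x)))) \<in> sqi lborel"
    by (intro sqi_add sqi_cmult exp_half_line_sqi) auto
  then show "peak' e i \<in> sqi lborel"
    by (cases "i = 0") (simp_all add: peak'_def[abs_def] sqi_zero)
qed

lemma peak_H1:
  assumes e: "e > 0"
  shows "H1spider N (peak e) 0 (peak' e)"
  unfolding H1spider_def
proof (intro allI impI)
  fix j
  have s: "peak' e j \<in> sqi lborel"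
    by (rule line_L2_sqi[OF line_L2_peak'[OF e]])
  have "peak e j x = prim (peak' e j) x" if "x \<ge> 0" for x
  proof (cases "j = 0")
    case True
    have "prim (peak' e j) x = prim (\<lambda>x. exp (- x) - e * exp (- (e * x))) x"
      unfolding prim_nonneg_eq[OF that] using True
      by (intro Bochner_Integration.integral_cong) (auto simp: peak'_def split: split_indicator)
    also have "\<dots> = (exp (- (e * x)) - exp (- x)) - (exp (- (e * 0)) - exp (- 0))"
      by (rule prim_C1[where F = "\<lambda>x. exp (- (e * x)) - exp (- x)"])
        (auto intro!: continuous_intros derivative_eq_intros)
    finally show ?thesis
      using True by (simp add: peak_def)
  next
    case False
    then show ?thesis
      unfolding prim_nonneg_eq[OF that] by (simp add: peak_def peak'_def)
  qed
  then have AE: "AE x in leg. peak e j x = 0 + prim (peak' e j) x"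
    by (simp add: AE_leg)
  have "peak e j \<in> sqi leg"
  proof (cases "j = 0")
    case True
    have "(\<lambda>x::real. 1 * (indicator {0..} x * exp (- (e * x)))
      + (- 1) * (indicator {0..} x * exp (- (1 * x)))) \<in> sqi lborel"
      using e by (intro sqi_add sqi_cmult exp_half_line_sqi) auto
    also have "(\<lambda>x::real. 1 * (indicator {0..} x * exp (- (e * x)))
      + (- 1) * (indicator {0..} x * exp (- (1 * x)))) = (\<lambda>x. indicator {0..} x * peak e j x)"
      using True by (intro ext) (auto simp: peak_def split: split_indicator)
    finally show ?thesis
      using True by (subst sqi_leg_iff) (auto simp: peak_def[abs_def])
  next
    case False
    then have "peak e j = (\<lambda>x. 0)"
      by (intro ext) (simp add: peak_def)
    then show ?thesis
      by (simp add: sqi_zero)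
  qed
  then show "H1rep (peak e j) 0 (peak' e j)"
    unfolding H1rep_def using s AE by simp
qed

lemma AE_leg_sequence:
  assumes "AE x in leg. Q x"
  obtains X where "X \<longlonglongrightarrow> (0::real)" "\<And>n. Q (X n)"
proof -
  have "\<exists>x. 0 < x \<and> x < 1 / real (Suc n) \<and> Q x" for n
  proof (rule ccontr)
    let ?d = "1 / real (Suc n)"
    assume no: "\<nexists>x. 0 < x \<and> x < ?d \<and> Q x"
    have "AE x in lborel. x \<notin> {0<..<?d}"
      using assms unfolding AE_leg by eventually_elim (use no in auto)
    then have "emeasure lborel {0<..<?d} = 0"
      by (subst (asm) AE_iff_measurable[of "{0<..<?d}"]) auto
    then show False
      by simp
  qed
  then obtain X where X: "\<And>n. 0 < X n" "\<And>n. X n < 1 / real (Suc n)" "\<And>n. Q (X n)"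
    by metis
  have "X \<longlonglongrightarrow> 0"
    by (rule real_tendsto_sandwich[of "\<lambda>_. 0" _ _ "\<lambda>n. 1 / real (Suc n)"])
      (use X LIMSEQ_inverse_real_of_nat in \<open>auto intro!: always_eventually less_imp_le simp: inverse_eq_divide\<close>)
  then show ?thesis
    using that X(3) by blast
qed

text \<open>At the vertex $p_t(x - y)$ and $p_t(x + y)$ coincide, and the two sides of the estimate
  carry the factors $2 - 2/N$ and $2/N$, whose ratio is $N - 1$.\<close>

lemma conv_unfold_peak:
  fixes e :: real
  assumes N: "N > 0" and t: "t > 0" and e: "e > 0"
  defines "I \<equiv> \<lambda>h. \<integral>y. indicator {0..} y * (heat_kernel t y * h y) \<partial>lborel"
  shows "conv (heat_kernel t) (unfold_deriv N (peak' e) 0) 0 = (2 - 2 / real N) * I (peak' e 0)"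
    and "conv (heat_kernel t) (unfold N (\<lambda>i y. \<bar>peak' e i y\<bar>) 0) 0 = 2 / real N * I (\<lambda>y. \<bar>peak' e 0 y\<bar>)"
proof -
  let ?p = "heat_kernel t" and ?\<gamma> = "unfold_deriv N (peak' e) 0" and ?e = "unfold N (\<lambda>i y. \<bar>peak' e i y\<bar>) 0"
  note p = bdd_L1_sqi[OF bdd_L1_heat_kernel[OF t]] and \<phi> = line_L2_peak'[OF e]
  have fold: "conv ?p g 0 = k * I h"
    if g: "g \<in> sqi lborel" and h: "h \<in> borel_measurable borel"
      and gh: "\<And>y. y > 0 \<Longrightarrow> g y + g (- y) = k * h y" for g h :: "real \<Rightarrow> real" and k
  proof -
    have [measurable]: "g \<in> borel_measurable borel" "h \<in> borel_measurable borel" "?p \<in> borel_measurable borel"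
      using sqi_measurable[OF g] h sqi_measurable[OF p] by auto
    have "conv ?p g 0 = (\<integral>y. indicator {0..} y * (?p (0 - y) * g y + ?p (0 - - y) * g (- y)) \<partial>lborel)"
      unfolding conv_def by (rule integral_fold(1)[OF conv_integrable[OF p g]])
    also have "\<dots> = (\<integral>y. k * (indicator {0..} y * (?p y * h y)) \<partial>lborel)"
    proof (rule integral_cong_AE)
      show "AE y in lborel. indicator {0..} y * (?p (0 - y) * g y + ?p (0 - - y) * g (- y))
          = k * (indicator {0..} y * (?p y * h y))"
        using AE_lborel_singleton[of "0::real"]
      proof eventually_elim
        case (elim y)
        show ?case
        proof (cases "y > 0")
          case True
          then show ?thesis
            using gh[OF True] by (simp add: heat_kernel_even mult.left_commute[of k] flip: distrib_left)
        qed (use elim in simp)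
      qed
    qed measurable
    finally show ?thesis
      by (simp add: I_def)
  qed
  have sum0: "(\<Sum>i<N. if i = 0 then a else 0) = a" for a :: real
    using N by simp
  have "(\<Sum>i<N. peak' e i y) = (\<Sum>i<N. if i = 0 then peak' e 0 y else 0)"
       "(\<Sum>i<N. \<bar>peak' e i y\<bar>) = (\<Sum>i<N. if i = 0 then \<bar>peak' e 0 y\<bar> else 0)" for y
    by (intro sum.cong refl; simp add: peak'_def)+
  then have S: "(\<Sum>i<N. peak' e i y) = peak' e 0 y" "(\<Sum>i<N. \<bar>peak' e i y\<bar>) = \<bar>peak' e 0 y\<bar>" for y
    unfolding sum0 by blast+
  have m: "peak' e 0 \<in> borel_measurable borel"
    by (rule line_L2_measurable[OF \<phi>])
  show "conv ?p ?\<gamma> 0 = (2 - 2 / real N) * I (peak' e 0)"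
    by (rule fold[OF unfold_deriv_sqi[OF \<phi>] m]) (simp add: unfold_deriv_def unfold_def S algebra_simps)
  show "conv ?p ?e 0 = 2 / real N * I (\<lambda>y. \<bar>peak' e 0 y\<bar>)"
    by (rule fold[OF unfold_sqi[OF line_L2_abs[OF \<phi>]]]) (use m in \<open>simp_all add: unfold_def S\<close>)
qed

lemma gradient_bound_optimal:
  assumes N: "N \<ge> 2"
    and C: "\<forall>f\<in>Dom_E N. \<forall>t\<ge>0. \<forall>j<N. AE x in leg.
               sqrt (Gam (heat N t f) j x) \<le> C * heat N t (\<lambda>i y. sqrt (Gam f i y)) j x"
  shows "C \<ge> real N - 1"
proof -
  have N0: "N > 0"
    using N by simp
  let ?p = "heat_kernel 1"
  define I where "I = (\<lambda>h. \<integral>y. indicator {0..} y * (?p y * h y) \<partial>lborel)"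
  define E where "E = (\<lambda>a y::real. indicator {0..} y * exp (- (a * y)))"
  note p = bdd_L1_heat_kernel[of 1, simplified]
  note pm[measurable] = bdd_L1_measurable[OF p]
  have E_sqi: "E a \<in> sqi lborel" if "a > 0" for a
    unfolding E_def by (rule exp_half_line_sqi[OF that])
  have E_int: "integrable lborel (\<lambda>y. ?p y * E a y)" if "a > 0" for a
    by (rule sqi_integrable_mult[OF bdd_L1_sqi[OF p] E_sqi[OF that]])
  define A where "A = (\<integral>y. ?p y * E 1 y \<partial>lborel)"
  have A_pos: "A > 0"
  proof -
    have "0 < ?p 1 * exp (- 1)"
      by (simp add: heat_kernel_pos)
    also have "?p 1 * exp (- 1) = (\<integral>y. ?p 1 * exp (- 1) * indicator {0..1::real} y \<partial>lborel)"
      by simp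
    also have "\<dots> \<le> A"
      unfolding A_def
    proof (rule integral_mono)
      show "integrable lborel (\<lambda>y. ?p 1 * exp (- 1) * indicator {0..1::real} y)"
        by (intro Bochner_Integration.integrable_mult_right integrable_real_indicator) auto
      show "integrable lborel (\<lambda>y. ?p y * E 1 y)"
        by (rule E_int) simp
      show "?p 1 * exp (- 1) * indicator {0..1} y \<le> ?p y * E 1 y" for y
        using heat_kernel_mono[of 1 y 1]
        by (auto simp: E_def heat_kernel_nonneg intro!: mult_mono split: split_indicator)
    qed
    finally show ?thesis .
  qed
  have main: "(real N - 1) * (A - e) \<le> C * A + \<bar>C\<bar> * e" if e: "e > 0" for e
  proof -
    let ?\<gamma> = "unfold_deriv N (peak' e) 0" and ?g = "unfold N (\<lambda>i y. \<bar>peak' e i y\<bar>) 0"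
    note h = peak_H1[OF e, of N] and \<phi> = line_L2_peak'[OF e]
    have "peak e \<in> Dom_E N"
      unfolding Dom_E_iff using h by blast
    then have "AE x in leg. sqrt (Gam (heat N 1 (peak e)) 0 x)
        \<le> C * heat N 1 (\<lambda>i y. sqrt (Gam (peak e) i y)) 0 x"
      using C N0 by simp
    with sqrt_Gam_heat[OF N0 zero_less_one h \<phi> N0] heat_sqrt_Gam[OF N0 zero_less_one h \<phi> N0]
    have "AE x in leg. \<bar>conv ?p ?\<gamma> x\<bar> \<le> C * conv ?p ?g x"
      by eventually_elim simp
    from AE_leg_sequence[OF this] obtain X
      where X: "X \<longlonglongrightarrow> 0" "\<And>n. \<bar>conv ?p ?\<gamma> (X n)\<bar> \<le> C * conv ?p ?g (X n)"
      by blast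
    have "(\<lambda>n. \<bar>conv ?p ?\<gamma> (X n)\<bar>) \<longlonglongrightarrow> \<bar>conv ?p ?\<gamma> 0\<bar>"
      by (intro tendsto_rabs conv_continuous_0 bdd_L1_sqi p unfold_deriv_sqi \<phi> X)
    moreover have "(\<lambda>n. C * conv ?p ?g (X n)) \<longlonglongrightarrow> C * conv ?p ?g 0"
      by (intro tendsto_mult_left conv_continuous_0 bdd_L1_sqi p unfold_sqi line_L2_abs \<phi> X)
    ultimately have "\<bar>conv ?p ?\<gamma> 0\<bar> \<le> C * conv ?p ?g 0"
      by (rule LIMSEQ_le) (use X(2) in auto)
    then have vertex: "\<bar>(2 - 2 / real N) * I (peak' e 0)\<bar> \<le> C * (2 / real N * I (\<lambda>y. \<bar>peak' e 0 y\<bar>))"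
      unfolding conv_unfold_peak[OF N0 zero_less_one e] I_def .
    have ratio: "(real N - 1) * \<bar>I (peak' e 0)\<bar> \<le> C * I (\<lambda>y. \<bar>peak' e 0 y\<bar>)"
    proof -
      have "0 \<le> 2 - 2 / real N"
        using N by (simp add: field_simps)
      then have "real N / 2 * \<bar>(2 - 2 / real N) * a\<bar> = real N / 2 * (2 - 2 / real N) * \<bar>a\<bar>" for a
        by (simp only: abs_mult abs_of_nonneg mult.assoc)
      moreover have "real N / 2 * (2 - 2 / real N) = real N - 1"
        using N0 by (simp add: field_simps)
      moreover have "real N / 2 * (C * (2 / real N * b)) = C * b" for b
        using N0 by simp
      ultimately show ?thesis
        using mult_left_mono[OF vertex, of "real N / 2"] by (simp only:)
    qed
    have peak_eq: "indicator {0..} y * (?p y * peak' e 0 y) = ?p y * E 1 y - e * (?p y * E e y)" for y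
      by (auto simp: peak'_def E_def algebra_simps split: split_indicator)
    have Ee: "0 \<le> (\<integral>y. ?p y * E e y \<partial>lborel)" "(\<integral>y. ?p y * E e y \<partial>lborel) \<le> 1"
    proof -
      show "0 \<le> (\<integral>y. ?p y * E e y \<partial>lborel)"
        by (intro integral_nonneg_AE AE_I2) (simp add: E_def heat_kernel_nonneg)
      have "(\<integral>y. ?p y * E e y \<partial>lborel) \<le> (\<integral>y. ?p y \<partial>lborel)"
        using e by (intro integral_mono E_int bdd_L1_integrable p)
          (auto simp: E_def heat_kernel_nonneg mult_left_le split: split_indicator)
      then show "(\<integral>y. ?p y * E e y \<partial>lborel) \<le> 1"
        by (simp add: heat_kernel_integral)
    qed
    have I1: "A - e \<le> I (peak' e 0)"
    proof -
      have "I (peak' e 0) = A - e * (\<integral>y. ?p y * E e y \<partial>lborel)"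
        unfolding I_def peak_eq A_def using E_int[OF e] E_int[of 1] by simp
      moreover have "e * (\<integral>y. ?p y * E e y \<partial>lborel) \<le> e * 1"
        using Ee e by (intro mult_left_mono) auto
      ultimately show ?thesis
        by simp
    qed
    have I2: "\<bar>I (\<lambda>y. \<bar>peak' e 0 y\<bar>) - A\<bar> \<le> e"
    proof -
      have eq: "indicator {0..} y * (?p y * \<bar>peak' e 0 y\<bar>) = \<bar>?p y * E 1 y - e * (?p y * E e y)\<bar>" for y
        unfolding peak_eq[symmetric] by (simp add: abs_mult heat_kernel_nonneg)
      have int: "integrable lborel (\<lambda>y. ?p y * E 1 y - e * (?p y * E e y))"
        using E_int[OF e] E_int[of 1] by simp
      let ?J = "\<integral>y. \<bar>?p y * E 1 y - e * (?p y * E e y)\<bar> - ?p y * E 1 y \<partial>lborel"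
      have J: "I (\<lambda>y. \<bar>peak' e 0 y\<bar>) - A = (\<integral>y. \<bar>?p y * E 1 y - e * (?p y * E e y)\<bar> - ?p y * E 1 y \<partial>lborel)"
        unfolding I_def eq A_def using int E_int[of 1] by simp
      have "\<bar>?J\<bar> \<le> (\<integral>y. \<bar>\<bar>?p y * E 1 y - e * (?p y * E e y)\<bar> - ?p y * E 1 y\<bar> \<partial>lborel)"
        by (rule integral_abs_bound)
      also have "\<dots> \<le> (\<integral>y. e * (?p y * E e y) \<partial>lborel)"
      proof (rule integral_mono)
        show "integrable lborel (\<lambda>y. \<bar>\<bar>?p y * E 1 y - e * (?p y * E e y)\<bar> - ?p y * E 1 y\<bar>)"
          by (intro integrable_abs Bochner_Integration.integrable_diff int E_int zero_less_one)
        show "integrable lborel (\<lambda>y. e * (?p y * E e y))"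
          by (intro Bochner_Integration.integrable_mult_right E_int e)
        fix y
        have E_nonneg: "0 \<le> ?p y * E a y" for a
          by (simp add: E_def heat_kernel_nonneg)
        have "\<bar>\<bar>a - b\<bar> - a\<bar> \<le> b" if "0 \<le> a" "0 \<le> b" for a b :: real
          using that by linarith
        from this[OF E_nonneg mult_nonneg_nonneg[OF less_imp_le[OF e] E_nonneg]]
        show "\<bar>\<bar>?p y * E 1 y - e * (?p y * E e y)\<bar> - ?p y * E 1 y\<bar> \<le> e * (?p y * E e y)" .
      qed
      also have "\<dots> \<le> e"
        using Ee e by (simp add: mult_left_le)
      finally show ?thesis
        unfolding J .
    qed
    have "(real N - 1) * (A - e) \<le> (real N - 1) * \<bar>I (peak' e 0)\<bar>"
      using I1 N by (intro mult_left_mono) auto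
    also have "\<dots> \<le> C * I (\<lambda>y. \<bar>peak' e 0 y\<bar>)"
      by (rule ratio)
    also have "\<dots> = C * A + C * (I (\<lambda>y. \<bar>peak' e 0 y\<bar>) - A)"
      by (simp add: algebra_simps)
    also have "C * (I (\<lambda>y. \<bar>peak' e 0 y\<bar>) - A) \<le> \<bar>C\<bar> * e"
    proof -
      have "C * (I (\<lambda>y. \<bar>peak' e 0 y\<bar>) - A) \<le> \<bar>C\<bar> * \<bar>I (\<lambda>y. \<bar>peak' e 0 y\<bar>) - A\<bar>"
        by (simp flip: abs_mult)
      also have "\<dots> \<le> \<bar>C\<bar> * e"
        using I2 by (intro mult_left_mono) auto
      finally show ?thesis .
    qed
    finally show ?thesis
      by simp
  qed
  show ?thesis
  proof (rule ccontr)
    assume "\<not> real N - 1 \<le> C"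
    define D where "D = (real N - 1 - C) * A"
    have D: "D > 0"
      using \<open>\<not> real N - 1 \<le> C\<close> A_pos by (simp add: D_def)
    define K where "K = \<bar>C\<bar> + real N"
    have K: "K > 0"
      using N by (simp add: K_def)
    \<comment> \<open>the error terms amount to at most \<open>(K - 1) * e\<close>\<close>
    define e where "e = D / K"
    have "D \<le> (K - 1) * e"
    proof -
      have "e > 0"
        using D K by (simp add: e_def)
      from main[OF this] show ?thesis
        by (simp add: D_def K_def algebra_simps)
    qed
    also have "\<dots> < D"
      using D K by (simp add: e_def field_simps)
    finally show False
      by simp
  qed
qed

theorem mainTheorem13:
  fixes N :: nat
  assumes "N \<ge> 2"
  shows "(\<forall>f\<in>Dom_E N. \<forall>t\<ge>0. \<forall>j<N. AE x in leg.
            sqrt (Gam (heat N t f) j x)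
              \<le> (real N - 1) * heat N t (\<lambda>i y. sqrt (Gam f i y)) j x)
       \<and> (\<forall>C::real.
            (\<forall>f\<in>Dom_E N. \<forall>t\<ge>0. \<forall>j<N. AE x in leg.
               sqrt (Gam (heat N t f) j x) \<le> C * heat N t (\<lambda>i y. sqrt (Gam f i y)) j x)
            \<longrightarrow> C \<ge> real N - 1)"
  using gradient_bound[OF assms] gradient_bound_optimal[OF assms] by blast

end
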